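(* Let $\Gamma$ be a stationary Poisson process on $\mathbb R^d$ with intensity $\gamma>0$, with Voronoi cells $C(x)=C(x,\Gamma)$, $x\in\Gamma$. Let $W\subset\mathbb R^d$ be a measurable set with $\lambda_d(W)<\infty$ and $0$ as an interior point, and let $\alpha\in(0,1]$. For $x\in\Gamma$ define $$\tau(x):=\sup\{r\ge0:\lambda_d((rW+x)\cap C(x))\le\alpha\lambda_d(C(x))\},\qquad D(x):=(\tau(x)W+x)\cap C(x),$$ and let $Z:=\bigcup_{x\in\Gamma}D(x)$. Then the random volume measure $\Psi$ defined by $$\Psi(B):=\lambda_d(Z\cap B)=\int\lambda_d(D(x)\cap B)\,\Gamma(\mathrm dx),\quad B\subset\mathbb R^d\text{ Borel},$$ is hyperuniform.
   Context: $\lambda_d$ is Lebesgue measure on $\mathbb R^d$. For a locally finite set $\varphi\ne\emptyset$ of points and $x\in\mathbb R^d$, $N(x,\varphi)$ denotes the nearest point of $\varphi$ to $x$ (the lexicographically smallest in case of ties), and the Voronoi cell is $C(x,\varphi):=\{y\in\mathbb R^d:N(y,\varphi)=N(x,\varphi)\}$. If $\tau(x)=\infty$ (which happens for $\alpha=1$), then $\tau(x)W+x$ is understood as $\mathbb R^d$, so that $D(x)=C(x)$. A stationary random measure $\Psi$ with $\mathbb E\Psi(B)^2<\infty$ for bounded Borel $B$ is hyperuniform if $\lim_{r\to\infty}\lambda_d(B_r)^{-1}\operatorname{Var}[\Psi(B_r)]=0$, where $B_r$ is the ball of radius $r$ centred at $0$. *)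

theory Defs
  imports "HOL-Probability.Probability"
begin

section \<open>Point processes and Poisson processes\<close>

definition locally_finite :: "'a::metric_space set \<Rightarrow> bool" where
  "locally_finite \<phi> \<longleftrightarrow> (\<forall>B. bounded B \<longrightarrow> finite (\<phi> \<inter> B))"

definition point_count :: "'a set \<Rightarrow> 'a set \<Rightarrow> ennreal" where
  "point_count \<phi> B = emeasure (count_space UNIV) (\<phi> \<inter> B)"

text \<open>A (simple) point process is identified with the random locally finite set of its points.\<close>

definition point_process :: "'w measure \<Rightarrow> ('w \<Rightarrow> 'a::euclidean_space set) \<Rightarrow> bool" where
  "point_process M \<Gamma> \<longleftrightarrow>
     (\<forall>\<omega>\<in>space M. locally_finite (\<Gamma> \<omega>)) \<and>
     (\<forall>B\<in>sets borel. (\<lambda>\<omega>. point_count (\<Gamma> \<omega>) B) \<in> borel_measurable M)"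

text \<open>Poisson process with a diffuse intensity measure \<open>\<Lambda>\<close> on a probability space \<open>M\<close>
  (an intensity measure with atoms would require multiple points, which sets cannot represent).
  The Poisson distribution with parameter \<open>\<infinity>\<close> is the point mass at \<open>\<infinity>\<close>. The probabilities are
  written out because the library's Poisson distribution needs a positive parameter, whereas
  \<open>\<Lambda> B = 0\<close> must be allowed.\<close>

definition poisson_process ::
    "'w measure \<Rightarrow> ('w \<Rightarrow> 'a::euclidean_space set) \<Rightarrow> 'a measure \<Rightarrow> bool" where
  "poisson_process M \<Gamma> \<Lambda> \<longleftrightarrow>
     point_process M \<Gamma> \<and>
     (\<forall>B\<in>sets borel. emeasure \<Lambda> B < \<infinity> \<longrightarrow>
        (\<forall>k::nat. measure M {\<omega>\<in>space M. point_count (\<Gamma> \<omega>) B = of_nat k} =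
           measure \<Lambda> B ^ k / fact k * exp (- measure \<Lambda> B))) \<and>
     (\<forall>B\<in>sets borel. emeasure \<Lambda> B = \<infinity> \<longrightarrow> (AE \<omega> in M. point_count (\<Gamma> \<omega>) B = \<infinity>)) \<and>
     (\<forall>(m::nat) B. (\<forall>i<m. B i \<in> sets borel) \<longrightarrow> disjoint_family_on B {..<m} \<longrightarrow>
        prob_space.indep_vars M (\<lambda>_. borel) (\<lambda>i \<omega>. point_count (\<Gamma> \<omega>) (B i)) {..<m})"

text \<open>A Poisson process is stationary with intensity \<open>\<gamma>\<close> iff its intensity measure is \<open>\<gamma>\<close> times
  Lebesgue measure.\<close>

definition stationary_poisson_process ::
    "'w measure \<Rightarrow> ('w \<Rightarrow> 'a::euclidean_space set) \<Rightarrow> real \<Rightarrow> bool" where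
  "stationary_poisson_process M \<Gamma> \<gamma> \<longleftrightarrow>
     poisson_process M \<Gamma> (scale_measure (ennreal \<gamma>) lborel)"

section \<open>Random measures and hyperuniformity\<close>

text \<open>The space of locally finite Borel measures, with the \<open>\<sigma>\<close>-algebra generated by the
  evaluation maps at Borel sets.\<close>

definition lf_measures :: "'a::euclidean_space measure set" where
  "lf_measures = {\<mu>. sets \<mu> = sets borel \<and>
     (\<forall>B\<in>sets borel. bounded B \<longrightarrow> emeasure \<mu> B < \<infinity>)}"

definition lf_measure_algebra :: "'a::euclidean_space measure measure" where
  "lf_measure_algebra =
     (SUP B\<in>sets borel. vimage_algebra lf_measures (\<lambda>\<mu>. emeasure \<mu> B) borel)"

definition random_measure :: "'w measure \<Rightarrow> ('w \<Rightarrow> 'a::euclidean_space measure) \<Rightarrow> bool" where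
  "random_measure M \<Psi> \<longleftrightarrow> \<Psi> \<in> M \<rightarrow>\<^sub>M lf_measure_algebra"

text \<open>\<open>shift_measure y \<mu>\<close> maps \<open>B\<close> to \<open>\<mu> (B + y)\<close>.\<close>

definition shift_measure :: "'a::euclidean_space \<Rightarrow> 'a measure \<Rightarrow> 'a measure" where
  "shift_measure y \<mu> = distr \<mu> borel (\<lambda>z. z - y)"

definition stationary_random_measure ::
    "'w measure \<Rightarrow> ('w \<Rightarrow> 'a::euclidean_space measure) \<Rightarrow> bool" where
  "stationary_random_measure M \<Psi> \<longleftrightarrow>
     random_measure M \<Psi> \<and>
     (\<forall>y. distr M lf_measure_algebra (\<lambda>\<omega>. shift_measure y (\<Psi> \<omega>)) =
          distr M lf_measure_algebra \<Psi>)"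

definition hyperuniform :: "'w measure \<Rightarrow> ('w \<Rightarrow> 'a::euclidean_space measure) \<Rightarrow> bool" where
  "hyperuniform M \<Psi> \<longleftrightarrow>
     stationary_random_measure M \<Psi> \<and>
     (\<forall>B\<in>sets borel. bounded B \<longrightarrow> (\<integral>\<^sup>+\<omega>. emeasure (\<Psi> \<omega>) B ^ 2 \<partial>M) < \<infinity>) \<and>
     ((\<lambda>r. prob_space.variance M (\<lambda>\<omega>. measure (\<Psi> \<omega>) (cball 0 r)) /
           measure lborel (cball (0::'a) r)) \<longlongrightarrow> 0) at_top"

section \<open>Voronoi cells and the restricted cells\<close>

text \<open>The coordinates of \<open>\<real>\<^sup>d\<close> are indexed by a linearly ordered finite type with \<open>d\<close> elements,
  so that the lexicographic order makes sense.\<close>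

definition lex_less_eq ::
    "real ^ 'n::{finite,linorder} \<Rightarrow> real ^ 'n::{finite,linorder} \<Rightarrow> bool" where
  "lex_less_eq x y \<longleftrightarrow> x = y \<or> (\<exists>i. x $ i < y $ i \<and> (\<forall>j<i. x $ j = y $ j))"

definition nearest_point ::
    "real ^ 'n::{finite,linorder} \<Rightarrow> (real ^ 'n::{finite,linorder}) set \<Rightarrow>
     real ^ 'n::{finite,linorder}" where
  "nearest_point x \<phi> = (THE p. p \<in> \<phi> \<and> (\<forall>q\<in>\<phi>. dist x p \<le> dist x q) \<and>
     (\<forall>q\<in>\<phi>. dist x q = dist x p \<longrightarrow> lex_less_eq p q))"

definition voronoi_cell ::
    "real ^ 'n::{finite,linorder} \<Rightarrow> (real ^ 'n::{finite,linorder}) set \<Rightarrow>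
     (real ^ 'n::{finite,linorder}) set" where
  "voronoi_cell x \<phi> = {y. nearest_point y \<phi> = nearest_point x \<phi>}"

definition scaled_copy :: "real \<Rightarrow> 'a::real_vector set \<Rightarrow> 'a \<Rightarrow> 'a set" where
  "scaled_copy r W x = (\<lambda>w. r *\<^sub>R w + x) ` W"

definition cell_radius ::
    "(real ^ 'n::{finite,linorder}) set \<Rightarrow> real \<Rightarrow> (real ^ 'n::{finite,linorder}) set \<Rightarrow>
     real ^ 'n::{finite,linorder} \<Rightarrow> ennreal" where
  "cell_radius W \<alpha> \<phi> x = Sup (ennreal ` {r. 0 \<le> r \<and>
     emeasure lebesgue (scaled_copy r W x \<inter> voronoi_cell x \<phi>)
       \<le> ennreal \<alpha> * emeasure lebesgue (voronoi_cell x \<phi>)})"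

definition restricted_cell ::
    "(real ^ 'n::{finite,linorder}) set \<Rightarrow> real \<Rightarrow> (real ^ 'n::{finite,linorder}) set \<Rightarrow>
     real ^ 'n::{finite,linorder} \<Rightarrow> (real ^ 'n::{finite,linorder}) set"
  where
  "restricted_cell W \<alpha> \<phi> x =
     (if cell_radius W \<alpha> \<phi> x = \<infinity> then UNIV
      else scaled_copy (enn2real (cell_radius W \<alpha> \<phi> x)) W x) \<inter> voronoi_cell x \<phi>"

definition restricted_union ::
    "(real ^ 'n::{finite,linorder}) set \<Rightarrow> real \<Rightarrow> (real ^ 'n::{finite,linorder}) set \<Rightarrow>
     (real ^ 'n::{finite,linorder}) set" where
  "restricted_union W \<alpha> \<phi> = (\<Union>x\<in>\<phi>. restricted_cell W \<alpha> \<phi> x)"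

definition volume_measure :: "'a::euclidean_space set \<Rightarrow> 'a measure" where
  "volume_measure Z = measure_of UNIV (sets borel) (\<lambda>B. emeasure lebesgue (Z \<inter> B))"

end

(* Since the volume of (r W + x) \<inter> C depends continuously on r and W contains a ball around 0, each
   restricted cell D(x) has exactly the fraction \<alpha> of the volume of C(x). Hence
   Psi(B) - \<alpha> \<lambda>(B) only involves the cells that are not contained in B = B_r, and it is the
   integral over B of a field Y with |Y| \<le> 1 that vanishes on the cells inside B. If every point near u
   has a point of the process within distance d, then Y(u) is determined by the process in the ball
   of radius 5 d around u, and Y(u) = 0 unless u is within distance 3 d of the boundary of B. The
   exceptional event has probability O(exp(- c d^D)), where D is the dimension; off this event the
   field has dependence range 10 d, so its integral has variance O(r^(D-1) d^(D+1)).
   The choice d = r^(1/(2(D+1))) makes both contributions o(r^D).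

   Void events form a generator of the counting sigma-algebra that is stable under intersection
   (Renyi), so the void probabilities alone yield the stationarity and the independence needed. *)
theory Submission
  imports Defs
begin

section \<open>Voronoi cells\<close>

text \<open>Since W need not be star-shaped, the volume of (r W + x) \<inter> C need not be monotone
  in r. The exact fraction \<alpha> is therefore obtained at the supremum t of the admissible radii:
  closedness of the set of admissible radii gives one inequality at t, continuity from the right the
  other. The identity is pointwise in the configuration and includes cells of infinite volume, so no
  null set of configurations has to be discarded. The other obstacle is measurability, because Z
  involves uncountably many points, volumes of cells and a supremum of radii. For this W is replaced
  by a Borel subset of full volume, which changes no value of Psi. Near u means within 4 d: this
  leaves room for the sphere of radius 3 d that the cell of u cannot cross, and deciding it takes
  points within 4 d + d/2 < 5 d.\<close>

definition closer :: "real ^ 'n::{finite,linorder} \<Rightarrow> real ^ 'n::{finite,linorder} \<Rightarrow>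
    real ^ 'n::{finite,linorder} \<Rightarrow> bool" where
  "closer u q p \<longleftrightarrow>
     dist u q < dist u p \<or> (dist u q = dist u p \<and> q \<noteq> p \<and> lex_less_eq q p)"

text \<open>A form of the Voronoi cell without definite description. It also makes sense for x
  outside \<phi>, so that x can be a free variable in measurability arguments, and it is visibly
  antitone in \<phi>.\<close>

definition cell :: "(real ^ 'n::{finite,linorder}) set \<Rightarrow> real ^ 'n::{finite,linorder} \<Rightarrow>
    (real ^ 'n::{finite,linorder}) set" where
  "cell \<phi> x = {y. \<forall>z\<in>\<phi>. \<not> closer y z x}"

section \<open>The order of points by distance with lexicographic ties\<close>

lemma lex_less_eq_antisym:
  assumes "lex_less_eq x y" "lex_less_eq y x" shows "x = y"
proof (rule ccontr)
  assume "x \<noteq> y"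
  then obtain i j where "x $ i < y $ i" "\<forall>k<i. x $ k = y $ k" "y $ j < x $ j" "\<forall>k<j. y $ k = x $ k"
    using assms unfolding lex_less_eq_def by metis
  then show False by (cases i j rule: linorder_cases) auto
qed

lemma lex_less_eq_trans:
  assumes "lex_less_eq x y" "lex_less_eq y z" shows "lex_less_eq x z"
proof (cases "x = y \<or> y = z")
  case False
  then obtain i j where ij: "x $ i < y $ i" "\<forall>k<i. x $ k = y $ k" "y $ j < z $ j" "\<forall>k<j. y $ k = z $ k"
    using assms unfolding lex_less_eq_def by metis
  \<comment> \<open>Both witnesses are first positions of difference, so the smaller of the two is
    the first position where x and z differ.\<close>
  have "x $ (min i j) < z $ (min i j) \<and> (\<forall>k<min i j. x $ k = z $ k)"
    using ij by (cases i j rule: linorder_cases) (auto simp: min_def)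
  then show ?thesis unfolding lex_less_eq_def by blast
qed (use assms in auto)

lemma lex_less_eq_total: "lex_less_eq x y \<or> lex_less_eq y x"
proof (cases "x = y")
  case False
  define i where "i = Min {i. x $ i \<noteq> y $ i}"
  have ne: "{i. x $ i \<noteq> y $ i} \<noteq> {}" using False by (auto simp: vec_eq_iff)
  have "x $ i \<noteq> y $ i" using Min_in[OF _ ne] by (auto simp: i_def)
  moreover have "\<forall>k<i. x $ k = y $ k"
  proof safe
    fix k assume "k < i"
    then show "x $ k = y $ k"
      using Min_le[of "{i. x $ i \<noteq> y $ i}" k] by (fastforce simp: i_def)
  qed
  ultimately show ?thesis unfolding lex_less_eq_def by (metis linorder_neqE)
qed (simp add: lex_less_eq_def)

lemma closer_irrefl [simp]: "\<not> closer u p p"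
  by (simp add: closer_def)

text \<open>Together with irreflexivity, asymmetry and transitivity this makes
  \<open>closer u\<close> a strict linear order for each fixed u; the nearest point of u is its
  minimum on \<phi>.\<close>

lemma closer_total: "p \<noteq> q \<Longrightarrow> closer u p q \<or> closer u q p"
  using lex_less_eq_total[of p q] by (auto simp: closer_def)

lemma closer_asym: "closer u p q \<Longrightarrow> \<not> closer u q p"
  using lex_less_eq_antisym[of p q] by (auto simp: closer_def)

lemma closer_trans: "closer u p q \<Longrightarrow> closer u q s \<Longrightarrow> closer u p s"
  using lex_less_eq_trans[of p q s] lex_less_eq_antisym[of p q] by (auto simp: closer_def)

lemma not_closer_dist_le: "\<not> closer u q p \<Longrightarrow> dist u p \<le> dist u q"
  by (auto simp: closer_def)

lemma closer_dist_le: "closer u q p \<Longrightarrow> dist u q \<le> dist u p"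
  by (auto simp: closer_def)

lemma closer_translate: "closer (u - a) (q - a) (p - a) \<longleftrightarrow> closer u q p"
  by (simp add: closer_def lex_less_eq_def dist_norm)

section \<open>Locally finite sets and existence of the nearest point\<close>

lemma locally_finite_subset: "locally_finite \<phi> \<Longrightarrow> \<psi> \<subseteq> \<phi> \<Longrightarrow> locally_finite \<psi>"
  unfolding locally_finite_def by (meson Int_mono finite_subset subset_refl)

lemma locally_finite_translation:
  fixes \<phi> :: "'a::euclidean_space set"
  assumes "locally_finite \<phi>" shows "locally_finite ((\<lambda>x. x - a) ` \<phi>)"
  unfolding locally_finite_def
proof safe
  fix B :: "'a set" assume "bounded B"
  then have "bounded ((\<lambda>x. x + a) ` B)" by (metis add.commute bounded_translation image_cong)
  then have "finite (\<phi> \<inter> (\<lambda>x. x + a) ` B)" using assms by (simp add: locally_finite_def)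
  then have "finite ((\<lambda>x. x - a) ` (\<phi> \<inter> (\<lambda>x. x + a) ` B))" by blast
  then show "finite ((\<lambda>x. x - a) ` \<phi> \<inter> B)" by (rule rev_finite_subset) force
qed

lemma countable_locally_finite:
  fixes \<phi> :: "'a::euclidean_space set"
  assumes "locally_finite \<phi>" shows "countable \<phi>"
proof -
  have "\<phi> = (\<Union>n::nat. \<phi> \<inter> cball 0 (real n))"
    using real_arch_simple by (auto simp: mem_cball_0)
  moreover have "countable (\<Union>n::nat. \<phi> \<inter> cball 0 (real n))"
    using assms by (intro countable_UN) (auto simp: locally_finite_def intro!: countable_finite)
  ultimately show ?thesis by simp
qed

text \<open>Only points no farther from u than a given p can compete with p. They lie in a closed
  ball, hence are finite in number, and a finite nonempty set has a minimal element for
  \<open>closer u\<close>.\<close>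

lemma ex_closest:
  fixes u :: "real ^ 'n::{finite,linorder}"
  assumes "locally_finite \<phi>" "\<phi> \<noteq> {}"
  obtains x where "x \<in> \<phi>" "u \<in> cell \<phi> x"
proof -
  obtain p where p: "p \<in> \<phi>" using assms by blast
  define F where "F = \<phi> \<inter> cball u (dist u p)"
  have "finite F" "p \<in> F" using assms p by (auto simp: F_def locally_finite_def)
  then obtain x where x: "x \<in> F" "\<forall>z\<in>F. z \<noteq> x \<longrightarrow> \<not> closer u z x"
    using Finite_Set.bex_min_element[of F "closer u"] closer_trans closer_asym
    by (metis asymp_onI empty_iff transp_onI)
  have "\<not> closer u z x" if "z \<in> \<phi>" for z
  proof
    assume c: "closer u z x"
    have "dist u z \<le> dist u p" using closer_dist_le[OF c] x by (auto simp: F_def)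
    then have "z \<in> F" using that by (simp add: F_def)
    then show False using x c by (metis closer_irrefl)
  qed
  then show ?thesis using that x by (auto simp: F_def cell_def)
qed

lemma cell_unique: "u \<in> cell \<phi> x \<Longrightarrow> u \<in> cell \<phi> y \<Longrightarrow> x \<in> \<phi> \<Longrightarrow> y \<in> \<phi> \<Longrightarrow> x = y"
  using closer_total[of x y u] by (auto simp: cell_def)

text \<open>Removes the definite description: \<open>ex_closest\<close> supplies existence and
  \<open>cell_unique\<close> uniqueness.\<close>

lemma nearest_point_eq_iff:
  fixes u :: "real ^ 'n::{finite,linorder}"
  assumes "locally_finite \<phi>" "\<phi> \<noteq> {}"
  shows "nearest_point u \<phi> = x \<longleftrightarrow> x \<in> \<phi> \<and> u \<in> cell \<phi> x"
proof -
  have *: "(p \<in> \<phi> \<and> (\<forall>q\<in>\<phi>. dist u p \<le> dist u q) \<and> (\<forall>q\<in>\<phi>. dist u q = dist u p \<longrightarrow> lex_less_eq p q))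
     \<longleftrightarrow> p \<in> \<phi> \<and> u \<in> cell \<phi> p" for p
    unfolding cell_def closer_def mem_Collect_eq
    using lex_less_eq_total lex_less_eq_antisym by (smt (verit, best))
  obtain x0 where x0: "x0 \<in> \<phi>" "u \<in> cell \<phi> x0" using ex_closest[OF assms] by blast
  have "nearest_point u \<phi> = x0"
    unfolding nearest_point_def * using x0 cell_unique by blast
  then show ?thesis using x0 cell_unique by blast
qed

lemma in_own_cell: "x \<in> cell \<phi> x"
  by (auto simp: cell_def closer_def)

lemma voronoi_cell_eq_cell:
  fixes x :: "real ^ 'n::{finite,linorder}"
  assumes "locally_finite \<phi>" "x \<in> \<phi>"
  shows "voronoi_cell x \<phi> = cell \<phi> x"
proof -
  have ne: "\<phi> \<noteq> {}" using assms by blast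
  have "nearest_point x \<phi> = x"
    using nearest_point_eq_iff[OF assms(1) ne] assms(2) in_own_cell by blast
  then show ?thesis
    unfolding voronoi_cell_def by (simp only: \<open>nearest_point x \<phi> = x\<close>)
      (simp add: nearest_point_eq_iff[OF assms(1) ne] assms(2))
qed

section \<open>Translation, monotonicity and convexity of cells\<close>

lemma cell_translate: "cell ((\<lambda>x. x - a) ` \<phi>) (x - a) = (\<lambda>x. x - a) ` cell \<phi> x"
proof -
  have "y \<in> cell ((\<lambda>x. x - a) ` \<phi>) (x - a) \<longleftrightarrow> y + a \<in> cell \<phi> x" for y
    using closer_translate[of "y + a" a] by (auto simp: cell_def)
  then show ?thesis by (force simp: image_iff)
qed

lemma cell_antimono: "\<psi> \<subseteq> \<phi> \<Longrightarrow> cell \<phi> x \<subseteq> cell \<psi> x"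
  by (auto simp: cell_def)

text \<open>Squaring the distances cancels the square of w, so the points at least as close to x as
  to z form a half-space, which is convex and contains both x and y. Only the weak inequality is
  claimed, which avoids tracking ties along the segment.\<close>

lemma cell_segment:
  assumes "y \<in> cell \<phi> x" "w \<in> closed_segment x y" "z \<in> \<phi>"
  shows "dist w x \<le> dist w z"
proof -
  have y: "dist y x \<le> dist y z" using assms not_closer_dist_le by (auto simp: cell_def)
  define H where "H = {w. dist w x \<le> dist w z}"
  have "H = {w. (2 *\<^sub>R (z - x)) \<bullet> w \<le> z \<bullet> z - x \<bullet> x}"
    unfolding H_def dist_norm norm_le by (auto simp: inner_diff inner_commute algebra_simps)
  then have "convex H" using convex_halfspace_le[of "2 *\<^sub>R (z - x)"] by metis
  moreover have "x \<in> H" "y \<in> H" using y by (auto simp: H_def)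
  ultimately have "closed_segment x y \<subseteq> H" by (simp add: closed_segment_subset)
  then show ?thesis using assms by (auto simp: H_def)
qed

text \<open>If every point within distance \<open>4 d\<close> of \<open>u\<close> has a point of \<open>\<phi>\<close> within distance
  \<open>d\<close>, then the cell containing \<open>u\<close> is determined by \<open>\<phi>\<close> near \<open>u\<close>. This hypothesis is phrased
  through a finite set of directions \<open>T\<close> so that its probability can be estimated.\<close>

definition filled :: "'a::euclidean_space set \<Rightarrow> 'a \<Rightarrow> real \<Rightarrow> 'a set \<Rightarrow> bool" where
  "filled T u d \<phi> \<longleftrightarrow> (\<forall>t\<in>T. \<phi> \<inter> ball (u + d *\<^sub>R t) (d/2) \<noteq> {})"

text \<open>Scaled by d and moved to u, the balls of radius 1/2 become balls of radius d/2 covering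
  the closed ball of radius 4 d. A point y and a point of \<phi> in the same small ball are less
  than d apart. T does not depend on d or u, so its cardinality enters the estimates as a
  constant.\<close>

definition covering :: "'a::euclidean_space set \<Rightarrow> bool" where
  "covering T \<longleftrightarrow> finite T \<and> T \<subseteq> cball 0 4 \<and> cball 0 4 \<subseteq> (\<Union>t\<in>T. ball t (1/2))"

lemma ex_covering: "\<exists>T::'a::euclidean_space set. covering T"
proof -
  have "compact (cball (0::'a) 4)" by simp
  then obtain T where "T \<subseteq> cball 0 4" "finite T" "cball (0::'a) 4 \<subseteq> (\<Union>t\<in>T. ball t (1/2))"
    by (rule compactE_image[of _ "cball (0::'a) 4" "\<lambda>t. ball t (1/2)"]) force+
  then show ?thesis by (auto simp: covering_def)
qed

text \<open>The small balls have centres within 4 d of u and radius d/2, so they stay inside the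
  ball of radius 5 d.\<close>

lemma filled_local:
  assumes "covering T" "d > 0"
  shows "filled T u d (\<phi> \<inter> ball u (5 * d)) \<longleftrightarrow> filled T u d \<phi>"
proof -
  have "ball (u + d *\<^sub>R t) (d/2) \<subseteq> ball u (5 * d)" if "t \<in> T" for t
  proof -
    have "norm t \<le> 4" using that assms by (auto simp: covering_def mem_cball_0)
    then have "norm (d *\<^sub>R t) \<le> 4 * d" using assms by simp
    show ?thesis
    proof
      fix y assume "y \<in> ball (u + d *\<^sub>R t) (d/2)"
      then have "dist (u + d *\<^sub>R t) y < d/2" by simp
      moreover have "dist u y \<le> dist u (u + d *\<^sub>R t) + dist (u + d *\<^sub>R t) y" by (rule dist_triangle)
      moreover have "dist u (u + d *\<^sub>R t) \<le> 4 * d" using \<open>norm (d *\<^sub>R t) \<le> 4 * d\<close> by (simp add: dist_norm)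
      ultimately show "y \<in> ball u (5 * d)" using assms by simp
    qed
  qed
  then show ?thesis unfolding filled_def by (smt (verit, best) Int_assoc inf.absorb_iff2)
qed

lemma filled_near:
  assumes "covering T" "d > 0" "filled T u d \<phi>" "dist u y \<le> 4 * d"
  obtains z where "z \<in> \<phi>" "dist y z < d"
proof -
  have "(y - u) /\<^sub>R d \<in> cball 0 4" using assms by (simp add: dist_norm norm_minus_commute divide_simps)
  then obtain t where t: "t \<in> T" "dist t ((y - u) /\<^sub>R d) < 1/2"
    using assms by (force simp: covering_def)
  have "dist (u + d *\<^sub>R t) y = norm (d *\<^sub>R (t - (y - u) /\<^sub>R d))"
    using assms(2) by (simp add: dist_norm algebra_simps)
  also have "\<dots> < d / 2" using t assms(2) by (simp add: dist_norm)
  finally have 1: "dist (u + d *\<^sub>R t) y < d / 2" .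
  obtain z where z: "z \<in> \<phi>" "dist (u + d *\<^sub>R t) z < d/2"
    using assms(3) t by (force simp: filled_def)
  have "dist y z < d" using 1 z dist_triangle3[of y z "u + d *\<^sub>R t"] by simp
  then show ?thesis using that z by blast
qed

text \<open>The hypothesis says nothing far from u, so a distant point of the cell cannot be refuted
  directly. Instead the segment from the nucleus x to it meets the sphere of radius 3 d around u in
  some w; a point of \<phi> lies within d of w, hence by \<open>cell_segment\<close> so does x, and
  x is within d of u. This puts w within 2 d of u, a contradiction.\<close>

lemma filled_cell_bounded:
  assumes "covering T" "d > 0" "filled T u d \<phi>" "u \<in> cell \<phi> x"
  shows "dist u x < d" "cell \<phi> x \<subseteq> ball u (3 * d)"
proof -
  obtain z where "z \<in> \<phi>" "dist u z < d" using filled_near[OF assms(1-3), of u] assms(2) by auto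
  then show ux: "dist u x < d" using assms(4) not_closer_dist_le by (fastforce simp: cell_def)
  show "cell \<phi> x \<subseteq> ball u (3 * d)"
  proof (rule ccontr)
    assume "\<not> ?thesis"
    then obtain y where y: "y \<in> cell \<phi> x" "dist u y \<ge> 3 * d" by (auto simp: not_less subset_iff)
    \<comment> \<open>Intermediate value theorem: the distance from u has connected image on the
      segment, is below d at x and at least 3 d at y.\<close>
    have "\<exists>w\<in>closed_segment x y. dist u w = 3 * d"
    proof -
      have "connected (dist u ` closed_segment x y)"
        by (intro connected_continuous_image continuous_intros) auto
      moreover have "dist u x \<in> dist u ` closed_segment x y" "dist u y \<in> dist u ` closed_segment x y"
        by auto
      moreover have "dist u x \<le> 3 * d" using ux assms(2) by simp
      ultimately show ?thesis using y(2) by (metis (no_types, lifting) connectedD_interval imageE)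
    qed
    then obtain w where w: "w \<in> closed_segment x y" "dist u w = 3 * d" by blast
    then obtain z where z: "z \<in> \<phi>" "dist w z < d" using filled_near[OF assms(1-3), of w] assms(2) by auto
    have "dist w x < d" using cell_segment[OF y(1) w(1) z(1)] z by simp
    then have "dist u w < 2 * d" using ux dist_triangle2[of u w x] by simp
    then show False using w assms(2) by simp
  qed
qed

text \<open>Deleting the points outside the ball could only enlarge the cell. The enlarged cell
  still lies within 3 d of u, because \<psi> is filled as well, and each of its points y is within d
  of x, whereas every deleted point is more than 2 d away from y. So no deleted point was needed to
  cut the cell.\<close>

lemma filled_cell_local:
  assumes "covering T" "d > 0" "filled T u d \<phi>" and A: "\<psi> = \<phi> \<inter> ball u (5 * d)"
    and x: "x \<in> \<phi>" "u \<in> cell \<phi> x"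
  shows "x \<in> \<psi>" "cell \<psi> x = cell \<phi> x"
proof -
  have ux: "dist u x < d" using filled_cell_bounded[OF assms(1-3) x(2)] by simp
  then show "x \<in> \<psi>" using x assms(2) by (simp add: A)
  have \<psi>: "filled T u d \<psi>" using filled_local assms by blast
  have "u \<in> cell \<psi> x" using x(2) cell_antimono[of \<psi> \<phi> x] A by auto
  note B = filled_cell_bounded[OF assms(1,2) \<psi> this]
  show "cell \<psi> x = cell \<phi> x"
  proof
    show "cell \<phi> x \<subseteq> cell \<psi> x" using cell_antimono[of \<psi> \<phi> x] A by auto
    show "cell \<psi> x \<subseteq> cell \<phi> x"
    proof
      fix y assume y: "y \<in> cell \<psi> x"
      then have uy: "dist u y < 3 * d" using B by auto
      obtain z where z: "z \<in> \<psi>" "dist y z < d" using filled_near[OF assms(1,2) \<psi>, of y] uy assms(2) by auto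
      then have yx: "dist y x < d" using y not_closer_dist_le by (fastforce simp: cell_def)
      have "\<not> closer y z x" if "z \<in> \<phi>" for z
      proof (cases "z \<in> \<psi>")
        case False
        then have "dist u z \<ge> 5 * d" using that by (auto simp: A)
        then have "dist y z > 2 * d" using uy dist_triangle[of u z y] by simp
        then show ?thesis using yx assms(2) by (auto simp: closer_def)
      qed (use y in \<open>auto simp: cell_def\<close>)
      then show "y \<in> cell \<phi> x" by (simp add: cell_def)
    qed
  qed
qed

section \<open>Measurability for point processes\<close>

lemma point_process_finite:
  "point_process P \<phi> \<Longrightarrow> p \<in> space P \<Longrightarrow> bounded B \<Longrightarrow> finite (\<phi> p \<inter> B)"
  by (auto simp: point_process_def locally_finite_def)

lemma point_process_compose:
  assumes "point_process M \<phi>" "f \<in> N \<rightarrow>\<^sub>M M"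
  shows "point_process N (\<lambda>p. \<phi> (f p))"
  using assms unfolding point_process_def
  by (auto intro: measurable_compose[OF assms(2)] dest: measurable_space)

lemma point_process_Int:
  assumes "point_process M \<phi>" "A \<in> sets borel"
  shows "point_process M (\<lambda>\<omega>. \<phi> \<omega> \<inter> A)"
  unfolding point_process_def
proof (intro conjI ballI)
  fix \<omega> assume "\<omega> \<in> space M"
  then show "locally_finite (\<phi> \<omega> \<inter> A)"
    using assms(1) locally_finite_subset[of "\<phi> \<omega>" "\<phi> \<omega> \<inter> A"] by (auto simp: point_process_def)
next
  fix B :: "'b set" assume "B \<in> sets borel"
  then have "A \<inter> B \<in> sets borel" using assms by auto
  then have "(\<lambda>\<omega>. point_count (\<phi> \<omega>) (A \<inter> B)) \<in> borel_measurable M"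
    using assms by (simp add: point_process_def)
  then show "(\<lambda>\<omega>. point_count (\<phi> \<omega> \<inter> A) B) \<in> borel_measurable M"
    by (simp add: point_count_def Int_assoc)
qed

text \<open>Induction over the intersection-stable rectangles generating the product algebra. The
  bounded set B keeps all counts finite, so that the count on a complement is a difference;
  \<open>measurable_point_count_section\<close> removes B by exhaustion with balls.\<close>

lemma measurable_point_count_bounded_section:
  fixes \<phi> :: "'p \<Rightarrow> 'a::euclidean_space set"
  assumes pp: "point_process P \<phi>" and A: "A \<in> sets (P \<Otimes>\<^sub>M borel)"
    and B: "B \<in> sets borel" "bounded B"
  shows "(\<lambda>p. point_count (\<phi> p) (Pair p -` A \<inter> B)) \<in> borel_measurable P"
proof -
  let ?N = "\<lambda>p S. emeasure (count_space UNIV) (\<phi> p \<inter> (Pair p -` S \<inter> B))"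
  have fin: "finite (\<phi> p \<inter> (X \<inter> B))" if "p \<in> space P" for p X
    by (rule finite_subset[OF _ point_process_finite[OF pp that B(2)]]) auto
  have B_meas: "(\<lambda>p. emeasure (count_space UNIV) (\<phi> p \<inter> (X \<inter> B))) \<in> borel_measurable P"
    if "X \<in> sets borel" for X
    using pp B(1) that unfolding point_process_def point_count_def by blast
  have A': "A \<in> sigma_sets (space P \<times> space borel) {a \<times> b |a b. a \<in> sets P \<and> b \<in> sets (borel::'a measure)}"
    using A by (simp add: sets_pair_measure)
  have "(\<lambda>p. ?N p A) \<in> borel_measurable P"
    using Int_stable_pair_measure_generator[of P borel] pair_measure_closed[of P borel] A'
  proof (induction rule: sigma_sets_induct_disjoint)
    case (basic C)
    then obtain a b where C: "C = a \<times> b" "a \<in> sets P" "b \<in> sets borel" by auto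
    have "?N p C = indicator a p * emeasure (count_space UNIV) (\<phi> p \<inter> (b \<inter> B))" for p
      by (auto simp: C indicator_def)
    then show ?case using B_meas[OF C(3)] C(2) by simp
  next
    case (compl C)
    have "?N p (space P \<times> space borel - C) =
        emeasure (count_space UNIV) (\<phi> p \<inter> (UNIV \<inter> B)) - ?N p C" if "p \<in> space P" for p
    proof -
      have "\<phi> p \<inter> (Pair p -` (space P \<times> space borel - C) \<inter> B) =
          \<phi> p \<inter> (UNIV \<inter> B) - \<phi> p \<inter> (Pair p -` C \<inter> B)" using that by auto
      moreover have "?N p C \<noteq> \<infinity>" using fin[OF that] by (simp add: emeasure_count_space)
      moreover have "\<phi> p \<inter> (Pair p -` C \<inter> B) \<subseteq> \<phi> p \<inter> (UNIV \<inter> B)" by auto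
      ultimately show ?thesis by (simp add: emeasure_Diff)
    qed
    moreover have "(\<lambda>p. emeasure (count_space UNIV) (\<phi> p \<inter> (UNIV \<inter> B)) - ?N p C) \<in> borel_measurable P"
      using B_meas[of UNIV] compl by (intro borel_measurable_minus_ennreal) auto
    ultimately show ?case by (subst measurable_cong) auto
  next
    case (union C)
    have "?N p (\<Union>i. C i) = (\<Sum>i. ?N p (C i))" for p
    proof -
      have "(\<Union>i. \<phi> p \<inter> (Pair p -` C i \<inter> B)) = \<phi> p \<inter> (Pair p -` (\<Union>i. C i) \<inter> B)" by auto
      moreover have "disjoint_family (\<lambda>i. \<phi> p \<inter> (Pair p -` C i \<inter> B))"
        using union(1) by (auto simp: disjoint_family_on_def)
      ultimately show ?thesis by (subst suminf_emeasure) auto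
    qed
    then show ?case using union by simp
  qed (auto dest: sets.sets_into_space)
  then show ?thesis by (simp add: point_count_def)
qed

lemma measurable_point_count_section:
  fixes \<phi> :: "'p \<Rightarrow> 'a::euclidean_space set"
  assumes pp: "point_process P \<phi>" and A: "A \<in> sets (P \<Otimes>\<^sub>M borel)"
  shows "(\<lambda>p. point_count (\<phi> p) (Pair p -` A)) \<in> borel_measurable P"
proof -
  have "point_count (\<phi> p) (Pair p -` A) = (SUP n. point_count (\<phi> p) (Pair p -` A \<inter> cball 0 (real n)))" for p
  proof -
    have "(\<Union>n. \<phi> p \<inter> (Pair p -` A \<inter> cball 0 (real n))) = \<phi> p \<inter> Pair p -` A"
      using real_arch_simple by (auto simp: mem_cball_0)
    moreover have "incseq (\<lambda>n. \<phi> p \<inter> (Pair p -` A \<inter> cball 0 (real n)))"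
      by (auto simp: incseq_def)
    ultimately show ?thesis unfolding point_count_def by (subst SUP_emeasure_incseq) auto
  qed
  then show ?thesis using measurable_point_count_bounded_section[OF pp A] by simp
qed

text \<open>A quantifier over random points is an uncountable union over positions. It becomes
  measurable by reading it as a nonzero count of the points in the section of Q; all later
  quantifiers over nuclei pass through this.\<close>

lemma pred_Bex_point_process:
  fixes \<phi> :: "'p \<Rightarrow> 'a::euclidean_space set"
  assumes pp: "point_process P \<phi>" and Q: "Measurable.pred (P \<Otimes>\<^sub>M borel) (\<lambda>(p, x). Q p x)"
  shows "Measurable.pred P (\<lambda>p. \<exists>x\<in>\<phi> p. Q p x)"
proof -
  define A where "A = {z \<in> space (P \<Otimes>\<^sub>M borel). case z of (p, x) \<Rightarrow> Q p x}"
  have A: "A \<in> sets (P \<Otimes>\<^sub>M borel)" unfolding A_def using Q by measurable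
  have "(\<exists>x\<in>\<phi> p. Q p x) \<longleftrightarrow> point_count (\<phi> p) (Pair p -` A) \<noteq> 0" if "p \<in> space P" for p
    using that by (auto simp: point_count_def A_def space_pair_measure emeasure_count_space_eq_0)
  moreover have "Measurable.pred P (\<lambda>p. point_count (\<phi> p) (Pair p -` A) \<noteq> 0)"
    using measurable_point_count_section[OF pp A] by measurable
  ultimately show ?thesis by (subst measurable_cong) auto
qed

lemma measurable_emeasure_section:
  fixes S :: "'p \<Rightarrow> 'a::euclidean_space set"
  assumes "Measurable.pred (P \<Otimes>\<^sub>M borel) (\<lambda>(p, y). y \<in> S p)"
  shows "(\<lambda>p. emeasure lborel (S p)) \<in> borel_measurable P"
proof -
  define A where "A = {z \<in> space (P \<Otimes>\<^sub>M borel). case z of (p, y) \<Rightarrow> y \<in> S p}"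
  have "A \<in> sets (P \<Otimes>\<^sub>M lborel)"
    unfolding A_def using assms by (simp add: pred_def cong: sets_pair_measure_cong)
  then have "(\<lambda>p. emeasure lborel (Pair p -` A)) \<in> borel_measurable P"
    by (rule lborel.measurable_emeasure_Pair)
  moreover have "Pair p -` A = S p" if "p \<in> space P" for p
    using that by (auto simp: A_def space_pair_measure)
  ultimately show ?thesis by (subst measurable_cong[where g = "\<lambda>p. emeasure lborel (Pair p -` A)"]) auto
qed

section \<open>The space of configurations\<close>

definition void :: "'a::euclidean_space set \<Rightarrow> 'a set set" where
  "void B = {\<phi>. locally_finite \<phi> \<and> \<phi> \<inter> B = {}}"

definition config_algebra :: "'a::euclidean_space set measure" where
  "config_algebra = sigma {\<phi>. locally_finite \<phi>} (void ` sets borel)"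

lemma
  shows space_config [simp]: "space config_algebra = {\<phi>::'a::euclidean_space set. locally_finite \<phi>}"
    and sets_config: "sets config_algebra = sigma_sets {\<phi>::'a set. locally_finite \<phi>} (void ` sets borel)"
proof -
  have "void ` sets borel \<subseteq> Pow {\<phi>::'a set. locally_finite \<phi>}" by (auto simp: void_def)
  then show "space config_algebra = {\<phi>::'a set. locally_finite \<phi>}"
    "sets config_algebra = sigma_sets {\<phi>::'a set. locally_finite \<phi>} (void ` sets borel)"
    unfolding config_algebra_def by simp_all
qed

lemma void_in_sets: "B \<in> sets borel \<Longrightarrow> void B \<in> sets config_algebra"
  by (simp add: sets_config sigma_sets.Basic)

lemma Int_stable_void: "Int_stable (void ` sets borel)"
proof (rule Int_stableI)
  fix a b :: "'a set set" assume "a \<in> void ` sets borel" "b \<in> void ` sets borel"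
  then obtain A B where AB: "a = void A" "b = void B" "A \<in> sets borel" "B \<in> sets borel" by auto
  then have "a \<inter> b = void (A \<union> B)" by (auto simp: void_def)
  then show "a \<inter> b \<in> void ` sets borel" using AB by auto
qed

text \<open>The n-th label of x is the first index of a dense sequence that comes within 1/(n+1) of
  x. Points with equal labels are less than 2/(n+1) apart, so the labels eventually separate any
  finite set.\<close>

lemma ex_separating_labels:
  "\<exists>c :: nat \<Rightarrow> 'a::euclidean_space \<Rightarrow> nat. (\<forall>n. c n \<in> borel \<rightarrow>\<^sub>M count_space UNIV) \<and>
     (\<forall>F. finite F \<longrightarrow> eventually (\<lambda>n. inj_on (c n) F) sequentially)"
proof -
  obtain D :: "'a set" where D: "countable D" "\<And>X. open X \<Longrightarrow> X \<noteq> {} \<Longrightarrow> \<exists>d\<in>D. d \<in> X"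
    using countable_dense_exists by metis
  have "D \<noteq> {}" using D(2)[of UNIV] by auto
  define e where "e = from_nat_into D"
  have ex: "\<exists>k. dist x (e k) < 1 / real (Suc n)" for x n
  proof -
    obtain d where d: "d \<in> D" "d \<in> ball x (1 / real (Suc n))" using D(2)[of "ball x (1 / real (Suc n))"] by auto
    then obtain k where "e k = d" unfolding e_def using from_nat_into_surj[OF D(1)] by metis
    then show ?thesis using d by auto
  qed
  define c where "c n x = (LEAST k. dist x (e k) < 1 / real (Suc n))" for n x
  have "c n \<in> borel \<rightarrow>\<^sub>M count_space UNIV" for n
    unfolding c_def by measurable
  moreover have "eventually (\<lambda>n. inj_on (c n) F) sequentially" if F: "finite F" for F
  proof -
    have "eventually (\<lambda>n. c n x = c n y \<longrightarrow> x = y) sequentially" for x y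
    proof (cases "x = y")
      case False
      have "eventually (\<lambda>n. 1 / real (Suc n) < dist x y / 2) sequentially"
        using False by (intro order_tendstoD(2)[OF LIMSEQ_Suc[OF lim_1_over_n]]) auto
      then show ?thesis
      proof eventually_elim
        case (elim n)
        have "dist x (e (c n x)) < 1 / real (Suc n)" "dist y (e (c n y)) < 1 / real (Suc n)"
          unfolding c_def using LeastI_ex[OF ex] by blast+
        then show ?case using elim dist_triangle2[of x y "e (c n x)"] by (auto simp: dist_commute)
      qed
    qed simp
    then have "eventually (\<lambda>n. \<forall>x\<in>F. \<forall>y\<in>F. c n x = c n y \<longrightarrow> x = y) sequentially"
      using F by (simp add: eventually_ball_finite)
    then show ?thesis by (simp add: inj_on_def)
  qed
  ultimately show ?thesis by blast
qed

text \<open>The void events determine the counts, since \<open>\<phi> \<inter> B\<close> is counted by the number of nonempty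
  classes of a sufficiently fine countable partition.\<close>

lemma point_process_config: "point_process config_algebra (\<lambda>\<phi> :: 'a::euclidean_space set. \<phi>)"
  unfolding point_process_def
proof (intro conjI ballI)
  fix B :: "'a set" assume B: "B \<in> sets borel"
  obtain c :: "nat \<Rightarrow> 'a \<Rightarrow> nat" where c: "\<And>n. c n \<in> borel \<rightarrow>\<^sub>M count_space UNIV"
    "\<And>F. finite F \<Longrightarrow> eventually (\<lambda>n. inj_on (c n) F) sequentially"
    using ex_separating_labels by metis
  have bdd: "(\<lambda>\<phi>. point_count \<phi> B) \<in> borel_measurable config_algebra"
    if B: "B \<in> sets borel" "bounded B" for B :: "'a set"
  proof (rule borel_measurable_LIMSEQ_order)
    \<comment> \<open>The number of labels occurring in \<phi> \<inter> B. Each summand is the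
      indicator of the complement of a void event, namely that \<phi> avoids the class of label k in
      B; once the labels separate \<phi> \<inter> B, the sum is the count.\<close>
    let ?u = "\<lambda>n \<phi>. \<Sum>k. indicator (c n ` (\<phi> \<inter> B)) k :: ennreal"
    show "?u n \<in> borel_measurable config_algebra" for n
    proof (intro borel_measurable_suminf_order)
      fix k
      have "c n -` {k} \<inter> B \<in> sets borel"
        using measurable_sets[OF c(1), of "{k}" n] B by auto
      then have *: "void (c n -` {k} \<inter> B) \<in> sets config_algebra" by (rule void_in_sets)
      have "indicator (c n ` (\<phi> \<inter> B)) k = (1 - indicator (void (c n -` {k} \<inter> B)) \<phi> :: ennreal)"
        if "\<phi> \<in> space config_algebra" for \<phi>
        using that by (auto simp: void_def indicator_def)
      moreover have "(\<lambda>\<phi>. 1 - indicator (void (c n -` {k} \<inter> B)) \<phi> :: ennreal) \<in> borel_measurable config_algebra"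
        using * by measurable
      ultimately show "(\<lambda>\<phi>. indicator (c n ` (\<phi> \<inter> B)) k :: ennreal) \<in> borel_measurable config_algebra"
        by (subst measurable_cong) auto
    qed
    fix \<phi> :: "'a set" assume "\<phi> \<in> space config_algebra"
    then have F: "finite (\<phi> \<inter> B)" using B by (auto simp: locally_finite_def)
    have "eventually (\<lambda>n. ?u n \<phi> = point_count \<phi> B) sequentially"
      using c(2)[OF F]
    proof eventually_elim
      case (elim n)
      have "?u n \<phi> = (\<integral>\<^sup>+k. indicator (c n ` (\<phi> \<inter> B)) k \<partial>count_space UNIV)"
        by (rule nn_integral_count_space_nat[symmetric])
      also have "\<dots> = of_nat (card (c n ` (\<phi> \<inter> B)))" using F by (simp add: emeasure_count_space)
      also have "\<dots> = point_count \<phi> B" using F elim by (simp add: card_image point_count_def emeasure_count_space)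
      finally show ?case .
    qed
    then show "(\<lambda>n. ?u n \<phi>) \<longlonglongrightarrow> point_count \<phi> B" by (rule tendsto_eventually)
  qed
  have "point_count \<phi> B = (SUP n. point_count \<phi> (B \<inter> cball 0 (real n)))" for \<phi>
  proof -
    have "(\<Union>n. \<phi> \<inter> (B \<inter> cball 0 (real n))) = \<phi> \<inter> B"
      using real_arch_simple by (auto simp: mem_cball_0)
    moreover have "incseq (\<lambda>n. \<phi> \<inter> (B \<inter> cball 0 (real n)))" by (auto simp: incseq_def)
    ultimately show ?thesis unfolding point_count_def by (subst SUP_emeasure_incseq) auto
  qed
  then show "(\<lambda>\<phi>. point_count \<phi> B) \<in> borel_measurable config_algebra"
    using bdd[of "B \<inter> cball 0 (real n)" for n] B by (simp add: bounded_Int)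
qed simp

lemma point_process_measurable:
  fixes \<Gamma> :: "'w \<Rightarrow> 'a::euclidean_space set"
  assumes "point_process M \<Gamma>" shows "\<Gamma> \<in> M \<rightarrow>\<^sub>M config_algebra"
  unfolding config_algebra_def
proof (rule measurable_measure_of)
  show "void ` sets borel \<subseteq> Pow {\<phi>::'a set. locally_finite \<phi>}" by (auto simp: void_def)
  show "\<Gamma> \<in> space M \<rightarrow> {\<phi>. locally_finite \<phi>}" using assms by (auto simp: point_process_def)
  fix y :: "'a set set" assume "y \<in> void ` sets borel"
  then obtain B where B: "B \<in> sets borel" "y = void B" by auto
  have "\<Gamma> -` y \<inter> space M = {\<omega> \<in> space M. point_count (\<Gamma> \<omega>) B = 0}"
    using assms by (auto simp: B void_def point_count_def point_process_def emeasure_count_space_eq_0)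
  also have "\<dots> \<in> sets M" using assms B by (auto simp: point_process_def)
  finally show "\<Gamma> -` y \<inter> space M \<in> sets M" .
qed

section \<open>Filling a fixed fraction of a set by dilations\<close>

text \<open>The preimage form is the one suited to measurability in x and r. It fails for r = 0,
  where the copy collapses to the point x, and that case is split off wherever it can occur.\<close>

lemma scaled_copy_eq_vimage:
  assumes "r \<noteq> 0" shows "scaled_copy r W x = {y. (y - x) /\<^sub>R r \<in> W}"
proof -
  have "y \<in> scaled_copy r W x" if "(y - x) /\<^sub>R r \<in> W" for y
    unfolding scaled_copy_def using that assms by (intro image_eqI[of _ _ "(y - x) /\<^sub>R r"]) auto
  then show ?thesis using assms by (auto simp: scaled_copy_def)
qed

lemma scaled_copy_0: "W \<noteq> {} \<Longrightarrow> scaled_copy 0 W x = {x}"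
  by (auto simp: scaled_copy_def)

lemma scaled_copy_mono: "V \<subseteq> W \<Longrightarrow> scaled_copy r V x \<subseteq> scaled_copy r W x"
  by (auto simp: scaled_copy_def)

lemma sets_scaled_copy:
  fixes W :: "'a::euclidean_space set"
  assumes "W \<in> sets lebesgue" shows "scaled_copy r W x \<in> sets lebesgue"
  unfolding scaled_copy_def
  by (rule differentiable_image_in_sets_lebesgue[OF assms]) (auto intro!: derivative_intros)

lemma measure_scaled_copy:
  fixes W :: "'a::euclidean_space set"
  shows "measure lebesgue (scaled_copy r W x) = \<bar>r\<bar> ^ DIM('a) * measure lebesgue W"
  and emeasure_scaled_copy:
    "emeasure lebesgue (scaled_copy r W x) = ennreal (\<bar>r\<bar> ^ DIM('a)) * emeasure lebesgue W"
  unfolding scaled_copy_def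
  using measure_lebesgue_affine[of r x W] emeasure_lebesgue_affine[of r x W] by (auto simp: ennreal_power)

lemma scaled_copy_lmeasurable:
  fixes W :: "'a::euclidean_space set"
  assumes "W \<in> lmeasurable" shows "scaled_copy r W x \<in> lmeasurable"
  using assms sets_scaled_copy[of W r x]
  by (auto simp: fmeasurable_def emeasure_scaled_copy ennreal_mult_less_top)

section \<open>Continuity of the volume of a dilated set\<close>

lemma lmeasurable_inner_compact:
  fixes W :: "'a::euclidean_space set"
  assumes W: "W \<in> lmeasurable" and "e > 0"
  obtains K where "compact K" "K \<subseteq> W" "measure lebesgue (W - K) < e"
proof -
  obtain T where T: "closed T" "T \<subseteq> W" "W - T \<in> lmeasurable" "emeasure lebesgue (W - T) < ennreal (e/2)"
    using sets_lebesgue_inner_closed[of W "e/2"] assms by (auto simp: fmeasurable_def)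
  have 1: "measure lebesgue (W - T) < e/2"
    using T(3,4) assms(2) by (simp add: emeasure_eq_measure2 ennreal_less_iff)
  have "(\<lambda>n::nat. measure lebesgue (T \<inter> cball 0 (real n))) \<longlonglongrightarrow> measure lebesgue (\<Union>n::nat. T \<inter> cball 0 (real n))"
  proof (rule Lim_measure_incseq)
    have "(\<Union>n. T \<inter> cball 0 (real n)) \<subseteq> W" using T by auto
    then show "emeasure lebesgue (\<Union>n::nat. T \<inter> cball 0 (real n)) \<noteq> \<infinity>"
      using W emeasure_mono[of "\<Union>n. T \<inter> cball 0 (real n)" W lebesgue] by (auto simp: fmeasurable_def)
  qed (use T in \<open>auto simp: incseq_def\<close>)
  moreover have "(\<Union>n::nat. T \<inter> cball 0 (real n)) = T" using real_arch_simple by (auto simp: mem_cball_0)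
  ultimately have "eventually (\<lambda>n::nat. measure lebesgue (T \<inter> cball 0 (real n)) > measure lebesgue T - e/2) sequentially"
    using assms(2) by (intro order_tendstoD(1)) auto
  then obtain n :: nat where n: "measure lebesgue (T \<inter> cball 0 (real n)) > measure lebesgue T - e/2"
    by (auto simp: eventually_sequentially)
  let ?K = "T \<inter> cball 0 (real n)"
  have TL: "T \<in> lmeasurable" using T W fmeasurable_Diff[OF W, of "W - T"] by (simp add: double_diff fmeasurableD)
  have KL: "?K \<in> lmeasurable" by (intro lmeasurable_compact closed_Int_compact T) auto
  have "measure lebesgue (W - ?K) = measure lebesgue W - measure lebesgue ?K"
    using W KL T by (intro measurable_measure_Diff) (auto dest: fmeasurableD)
  moreover have "measure lebesgue (W - T) = measure lebesgue W - measure lebesgue T"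
    using W TL T by (intro measurable_measure_Diff) (auto dest: fmeasurableD)
  ultimately have "measure lebesgue (W - ?K) < e" using n 1 by simp
  moreover have "compact ?K" by (intro closed_Int_compact T) auto
  ultimately show ?thesis using that T by blast
qed

lemma lmeasurable_outer_open:
  fixes W :: "'a::euclidean_space set"
  assumes W: "W \<in> lmeasurable" and "e > 0"
  obtains U where "open U" "W \<subseteq> U" "U - W \<in> lmeasurable" "measure lebesgue (U - W) < e"
proof -
  obtain T where T: "open T" "W \<subseteq> T" "T - W \<in> lmeasurable" "emeasure lebesgue (T - W) < ennreal e"
    using sets_lebesgue_outer_open[of W "e"] assms by (auto simp: fmeasurable_def)
  have "measure lebesgue (T - W) < e"
    using T(3,4) assms(2) by (simp add: emeasure_eq_measure2 ennreal_less_iff)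
  then show ?thesis using that T by blast
qed

text \<open>K keeps a positive distance from the complement of U, and replacing k by t k moves it by
  |t - 1| times its norm, which is bounded on K.\<close>

lemma compact_dilation_subset:
  fixes K :: "'a::real_normed_vector set"
  assumes "compact K" "open U" "K \<subseteq> U"
  obtains \<delta> where "\<delta> > 0" "\<And>t k. \<bar>t - 1\<bar> < \<delta> \<Longrightarrow> k \<in> K \<Longrightarrow> t *\<^sub>R k \<in> U"
proof -
  obtain \<epsilon> where \<epsilon>: "\<epsilon> > 0" "(\<Union>x\<in>K. ball x \<epsilon>) \<subseteq> U"
    using compact_subset_open_imp_ball_epsilon_subset[OF assms] by blast
  obtain b where b: "b > 0" "\<And>k. k \<in> K \<Longrightarrow> norm k \<le> b"
    using compact_imp_bounded[OF assms(1)] bounded_pos by blast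
  have "t *\<^sub>R k \<in> U" if t: "\<bar>t - 1\<bar> < \<epsilon> / b" and k: "k \<in> K" for t k
  proof -
    have "k - t *\<^sub>R k = (1 - t) *\<^sub>R k" by (simp add: algebra_simps)
    then have "dist k (t *\<^sub>R k) = \<bar>t - 1\<bar> * norm k" by (simp add: dist_norm abs_minus_commute)
    also have "\<dots> \<le> \<bar>t - 1\<bar> * b" using b k by (intro mult_left_mono) auto
    also have "\<dots> < \<epsilon>" using t b by (simp add: pos_less_divide_eq)
    finally have "t *\<^sub>R k \<in> ball k \<epsilon>" by simp
    then show ?thesis using \<epsilon>(2) k by blast
  qed
  then show ?thesis using that[of "\<epsilon> / b"] \<epsilon> b by auto
qed

text \<open>Squeeze W between a compact K and an open U with small differences. A point of s W + x
  outside r W + x comes either from s (W - K) or from s K; in the latter case it lies in r U, since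
  s/r is close to 1, hence in r (U - W). The bound \<delta> concerns only the ratio s/r, so it is
  uniform in x and symmetric in its use.\<close>

lemma measure_scaled_copy_diff:
  fixes W :: "'a::euclidean_space set"
  assumes W: "W \<in> lmeasurable" and "e > 0"
  obtains \<delta> where "\<delta> > 0" "\<And>r s x. r > 0 \<Longrightarrow> s > 0 \<Longrightarrow> \<bar>s / r - 1\<bar> < \<delta> \<Longrightarrow>
    measure lebesgue (scaled_copy s W x - scaled_copy r W x) \<le> (s ^ DIM('a) + r ^ DIM('a)) * e"
proof -
  obtain K where K: "compact K" "K \<subseteq> W" "measure lebesgue (W - K) < e"
    using lmeasurable_inner_compact[OF assms] .
  obtain U where U: "open U" "W \<subseteq> U" "U - W \<in> lmeasurable" "measure lebesgue (U - W) < e"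
    using lmeasurable_outer_open[OF assms] .
  obtain \<delta> where \<delta>: "\<delta> > 0" "\<And>t k. \<bar>t - 1\<bar> < \<delta> \<Longrightarrow> k \<in> K \<Longrightarrow> t *\<^sub>R k \<in> U"
    using compact_dilation_subset[OF K(1) U(1)] K(2) U(2) by auto
  have WK: "W - K \<in> lmeasurable"
    using W K(1) by (intro fmeasurable_Diff) (auto simp: fmeasurableD lmeasurable_compact)
  have "measure lebesgue (scaled_copy s W x - scaled_copy r W x) \<le> (s ^ DIM('a) + r ^ DIM('a)) * e"
    if rs: "r > 0" "s > 0" "\<bar>s / r - 1\<bar> < \<delta>" for r s x
  proof -
    have "y \<in> scaled_copy s (W - K) x \<union> scaled_copy r (U - W) x"
      if "y \<in> scaled_copy s W x" "y \<notin> scaled_copy r W x" for y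
    proof (cases "(y - x) /\<^sub>R s \<in> K")
      case True
      then have "(s / r) *\<^sub>R ((y - x) /\<^sub>R s) \<in> U" using \<delta>(2) rs by blast
      moreover have "(s / r) *\<^sub>R ((y - x) /\<^sub>R s) = (y - x) /\<^sub>R r" using rs by (simp add: divide_simps)
      ultimately have "(y - x) /\<^sub>R r \<in> U" by metis
      then show ?thesis using that rs by (simp add: scaled_copy_eq_vimage)
    next
      case False
      then show ?thesis using that rs by (simp add: scaled_copy_eq_vimage)
    qed
    then have "measure lebesgue (scaled_copy s W x - scaled_copy r W x)
        \<le> measure lebesgue (scaled_copy s (W - K) x \<union> scaled_copy r (U - W) x)"
      using W WK U(3)
      by (intro measure_mono_fmeasurable)
         (auto intro!: fmeasurable.Un scaled_copy_lmeasurable sets.Diff sets_scaled_copy dest: fmeasurableD)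
    also have "\<dots> \<le> measure lebesgue (scaled_copy s (W - K) x) + measure lebesgue (scaled_copy r (U - W) x)"
      using WK U(3) by (intro measure_Un_le) (auto intro!: sets_scaled_copy dest: fmeasurableD)
    also have "\<dots> \<le> s ^ DIM('a) * e + r ^ DIM('a) * e"
      using rs K(3) U(4) by (intro add_mono) (auto simp: measure_scaled_copy intro!: mult_left_mono)
    finally show ?thesis by (simp add: algebra_simps)
  qed
  then show ?thesis using that \<delta>(1) by blast
qed

lemma measure_Int_diff_le:
  assumes "A \<in> lmeasurable" "B \<in> lmeasurable" "C \<in> sets lebesgue"
  shows "measure lebesgue (A \<inter> C) \<le> measure lebesgue (B \<inter> C) + measure lebesgue (A - B)"
proof -
  have m: "B \<inter> C \<in> lmeasurable" "A - B \<in> lmeasurable"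
    using assms by (auto intro: fmeasurable_Int_fmeasurable fmeasurable_Diff dest: fmeasurableD)
  have "measure lebesgue (A \<inter> C) \<le> measure lebesgue ((B \<inter> C) \<union> (A - B))"
    using assms m by (intro measure_mono_fmeasurable fmeasurable.Un) (auto dest: fmeasurableD)
  also have "\<dots> \<le> measure lebesgue (B \<inter> C) + measure lebesgue (A - B)"
    using m by (intro measure_Un_le) (auto dest: fmeasurableD)
  finally show ?thesis .
qed

text \<open>At r = 0 the volume is squeezed by |s|^D times the volume of W, with D the dimension. At
  r > 0 the preceding estimate bounds the part of either copy outside the other, once s/r and r/s
  are both near 1.\<close>

lemma continuous_measure_scaled_copy_Int:
  fixes W C :: "'a::euclidean_space set"
  assumes W: "W \<in> lmeasurable" and C: "C \<in> sets lebesgue"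
  shows "continuous_on {0..} (\<lambda>r. measure lebesgue (scaled_copy r W x \<inter> C))" (is "continuous_on _ ?g")
proof -
  have sW: "scaled_copy r W x \<in> lmeasurable" for r using scaled_copy_lmeasurable[OF W] .
  have "(?g \<longlongrightarrow> ?g r) (at r within {0..})" if "r \<ge> 0" for r
  proof (cases "r = 0")
    case True
    have le: "?g s \<le> \<bar>s\<bar> ^ DIM('a) * measure lebesgue W" for s
      using measure_mono_fmeasurable[of "scaled_copy s W x \<inter> C" "scaled_copy s W x" lebesgue] sW[of s] C
      by (auto simp: measure_scaled_copy dest: fmeasurableD)
    have "?g 0 = 0" using le[of 0] by (simp add: power_0_left antisym)
    moreover have "((\<lambda>s. \<bar>s\<bar> ^ DIM('a) * measure lebesgue W) \<longlongrightarrow> \<bar>0\<bar> ^ DIM('a) * measure lebesgue W) (at 0 within {0..})"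
      by (intro tendsto_intros)
    then have "((\<lambda>s. \<bar>s\<bar> ^ DIM('a) * measure lebesgue W) \<longlongrightarrow> 0) (at 0 within {0..})"
      by (simp add: power_0_left)
    then have "(?g \<longlongrightarrow> 0) (at 0 within {0..})"
      by (rule tendsto_sandwich[where f = "\<lambda>_. 0", rotated 3]) (use le in \<open>auto intro!: always_eventually\<close>)
    ultimately show ?thesis using True by simp
  next
    case False
    then have r: "r > 0" using that by simp
    show ?thesis
    proof (rule tendstoI)
      fix \<epsilon> :: real assume "\<epsilon> > 0"
      \<comment> \<open>Chosen so that (s^D + r^D) e < \<epsilon>/2 for all positive s < 2 r, where
        D is the dimension.\<close>
      define e where "e = \<epsilon> / (4 * (2 * r) ^ DIM('a))"
      have e: "e > 0" using \<open>\<epsilon> > 0\<close> r by (simp add: e_def)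
      obtain \<delta> where \<delta>: "\<delta> > 0" "\<And>r s x. r > 0 \<Longrightarrow> s > 0 \<Longrightarrow> \<bar>s / r - 1\<bar> < \<delta> \<Longrightarrow>
        measure lebesgue (scaled_copy s W x - scaled_copy r W x) \<le> (s ^ DIM('a) + r ^ DIM('a)) * e"
        by (rule measure_scaled_copy_diff[OF W e]) blast
      have "((\<lambda>s. s) \<longlongrightarrow> r) (at r within {0..})" by (rule tendsto_ident_at)
      then have s1: "eventually (\<lambda>s. s > 0 \<and> s < 2 * r) (at r within {0..})"
        using r order_tendstoD[of "\<lambda>s. s" r] by (intro eventually_conj) auto
      have "((\<lambda>s. s / r) \<longlongrightarrow> r / r) (at r within {0..})" "((\<lambda>s. r / s) \<longlongrightarrow> r / r) (at r within {0..})"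
        using r by (intro tendsto_intros; simp)+
      then have "eventually (\<lambda>s. dist (s / r) 1 < \<delta>) (at r within {0..})"
        "eventually (\<lambda>s. dist (r / s) 1 < \<delta>) (at r within {0..})"
        using r \<delta>(1) by (auto intro: tendstoD)
      with s1 show "eventually (\<lambda>s. dist (?g s) (?g r) < \<epsilon>) (at r within {0..})"
      proof eventually_elim
        case (elim s)
        have pw: "s ^ DIM('a) + r ^ DIM('a) < 2 * (2 * r) ^ DIM('a)"
        proof -
          have "s ^ DIM('a) < (2 * r) ^ DIM('a)" "r ^ DIM('a) < (2 * r) ^ DIM('a)"
            using elim r by (intro power_strict_mono; simp)+
          then show ?thesis by linarith
        qed
        have "(s ^ DIM('a) + r ^ DIM('a)) * e < 2 * (2 * r) ^ DIM('a) * e"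
          using pw e by (intro mult_strict_right_mono)
        also have "\<dots> = \<epsilon> / 2" using r by (simp add: e_def)
        finally have *: "(s ^ DIM('a) + r ^ DIM('a)) * e < \<epsilon> / 2" .
        have "?g s \<le> ?g r + (s ^ DIM('a) + r ^ DIM('a)) * e"
          using measure_Int_diff_le[OF sW sW C, of s r] \<delta>(2)[of r s x] elim r by (auto simp: dist_real_def)
        moreover have "?g r \<le> ?g s + (s ^ DIM('a) + r ^ DIM('a)) * e"
          using measure_Int_diff_le[OF sW sW C, of r s] \<delta>(2)[of s r x] elim r by (auto simp: dist_real_def add.commute)
        ultimately show ?case using * \<open>\<epsilon> > 0\<close> by (simp add: dist_real_def abs_less_iff)
      qed
    qed
  qed
  then show ?thesis by (simp add: continuous_on_def)
qed

text \<open>The radius for an arbitrary set C in place of a Voronoi cell, which separates the volume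
  computation from point configurations.\<close>

definition filling_radius :: "'a::euclidean_space set \<Rightarrow> real \<Rightarrow> 'a set \<Rightarrow> 'a \<Rightarrow> ennreal" where
  "filling_radius W \<alpha> C x = Sup (ennreal ` {r. 0 \<le> r \<and>
     emeasure lebesgue (scaled_copy r W x \<inter> C) \<le> ennreal \<alpha> * emeasure lebesgue C})"

definition filling :: "'a::euclidean_space set \<Rightarrow> real \<Rightarrow> 'a set \<Rightarrow> 'a \<Rightarrow> 'a set" where
  "filling W \<alpha> C x =
     (if filling_radius W \<alpha> C x = \<infinity> then UNIV
      else scaled_copy (enn2real (filling_radius W \<alpha> C x)) W x) \<inter> C"

lemma restricted_cell_eq_filling:
  "restricted_cell W \<alpha> \<phi> x = filling W \<alpha> (voronoi_cell x \<phi>) x"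
  by (simp only: restricted_cell_def filling_def cell_radius_def filling_radius_def)

lemma filling_subset: "filling W \<alpha> C x \<subseteq> C"
  by (simp add: filling_def)

lemma sets_filling:
  assumes "W \<in> sets lebesgue" "C \<in> sets lebesgue" shows "filling W \<alpha> C x \<in> sets lebesgue"
  using assms by (auto simp: filling_def intro!: sets.Int sets_scaled_copy)

text \<open>Here \<alpha> times infinity is infinity, so every radius is admissible. This covers
  configurations with cells of infinite volume, such as a single point.\<close>

lemma filling_radius_infinite:
  assumes "0 < \<alpha>" "emeasure lebesgue C = \<infinity>" shows "filling_radius W \<alpha> C x = \<infinity>"
proof -
  have "ennreal \<alpha> * \<infinity> = \<infinity>" using assms by (simp add: ennreal_mult_top)
  then have "filling_radius W \<alpha> C x = Sup (ennreal ` {0..})"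
    using assms by (simp add: filling_radius_def atLeast_def)
  also have "\<dots> = \<infinity>"
  proof (rule ccontr)
    assume "Sup (ennreal ` {0..}) \<noteq> \<infinity>"
    then obtain b where b: "b \<ge> 0" "Sup (ennreal ` {0..}) = ennreal b" by (cases "Sup (ennreal ` {0..})") auto
    have "ennreal (b + 1) \<le> Sup (ennreal ` {0..})" using b(1) by (intro Sup_upper imageI) simp
    then show False using b by (simp add: ennreal_le_iff)
  qed
  finally show ?thesis .
qed

lemma filling_radius_eq_measure:
  fixes W C :: "'a::euclidean_space set"
  assumes "W \<in> lmeasurable" "C \<in> lmeasurable" "\<alpha> > 0"
  shows "filling_radius W \<alpha> C x =
    Sup (ennreal ` {r. 0 \<le> r \<and> measure lebesgue (scaled_copy r W x \<inter> C) \<le> \<alpha> * measure lebesgue C})"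
proof -
  have "scaled_copy r W x \<inter> C \<in> lmeasurable" for r
    using assms scaled_copy_lmeasurable[OF assms(1)] by (auto intro: fmeasurable_Int_fmeasurable dest: fmeasurableD)
  then have "(emeasure lebesgue (scaled_copy r W x \<inter> C) \<le> ennreal \<alpha> * emeasure lebesgue C) \<longleftrightarrow>
     measure lebesgue (scaled_copy r W x \<inter> C) \<le> \<alpha> * measure lebesgue C" for r
    using assms by (simp add: emeasure_eq_measure2 ennreal_mult[symmetric])
  then show ?thesis by (simp add: filling_radius_def)
qed

text \<open>A ball of radius \<epsilon> around 0 in W makes r W + x contain the ball of radius r
  \<epsilon> around x, and balls around x exhaust C. The conclusion for all large r, not just along
  a sequence, is what bounds the set of admissible radii.\<close>

lemma measure_scaled_copy_Int_tendsto:
  fixes W C :: "'a::euclidean_space set"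
  assumes "0 \<in> interior W" "W \<in> lmeasurable" and C: "C \<in> lmeasurable" and c: "c < measure lebesgue C"
  obtains b where "b > 0" "\<And>r. r \<ge> b \<Longrightarrow> c < measure lebesgue (scaled_copy r W x \<inter> C)"
proof -
  obtain \<epsilon> where \<epsilon>: "\<epsilon> > 0" "ball 0 \<epsilon> \<subseteq> W" using assms(1) mem_interior by blast
  have "(\<lambda>n::nat. measure lebesgue (C \<inter> ball x (real n))) \<longlonglongrightarrow> measure lebesgue (\<Union>n::nat. C \<inter> ball x (real n))"
  proof (rule Lim_measure_incseq)
    have "(\<Union>n. C \<inter> ball x (real n)) \<subseteq> C" by auto
    then show "emeasure lebesgue (\<Union>n::nat. C \<inter> ball x (real n)) \<noteq> \<infinity>"
      using C emeasure_mono[of "\<Union>n. C \<inter> ball x (real n)" C lebesgue] by (auto simp: fmeasurable_def)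
  qed (use C in \<open>auto simp: incseq_def dest: fmeasurableD\<close>)
  moreover have "(\<Union>n::nat. C \<inter> ball x (real n)) = C" using reals_Archimedean2 by auto
  ultimately have "eventually (\<lambda>n::nat. c < measure lebesgue (C \<inter> ball x (real n))) sequentially"
    using c by (intro order_tendstoD(1)) auto
  then obtain n :: nat where n: "c < measure lebesgue (C \<inter> ball x (real n))"
    by (auto simp: eventually_sequentially)
  have "c < measure lebesgue (scaled_copy r W x \<inter> C)" if r: "r \<ge> real n / \<epsilon> + 1" for r
  proof -
    have rp: "r > 0" using r \<epsilon>(1) by (smt (verit) divide_nonneg_pos of_nat_0_le_iff)
    have "ball x (real n) \<subseteq> scaled_copy r W x"
    proof
      fix y assume y: "y \<in> ball x (real n)"
      have "real n / \<epsilon> < r" using r by simp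
      then have "real n < r * \<epsilon>" using \<epsilon>(1) by (simp add: pos_divide_less_eq)
      then have "norm (y - x) < r * \<epsilon>" using y by (simp add: dist_norm norm_minus_commute)
      then have "(y - x) /\<^sub>R r \<in> ball 0 \<epsilon>" using rp by (simp add: divide_simps mult.commute)
      then show "y \<in> scaled_copy r W x" using \<epsilon> rp by (auto simp: scaled_copy_eq_vimage)
    qed
    then have "measure lebesgue (C \<inter> ball x (real n)) \<le> measure lebesgue (scaled_copy r W x \<inter> C)"
      using C scaled_copy_lmeasurable[OF assms(2)]
      by (intro measure_mono_fmeasurable) (auto intro!: fmeasurable_Int_fmeasurable dest: fmeasurableD)
    then show ?thesis using n by simp
  qed
  moreover have "real n / \<epsilon> + 1 > 0" using \<epsilon>(1) by (smt (verit) divide_nonneg_pos of_nat_0_le_iff)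
  ultimately show ?thesis using that by blast
qed

lemma Sup_ennreal_eq_infinity_iff:
  "Sup (ennreal ` S) = \<infinity> \<longleftrightarrow> (\<forall>b\<ge>0. \<exists>r\<in>S. b < r)"
proof
  assume *: "Sup (ennreal ` S) = \<infinity>"
  show "\<forall>b\<ge>0. \<exists>r\<in>S. b < r"
  proof (intro allI impI)
    fix b :: real assume "b \<ge> 0"
    have "ennreal b < Sup (ennreal ` S)" unfolding * by simp
    then obtain r where "r \<in> S" "ennreal b < ennreal r" unfolding less_Sup_iff by blast
    then show "\<exists>r\<in>S. b < r" using \<open>b \<ge> 0\<close> ennreal_less_iff by auto
  qed
next
  assume *: "\<forall>b\<ge>0. \<exists>r\<in>S. b < r"
  show "Sup (ennreal ` S) = \<infinity>"
  proof (rule ccontr)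
    assume "Sup (ennreal ` S) \<noteq> \<infinity>"
    then obtain b where b: "b \<ge> 0" "Sup (ennreal ` S) = ennreal b" by (cases "Sup (ennreal ` S)") auto
    obtain r where r: "r \<in> S" "b < r" using * b by blast
    have "ennreal r \<le> Sup (ennreal ` S)" using r by (intro Sup_upper) auto
    then show False using b r by (simp add: ennreal_le_iff)
  qed
qed

text \<open>Three cases: C has infinite volume and both sides are infinite; C has finite volume but
  the radius is infinite, which forces \<alpha> \<lambda>(C) = \<lambda>(C); or the radius is finite
  and the supremum is attained with equality.\<close>

lemma emeasure_filling:
  fixes W C :: "'a::euclidean_space set"
  assumes W: "W \<in> lmeasurable" "0 \<in> interior W" and C: "C \<in> sets lebesgue" and \<alpha>: "0 < \<alpha>" "\<alpha> \<le> 1"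
  shows "emeasure lebesgue (filling W \<alpha> C x) = ennreal \<alpha> * emeasure lebesgue C"
proof (cases "emeasure lebesgue C = \<infinity>")
  case True
  have "filling_radius W \<alpha> C x = \<infinity>" using filling_radius_infinite[OF \<alpha>(1) True] .
  then show ?thesis using True \<alpha> by (simp add: filling_def ennreal_mult_top)
next
  case False
  then have CL: "C \<in> lmeasurable" using C by (simp add: fmeasurable_def top.not_eq_extremum)
  define g where "g r = measure lebesgue (scaled_copy r W x \<inter> C)" for r
  define a where "a = \<alpha> * measure lebesgue C"
  define S where "S = {r. 0 \<le> r \<and> g r \<le> a}"
  have rad: "filling_radius W \<alpha> C x = Sup (ennreal ` S)"
    unfolding S_def g_def a_def by (rule filling_radius_eq_measure[OF W(1) CL \<alpha>(1)])
  have cont: "continuous_on {0..} g"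
    unfolding g_def by (rule continuous_measure_scaled_copy_Int[OF W(1) C])
  have "g 0 \<le> measure lebesgue (scaled_copy 0 W x)"
    unfolding g_def using scaled_copy_lmeasurable[OF W(1), of 0 x] C
    by (intro measure_mono_fmeasurable) (auto dest: fmeasurableD)
  then have "g 0 = 0" using measure_scaled_copy[of 0 W x] by (simp add: power_0_left g_def antisym)
  then have S0: "0 \<in> S" using \<alpha> by (simp add: S_def a_def)
  show ?thesis
  proof (cases "filling_radius W \<alpha> C x = \<infinity>")
    case True
    \<comment> \<open>Were a smaller, all sufficiently large copies would exceed it, so S would be
      bounded and the radius finite.\<close>
    have "a = measure lebesgue C"
    proof (rule ccontr)
      assume "a \<noteq> measure lebesgue C"
      moreover have "a \<le> measure lebesgue C" using \<alpha> by (simp add: a_def mult_left_le_one_le)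
      ultimately have "a < measure lebesgue C" by simp
      then obtain b where b: "b > 0" "\<And>r. r \<ge> b \<Longrightarrow> a < g r"
        unfolding g_def using measure_scaled_copy_Int_tendsto[OF W(2,1) CL] by metis
      obtain r where "r \<in> S" "b < r"
        using True b(1) unfolding rad Sup_ennreal_eq_infinity_iff by (meson less_imp_le)
      then show False using b(2)[of r] by (auto simp: S_def)
    qed
    then have "ennreal \<alpha> * emeasure lebesgue C = emeasure lebesgue C"
      using CL \<alpha> by (simp add: emeasure_eq_measure2 a_def ennreal_mult[symmetric])
    then show ?thesis using True by (simp add: filling_def)
  next
    case False
    define t where "t = enn2real (filling_radius W \<alpha> C x)"
    have t: "filling_radius W \<alpha> C x = ennreal t" "t \<ge> 0"
      using False by (auto simp: t_def less_top)
    have S_le: "r \<le> t" if "r \<in> S" for r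
    proof -
      have "ennreal r \<le> ennreal t" using that by (simp add: rad[symmetric] t(1)[symmetric]) (simp add: rad Sup_upper)
      then show ?thesis using t(2) by (simp add: ennreal_le_iff)
    qed
    have S_gt: "\<exists>r\<in>S. b < r" if "b \<ge> 0" "b < t" for b
    proof -
      have "ennreal b < Sup (ennreal ` S)" using that t rad by (simp add: ennreal_less_iff)
      then obtain r where "r \<in> S" "ennreal b < ennreal r" by (auto simp: less_Sup_iff)
      then show ?thesis using that ennreal_less_iff by auto
    qed
    have "t = Sup S"
    proof (rule cSup_eq_non_empty[symmetric])
      show "S \<noteq> {}" using S0 by auto
      fix y assume y: "\<And>r. r \<in> S \<Longrightarrow> r \<le> y"
      show "t \<le> y"
      proof (rule ccontr)
        assume "\<not> t \<le> y"
        then show False using S_gt[of y] y S0 by fastforce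
      qed
    qed (rule S_le)
    have "closed S"
    proof -
      have "closedin (top_of_set {0..}) ({0..} \<inter> g -` {..a})"
        using continuous_closedin_preimage[OF cont closed_atMost] .
      moreover have "{0..} \<inter> g -` {..a} = S" by (auto simp: S_def)
      ultimately show ?thesis using closed_atLeast closedin_closed_trans by metis
    qed
    have "t \<in> S" unfolding \<open>t = Sup S\<close>
      using S0 S_le \<open>closed S\<close> by (intro closed_contains_Sup) (auto intro!: bdd_aboveI)
    have "g t \<ge> a"
    proof (rule tendsto_lowerbound)
      have "(g \<longlongrightarrow> g t) (at t within {0..})" using cont t(2) by (simp add: continuous_on_def)
      then show "(g \<longlongrightarrow> g t) (at_right t)" using t(2) by (elim tendsto_within_subset) auto
      show "eventually (\<lambda>r. a \<le> g r) (at_right t)"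
        using eventually_at_right_less[of t]
      proof eventually_elim
        case (elim r)
        then show ?case using S_le[of r] t(2) by (force simp: S_def)
      qed
    qed simp
    then have "g t = a" using \<open>t \<in> S\<close> by (simp add: S_def)
    moreover have "scaled_copy t W x \<inter> C \<in> lmeasurable"
      using scaled_copy_lmeasurable[OF W(1)] CL by (auto intro: fmeasurable_Int_fmeasurable dest: fmeasurableD)
    ultimately have "emeasure lebesgue (scaled_copy t W x \<inter> C) = ennreal \<alpha> * emeasure lebesgue C"
      using CL \<alpha> by (simp add: emeasure_eq_measure2 g_def a_def ennreal_mult[symmetric])
    then show ?thesis using False by (simp add: filling_def t_def)
  qed
qed

section \<open>Measurability of the union of the restricted cells\<close>

text \<open>Only rational radii occur on the right, which makes the radius measurable; the margin
  \<open>1 / Suc N\<close> keeps a limit of radii above \<open>t\<close>.\<close>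

lemma filling_radius_greater_iff:
  fixes W C :: "'a::euclidean_space set"
  assumes W: "W \<in> lmeasurable" and C: "C \<in> sets lebesgue" and \<alpha>: "0 < \<alpha>" and t: "0 \<le> t"
  shows "ennreal t < filling_radius W \<alpha> C x \<longleftrightarrow> emeasure lebesgue C = \<infinity> \<or>
    (\<exists>N::nat. \<forall>k::nat. \<exists>q::rat. t + 1 / real (Suc N) < of_rat q \<and> of_rat q < real N \<and>
       emeasure lebesgue (scaled_copy (of_rat q) W x \<inter> C)
         < ennreal \<alpha> * emeasure lebesgue C + ennreal (1 / real (Suc k)))"
proof (cases "emeasure lebesgue C = \<infinity>")
  case True
  then show ?thesis using filling_radius_infinite[OF \<alpha> True] by simp
next
  case False
  then have CL: "C \<in> lmeasurable" using C by (simp add: fmeasurable_def top.not_eq_extremum)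
  define g where "g r = measure lebesgue (scaled_copy r W x \<inter> C)" for r
  define a where "a = \<alpha> * measure lebesgue C"
  have rad: "filling_radius W \<alpha> C x = Sup (ennreal ` {r. 0 \<le> r \<and> g r \<le> a})"
    unfolding g_def a_def by (rule filling_radius_eq_measure[OF W CL \<alpha>])
  have cont: "continuous_on {0..} g"
    unfolding g_def by (rule continuous_measure_scaled_copy_Int[OF W C])
  have eq: "emeasure lebesgue (scaled_copy r W x \<inter> C)
         < ennreal \<alpha> * emeasure lebesgue C + ennreal (1 / real (Suc k)) \<longleftrightarrow> g r < a + 1 / real (Suc k)" for r k
  proof -
    have "scaled_copy r W x \<inter> C \<in> lmeasurable"
      using scaled_copy_lmeasurable[OF W] CL by (auto intro: fmeasurable_Int_fmeasurable dest: fmeasurableD)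
    moreover have "ennreal \<alpha> * emeasure lebesgue C + ennreal (1 / real (Suc k)) = ennreal (a + 1 / real (Suc k))"
      using CL \<alpha> by (simp add: emeasure_eq_measure2 a_def ennreal_mult[symmetric] ennreal_plus[symmetric] del: ennreal_plus)
    ultimately show ?thesis using \<alpha> by (simp add: emeasure_eq_measure2 g_def ennreal_less_iff)
  qed
  have "ennreal t < filling_radius W \<alpha> C x \<longleftrightarrow> (\<exists>r>t. g r \<le> a)"
    unfolding rad less_Sup_iff using t by (auto simp: ennreal_less_iff intro: less_imp_le order.trans)
  also have "\<dots> \<longleftrightarrow> (\<exists>N::nat. \<forall>k::nat. \<exists>q::rat. t + 1 / real (Suc N) < of_rat q \<and> of_rat q < real N \<and>
       g (of_rat q) < a + 1 / real (Suc k))"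
  proof
    assume "\<exists>r>t. g r \<le> a"
    then obtain r where r: "r > t" "g r \<le> a" by blast
    have "eventually (\<lambda>N. 1 / real (Suc N) < r - t) sequentially"
      using r by (intro order_tendstoD(2)[OF LIMSEQ_Suc[OF lim_1_over_n]]) auto
    moreover have "eventually (\<lambda>N. real N > r) sequentially"
      using filterlim_real_sequentially filterlim_at_top_dense by blast
    ultimately have "eventually (\<lambda>N. 1 / real (Suc N) < r - t \<and> real N > r) sequentially"
      by (rule eventually_conj)
    then obtain N where N: "1 / real (Suc N) < r - t" "real N > r"
      by (auto simp: eventually_sequentially)
    have "\<exists>q::rat. t + 1 / real (Suc N) < of_rat q \<and> of_rat q < real N \<and> g (of_rat q) < a + 1 / real (Suc k)" for k
    proof -
      have "(g \<longlongrightarrow> g r) (at r within {0..})" using cont r t by (simp add: continuous_on_def)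
      then have "eventually (\<lambda>s. g s < a + 1 / real (Suc k)) (at r within {0..})"
        using r(2) by (intro order_tendstoD(2)) (auto intro: le_less_trans)
      then obtain d where d: "d > 0" "\<And>s. s \<ge> 0 \<Longrightarrow> s \<noteq> r \<Longrightarrow> dist s r < d \<Longrightarrow> g s < a + 1 / real (Suc k)"
        unfolding eventually_at by auto
      \<comment> \<open>Approaching r from above keeps q beyond the margin over t as well.\<close>
      obtain q :: rat where q: "r < of_rat q" "of_rat q < min (r + d) (real N)"
        using of_rat_dense[of r "min (r + d) (real N)"] d(1) N(2) by auto
      have "real_of_rat q \<ge> 0" "real_of_rat q \<noteq> r" using q(1) r(1) t by linarith+
      moreover have "dist (of_rat q) r < d" using q by (simp add: dist_real_def)
      ultimately have "g (of_rat q) < a + 1 / real (Suc k)" by (rule d(2))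
      then show ?thesis using q N by (intro exI[of _ q]) auto
    qed
    then show "\<exists>N::nat. \<forall>k::nat. \<exists>q::rat. t + 1 / real (Suc N) < of_rat q \<and> of_rat q < real N \<and>
       g (of_rat q) < a + 1 / real (Suc k)" by blast
  next
    assume "\<exists>N::nat. \<forall>k::nat. \<exists>q::rat. t + 1 / real (Suc N) < of_rat q \<and> of_rat q < real N \<and>
       g (of_rat q) < a + 1 / real (Suc k)"
    then obtain N and q :: "nat \<Rightarrow> rat" where q: "\<And>k. t + 1 / real (Suc N) < of_rat (q k)"
      "\<And>k. of_rat (q k) < real N" "\<And>k. g (of_rat (q k)) < a + 1 / real (Suc k)" by metis
    \<comment> \<open>The upper bound N places the rational radii in a compact interval. A limit r
      of a subsequence satisfies g r \<le> a because the slack 1/(k+1) vanishes, and r > t because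
      of the margin.\<close>
    define K where "K = {t + 1 / real (Suc N)..real N}"
    have "seq_compact K" unfolding K_def using compact_imp_seq_compact by blast
    moreover have "\<forall>k. real_of_rat (q k) \<in> K" using q(1,2) by (simp add: K_def less_imp_le)
    ultimately obtain r s where r: "r \<in> K" "strict_mono (s :: nat \<Rightarrow> nat)" "((\<lambda>k. real_of_rat (q k)) \<circ> s) \<longlonglongrightarrow> r"
      by (rule seq_compactE) auto
    have K0: "K \<subseteq> {0..}" using t by (auto simp: K_def intro: order_trans[rotated])
    have "(\<lambda>k. g (real_of_rat (q (s k)))) \<longlonglongrightarrow> g r"
    proof (rule continuous_on_tendsto_compose[OF cont])
      show "(\<lambda>k. real_of_rat (q (s k))) \<longlonglongrightarrow> r" using r(3) by (simp add: o_def)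
      show "r \<in> {0..}" using r(1) K0 by blast
      show "\<forall>\<^sub>F k in sequentially. real_of_rat (q (s k)) \<in> {0..}"
        using \<open>\<forall>k. real_of_rat (q k) \<in> K\<close> K0 by (intro always_eventually) blast
    qed
    moreover have "(\<lambda>k. a + 1 / real (Suc k)) \<longlonglongrightarrow> a + 0"
      by (intro tendsto_intros LIMSEQ_Suc[OF lim_1_over_n])
    then have "(\<lambda>k. a + 1 / real (Suc (s k))) \<longlonglongrightarrow> a"
      using LIMSEQ_subseq_LIMSEQ[OF _ r(2), of "\<lambda>k. a + 1 / real (Suc k)" a] by (simp add: o_def)
    ultimately have "g r \<le> a" by (rule LIMSEQ_le) (use q(3) in \<open>auto intro: less_imp_le\<close>)
    moreover have "t < r" using r(1) by (auto simp: K_def intro: less_le_trans[rotated])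
    ultimately show "\<exists>r>t. g r \<le> a" by blast
  qed
  finally show ?thesis using False unfolding eq by blast
qed

section \<open>Joint measurability in the configuration and the position\<close>

lemma pred_section_borel:
  assumes "Measurable.pred (P \<Otimes>\<^sub>M borel) (\<lambda>(p, y). y \<in> S p)" "p \<in> space P"
  shows "S p \<in> sets borel"
proof -
  have "Measurable.pred borel (\<lambda>y. case (p, y) of (p, y) \<Rightarrow> y \<in> S p)"
    by (rule measurable_compose[OF _ assms(1)]) (use assms(2) in measurable)
  then show ?thesis by (simp add: pred_def)
qed

lemma measurable_filling_radius:
  fixes W :: "'a::euclidean_space set"
  assumes W: "W \<in> lmeasurable" "W \<in> sets borel" and \<alpha>: "0 < \<alpha>"
    and C: "Measurable.pred (P \<Otimes>\<^sub>M borel) (\<lambda>(p, y). y \<in> C p)" and x[measurable]: "x \<in> P \<rightarrow>\<^sub>M borel"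
  shows "(\<lambda>p. filling_radius W \<alpha> (C p) (x p)) \<in> borel_measurable P"
proof (rule borel_measurableI_greater)
  fix y :: ennreal
  \<comment> \<open>The copy of W intersected with the cell, written as a preimage so that it is
    jointly measurable in p and z for fixed q. The rational radii that occur exceed the positive
    number t + 1/(N+1), so q is nonzero and V is the true copy.\<close>
  define V where "V q p = {z. (z - x p) /\<^sub>R q \<in> W} \<inter> C p" for q p
  note W(2)[measurable]
  have [measurable]: "Measurable.pred (P \<Otimes>\<^sub>M borel) (\<lambda>(p, z). z \<in> V q p)" for q
    unfolding V_def Int_iff mem_Collect_eq split_beta' using C[unfolded split_beta'] by measurable
  have [measurable]: "(\<lambda>p. emeasure lborel (V q p)) \<in> borel_measurable P" for q
    by (rule measurable_emeasure_section) measurable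
  have [measurable]: "(\<lambda>p. emeasure lborel (C p)) \<in> borel_measurable P"
    by (rule measurable_emeasure_section[OF C])
  show "{p \<in> space P. y < filling_radius W \<alpha> (C p) (x p)} \<in> sets P"
  proof (cases y)
    case (real t)
    have "{p \<in> space P. y < filling_radius W \<alpha> (C p) (x p)} =
      {p \<in> space P. emeasure lborel (C p) = \<infinity> \<or>
        (\<exists>N::nat. \<forall>k::nat. \<exists>q::rat. t + 1 / real (Suc N) < of_rat q \<and> of_rat q < real N \<and>
           emeasure lborel (V (of_rat q) p) < ennreal \<alpha> * emeasure lborel (C p) + ennreal (1 / real (Suc k)))}"
    proof (intro Collect_cong conj_cong refl)
      fix p assume p: "p \<in> space P"
      have Cb: "C p \<in> sets borel" using pred_section_borel[OF C p] .
      have "emeasure lebesgue (scaled_copy q W (x p) \<inter> C p) = emeasure lborel (V q p)" if "t + 1 / real (Suc N) < q" for q N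
      proof -
        have "t + 1 / real (Suc N) \<ge> 0" using real by simp
        then have "q \<noteq> 0" using that by linarith
        then have "scaled_copy q W (x p) \<inter> C p = V q p" by (simp add: V_def scaled_copy_eq_vimage)
        moreover have "V q p \<in> sets borel" by (rule pred_section_borel[OF _ p]) measurable
        ultimately show ?thesis by simp
      qed
      then show "(y < filling_radius W \<alpha> (C p) (x p)) \<longleftrightarrow> (emeasure lborel (C p) = \<infinity> \<or>
        (\<exists>N::nat. \<forall>k::nat. \<exists>q::rat. t + 1 / real (Suc N) < of_rat q \<and> of_rat q < real N \<and>
           emeasure lborel (V (of_rat q) p) < ennreal \<alpha> * emeasure lborel (C p) + ennreal (1 / real (Suc k))))"
        unfolding real filling_radius_greater_iff[OF W(1) sets_completionI_sets[OF Cb[unfolded sets_lborel[symmetric]]] \<alpha> real(1)]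
        using Cb by (simp cong: conj_cong)
    qed
    also have "\<dots> \<in> sets P" by measurable
    finally show ?thesis .
  qed simp
qed

lemma pred_filling:
  fixes W :: "'a::euclidean_space set"
  assumes W: "W \<in> lmeasurable" "W \<in> sets borel" "W \<noteq> {}" and \<alpha>: "0 < \<alpha>"
    and C: "Measurable.pred (P \<Otimes>\<^sub>M borel) (\<lambda>(p, y). y \<in> C p)"
    and x[measurable]: "x \<in> P \<rightarrow>\<^sub>M borel" and f[measurable]: "f \<in> P \<rightarrow>\<^sub>M borel"
  shows "Measurable.pred P (\<lambda>p. f p \<in> filling W \<alpha> (C p) (x p))"
proof -
  note W(2)[measurable] measurable_filling_radius[OF W(1,2) \<alpha> C x, measurable]
  have [measurable]: "Measurable.pred P (\<lambda>p. f p \<in> C p)"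
  proof -
    have "Measurable.pred P (\<lambda>p. case (p, f p) of (p, y) \<Rightarrow> y \<in> C p)"
      by (rule measurable_compose[OF _ C]) measurable
    then show ?thesis by simp
  qed
  let ?t = "\<lambda>p. enn2real (filling_radius W \<alpha> (C p) (x p))"
  \<comment> \<open>Radius 0 has to be treated apart: the copy is then the single point x, not a
    preimage under division by the radius. Equality of points is phrased as zero distance, a
    measurable function.\<close>
  have "f p \<in> filling W \<alpha> (C p) (x p) \<longleftrightarrow> f p \<in> C p \<and>
    (filling_radius W \<alpha> (C p) (x p) = \<infinity> \<or>
      (if ?t p = 0 then dist (f p) (x p) = 0 else (f p - x p) /\<^sub>R ?t p \<in> W))" for p
    using W(3) by (auto simp: filling_def scaled_copy_0 scaled_copy_eq_vimage)
  moreover have "Measurable.pred P (\<lambda>p. f p \<in> C p \<and>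
    (filling_radius W \<alpha> (C p) (x p) = \<infinity> \<or>
      (if ?t p = 0 then dist (f p) (x p) = 0 else (f p - x p) /\<^sub>R ?t p \<in> W)))"
    by measurable
  ultimately show ?thesis by simp
qed

lemma pred_closer:
  fixes f g h :: "'p \<Rightarrow> real ^ 'n::{finite,linorder}"
  assumes [measurable]: "f \<in> P \<rightarrow>\<^sub>M borel" "g \<in> P \<rightarrow>\<^sub>M borel" "h \<in> P \<rightarrow>\<^sub>M borel"
  shows "Measurable.pred P (\<lambda>p. closer (f p) (g p) (h p))"
proof -
  have [measurable]: "(\<lambda>p. k p $ i) \<in> borel_measurable P" if [measurable]: "k \<in> P \<rightarrow>\<^sub>M borel"
    for k :: "'p \<Rightarrow> (real, 'n) vec" and i
    unfolding cart_eq_inner_axis by measurable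
  have "closer (f p) (g p) (h p) \<longleftrightarrow> dist (f p) (g p) < dist (f p) (h p) \<or>
      dist (f p) (g p) = dist (f p) (h p) \<and> dist (g p) (h p) \<noteq> 0 \<and>
      (\<exists>i. g p $ i < h p $ i \<and> (\<forall>j. j < i \<longrightarrow> g p $ j = h p $ j))" for p
    by (auto simp: closer_def lex_less_eq_def)
  moreover have "Measurable.pred P (\<lambda>p. dist (f p) (g p) < dist (f p) (h p) \<or>
      dist (f p) (g p) = dist (f p) (h p) \<and> dist (g p) (h p) \<noteq> 0 \<and>
      (\<exists>i. g p $ i < h p $ i \<and> (\<forall>j. j < i \<longrightarrow> g p $ j = h p $ j)))"
    by measurable
  ultimately show ?thesis by simp
qed

lemma pred_cell:
  fixes \<phi> :: "'p \<Rightarrow> (real ^ 'n::{finite,linorder}) set"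
  assumes pp: "point_process P \<phi>" and [measurable]: "f \<in> P \<rightarrow>\<^sub>M borel" "g \<in> P \<rightarrow>\<^sub>M borel"
  shows "Measurable.pred P (\<lambda>p. f p \<in> cell (\<phi> p) (g p))"
proof -
  have "Measurable.pred (P \<Otimes>\<^sub>M borel) (\<lambda>(p, z). closer (f p) z (g p))"
    unfolding split_beta' by (rule pred_closer) measurable
  then have [measurable]: "Measurable.pred P (\<lambda>p. \<exists>z\<in>\<phi> p. closer (f p) z (g p))"
    by (rule pred_Bex_point_process[OF pp])
  have "(\<lambda>p. f p \<in> cell (\<phi> p) (g p)) = (\<lambda>p. \<not> (\<exists>z\<in>\<phi> p. closer (f p) z (g p)))"
    by (auto simp: cell_def)
  moreover have "Measurable.pred P (\<lambda>p. \<not> (\<exists>z\<in>\<phi> p. closer (f p) z (g p)))" by measurable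
  ultimately show ?thesis by metis
qed

definition cell_filling_union :: "(real ^ 'n::{finite,linorder}) set \<Rightarrow> real \<Rightarrow>
    (real ^ 'n::{finite,linorder}) set \<Rightarrow> (real ^ 'n::{finite,linorder}) set" where
  "cell_filling_union W \<alpha> \<phi> = (\<Union>x\<in>\<phi>. filling W \<alpha> (cell \<phi> x) x)"

lemma restricted_union_eq:
  "locally_finite \<phi> \<Longrightarrow> restricted_union W \<alpha> \<phi> = cell_filling_union W \<alpha> \<phi>"
  by (simp add: restricted_union_def cell_filling_union_def restricted_cell_eq_filling voronoi_cell_eq_cell)

text \<open>A twofold product is needed: one factor for the candidate nucleus x, another for the
  points of its cell over which the volume defining the radius is taken.\<close>

lemma pred_cell_filling_union:
  fixes \<phi> :: "'p \<Rightarrow> (real ^ 'n::{finite,linorder}) set"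
  assumes W: "W \<in> lmeasurable" "W \<in> sets borel" "W \<noteq> {}" and \<alpha>: "0 < \<alpha>"
    and pp: "point_process P \<phi>" and f[measurable]: "f \<in> P \<rightarrow>\<^sub>M borel"
  shows "Measurable.pred P (\<lambda>p. f p \<in> cell_filling_union W \<alpha> (\<phi> p))"
proof -
  let ?P = "P \<Otimes>\<^sub>M (borel :: (real, 'n) vec measure)"
  let ?C = "\<lambda>p. cell (\<phi> (fst p)) (snd p)"
  have pp2: "point_process (?P \<Otimes>\<^sub>M (borel :: (real, 'n) vec measure)) (\<lambda>q. \<phi> (fst (fst q)))"
    by (rule point_process_compose[OF pp]) measurable
  have "Measurable.pred (?P \<Otimes>\<^sub>M borel) (\<lambda>(p, y). y \<in> ?C p)"
    unfolding split_beta' by (rule pred_cell[OF pp2]) measurable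
  then have "Measurable.pred ?P (\<lambda>p. f (fst p) \<in> filling W \<alpha> (?C p) (snd p))"
    by (rule pred_filling[OF W \<alpha>]) measurable
  then have "Measurable.pred P (\<lambda>p. \<exists>x\<in>\<phi> p. f p \<in> filling W \<alpha> (cell (\<phi> p) x) x)"
    by (intro pred_Bex_point_process[OF pp]) (simp add: split_beta')
  then show ?thesis by (simp add: cell_filling_union_def)
qed

lemma cell_borel:
  fixes \<phi> :: "(real ^ 'n::{finite,linorder}) set"
  assumes "locally_finite \<phi>" shows "cell \<phi> x \<in> sets borel"
proof -
  have "Measurable.pred borel (\<lambda>y. \<not> closer y z x)" for z :: "(real, 'n) vec"
    by (intro pred_intros_logic pred_closer) measurable
  then have "(\<Inter>z\<in>\<phi>. {y. \<not> closer y z x}) \<in> sets borel"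
    using countable_locally_finite[OF assms]
    by (cases "\<phi> = {}") (auto simp: pred_def intro!: sets.countable_INT'')
  then show ?thesis by (simp add: cell_def Collect_ball_eq)
qed

section \<open>The volume measure of the union\<close>

lemma sets_volume_measure [simp]: "sets (volume_measure Z) = sets borel"
  using sets.space_closed[of borel] sets.sigma_sets_eq[of borel]
  by (simp add: volume_measure_def)

text \<open>\<open>measure_of\<close> yields the zero measure when the given function fails to be a
  measure, so countable additivity of B \<mapsto> \<lambda>(Z \<inter> B) must be checked before the
  formula can be read off.\<close>

lemma emeasure_volume_measure:
  fixes Z :: "'a::euclidean_space set"
  assumes Z: "Z \<in> sets lebesgue" and B: "B \<in> sets borel"
  shows "emeasure (volume_measure Z) B = emeasure lebesgue (Z \<inter> B)"
proof (rule emeasure_measure_of)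
  show "volume_measure Z = measure_of UNIV (sets borel) (\<lambda>B. emeasure lebesgue (Z \<inter> B))"
    by (rule volume_measure_def)
  show "countably_additive (sets (volume_measure Z)) (\<lambda>B. emeasure lebesgue (Z \<inter> B))"
  proof (rule countably_additiveI)
    fix A :: "nat \<Rightarrow> 'a set"
    assume A: "range A \<subseteq> sets (volume_measure Z)" "disjoint_family A"
    have "(\<Sum>i. emeasure lebesgue (Z \<inter> A i)) = emeasure lebesgue (\<Union>i. Z \<inter> A i)"
      using A Z by (intro suminf_emeasure) (auto simp: disjoint_family_on_def subset_iff)
    also have "(\<Union>i. Z \<inter> A i) = Z \<inter> \<Union> (range A)" by blast
    finally show "(\<Sum>i. emeasure lebesgue (Z \<inter> A i)) = emeasure lebesgue (Z \<inter> \<Union> (range A))" .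
  qed
qed (use B in \<open>auto simp: positive_def\<close>)

lemma volume_measure_in_lf_measures:
  assumes "Z \<in> sets lebesgue" shows "volume_measure Z \<in> lf_measures"
proof -
  have "emeasure (volume_measure Z) B < \<infinity>" if B: "B \<in> sets borel" "bounded B" for B
  proof -
    have "emeasure lebesgue (Z \<inter> B) \<le> emeasure lebesgue B" using B by (intro emeasure_mono) auto
    also have "\<dots> < \<infinity>" using B emeasure_bounded_finite by simp
    finally show ?thesis using emeasure_volume_measure[OF assms B(1)] by simp
  qed
  then show ?thesis by (simp add: lf_measures_def)
qed

lemma shift_volume_measure:
  fixes Z :: "'a::euclidean_space set"
  assumes Z: "Z \<in> sets lebesgue"
  shows "shift_measure a (volume_measure Z) = volume_measure ((\<lambda>z. z - a) ` Z)"
proof (rule measure_eqI)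
  fix B assume "B \<in> sets (shift_measure a (volume_measure Z))"
  then have B: "B \<in> sets borel" by (simp add: shift_measure_def)
  have [measurable]: "(\<lambda>z. z - a) \<in> volume_measure Z \<rightarrow>\<^sub>M borel"
    by (subst measurable_cong_sets[OF sets_volume_measure refl]) measurable
  have pre: "(\<lambda>z. z - a) -` B \<in> sets borel"
    using measurable_sets[of "\<lambda>z. z - a" borel borel B] B by simp
  have "emeasure (shift_measure a (volume_measure Z)) B = emeasure lebesgue (Z \<inter> (\<lambda>z. z - a) -` B)"
    using B pre by (simp add: shift_measure_def emeasure_distr emeasure_volume_measure[OF Z])
  also have "\<dots> = emeasure lebesgue ((\<lambda>z. 1 *\<^sub>R z + (- a)) ` (Z \<inter> (\<lambda>z. z - a) -` B))"
    by (subst emeasure_lebesgue_affine) simp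
  also have "(\<lambda>z. 1 *\<^sub>R z + (- a)) ` (Z \<inter> (\<lambda>z. z - a) -` B) = (\<lambda>z. z - a) ` Z \<inter> B" by auto
  also have "emeasure lebesgue \<dots> = emeasure (volume_measure ((\<lambda>z. z - a) ` Z)) B"
  proof -
    have "(\<lambda>z. z - a) ` Z \<in> sets lebesgue"
      using lebesgue_sets_translation[OF Z, of "- a"] by simp
    then show ?thesis using B by (simp add: emeasure_volume_measure)
  qed
  finally show "emeasure (shift_measure a (volume_measure Z)) B = emeasure (volume_measure ((\<lambda>z. z - a) ` Z)) B" .
qed (simp add: shift_measure_def)

lemma measurable_volume_measure:
  fixes Z :: "'w \<Rightarrow> 'a::euclidean_space set"
  assumes Z: "Measurable.pred (N \<Otimes>\<^sub>M borel) (\<lambda>(\<omega>, y). y \<in> Z \<omega>)"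
  shows "(\<lambda>\<omega>. volume_measure (Z \<omega>)) \<in> N \<rightarrow>\<^sub>M lf_measure_algebra"
    and "B \<in> sets borel \<Longrightarrow> (\<lambda>\<omega>. emeasure (volume_measure (Z \<omega>)) B) \<in> borel_measurable N"
proof -
  have Zb: "Z \<omega> \<in> sets borel" if "\<omega> \<in> space N" for \<omega>
    using pred_section_borel[OF Z that] .
  have meas: "(\<lambda>\<omega>. emeasure (volume_measure (Z \<omega>)) B) \<in> borel_measurable N" if B: "B \<in> sets borel" for B
  proof -
    note B[measurable]
    have [measurable]: "Measurable.pred (N \<Otimes>\<^sub>M borel) (\<lambda>(\<omega>, y). y \<in> Z \<omega> \<inter> B)"
      unfolding Int_iff split_beta' using Z[unfolded split_beta'] by measurable
    have "(\<lambda>\<omega>. emeasure lborel (Z \<omega> \<inter> B)) \<in> borel_measurable N"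
      by (rule measurable_emeasure_section) measurable
    moreover have "emeasure (volume_measure (Z \<omega>)) B = emeasure lborel (Z \<omega> \<inter> B)" if "\<omega> \<in> space N" for \<omega>
      using Zb[OF that] B by (simp add: emeasure_volume_measure)
    ultimately show ?thesis by (subst measurable_cong) auto
  qed
  then show "B \<in> sets borel \<Longrightarrow> (\<lambda>\<omega>. emeasure (volume_measure (Z \<omega>)) B) \<in> borel_measurable N" .
  show "(\<lambda>\<omega>. volume_measure (Z \<omega>)) \<in> N \<rightarrow>\<^sub>M lf_measure_algebra"
    unfolding lf_measure_algebra_def
    using Zb by (intro measurable_SUP2 measurable_vimage_algebra2 meas)
       (auto intro!: volume_measure_in_lf_measures)
qed

lemma disjoint_fillings:
  "disjoint_family_on (\<lambda>x. filling W \<alpha> (cell \<phi> x) x) \<phi>"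
  unfolding disjoint_family_on_def using cell_unique filling_subset by blast

lemma sets_lebesgue_cell:
  fixes \<phi> :: "(real ^ 'n::{finite,linorder}) set"
  assumes "locally_finite \<phi>" shows "cell \<phi> x \<in> sets lebesgue"
  using cell_borel[OF assms] by simp

lemma sets_cell_filling_union:
  fixes \<phi> :: "(real ^ 'n::{finite,linorder}) set"
  assumes "locally_finite \<phi>" "W \<in> sets lebesgue"
  shows "cell_filling_union W \<alpha> \<phi> \<in> sets lebesgue"
  unfolding cell_filling_union_def using assms
  by (auto intro!: sets.countable_UN' countable_locally_finite sets_filling sets_lebesgue_cell)

lemma emeasure_cell_filling_union:
  fixes \<phi> :: "(real ^ 'n::{finite,linorder}) set"
  assumes "locally_finite \<phi>" "W \<in> sets lebesgue" "B \<in> sets borel"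
  shows "emeasure lebesgue (cell_filling_union W \<alpha> \<phi> \<inter> B) =
    (\<integral>\<^sup>+x. emeasure lebesgue (filling W \<alpha> (cell \<phi> x) x \<inter> B) \<partial>count_space \<phi>)"
proof -
  have "cell_filling_union W \<alpha> \<phi> \<inter> B = (\<Union>x\<in>\<phi>. filling W \<alpha> (cell \<phi> x) x \<inter> B)"
    by (auto simp: cell_filling_union_def)
  also have "emeasure lebesgue \<dots> = (\<integral>\<^sup>+x. emeasure lebesgue (filling W \<alpha> (cell \<phi> x) x \<inter> B) \<partial>count_space \<phi>)"
    using assms disjoint_fillings[of W \<alpha> \<phi>]
    by (intro emeasure_UN_countable countable_locally_finite sets.Int sets_filling sets_lebesgue_cell)
       (auto simp: disjoint_family_on_def)
  finally show ?thesis .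
qed

subsection \<open>Reduction to a Borel set \<open>W\<close>\<close>

lemma emeasure_subset_null_diff:
  assumes "B \<subseteq> A" "A \<in> sets M" "B \<in> sets M" "emeasure M (A - B) = 0"
  shows "emeasure M A = emeasure M B"
proof -
  have "A - B \<in> null_sets M" using assms by auto
  then have "emeasure M (B \<union> (A - B)) = emeasure M B" using assms by (intro emeasure_Un_null_set)
  then show ?thesis using assms(1) by (simp add: Un_absorb1)
qed

text \<open>A Lebesgue set is a Borel set up to a null set; adding the interior of W keeps 0 an
  interior point. Borel sets are wanted because preimages of W under (y, x) \<mapsto> (y - x)/q must
  lie in a product of Borel algebras.\<close>

lemma ex_borel_subset:
  fixes W :: "'a::euclidean_space set"
  assumes "W \<in> sets lebesgue"
  obtains V where "V \<in> sets borel" "V \<subseteq> W" "interior W \<subseteq> interior V" "emeasure lebesgue (W - V) = 0"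
proof -
  obtain S N N' where S: "W = S \<union> N" "N \<subseteq> N'" "N' \<in> null_sets lborel" "S \<in> sets lborel"
    using sets_completionE[OF assms] .
  have "N' \<in> null_sets lebesgue" using S(3) by (rule null_sets_completionI)
  then have "emeasure lebesgue N' = 0" "N' \<in> sets lebesgue" by auto
  moreover have "W - (S \<union> interior W) \<subseteq> N'" using S(1,2) by blast
  ultimately have "emeasure lebesgue (W - (S \<union> interior W)) = 0"
    using emeasure_mono[of "W - (S \<union> interior W)" N' lebesgue] by simp
  moreover have "interior W \<subseteq> interior (S \<union> interior W)" by (intro interior_maximal) auto
  ultimately show ?thesis
    using that[of "S \<union> interior W"] S interior_subset[of W] by auto
qed

lemma emeasure_scaled_copy_null_diff:
  fixes V W :: "'a::euclidean_space set"
  assumes "V \<subseteq> W" "W \<in> sets lebesgue" "V \<in> sets lebesgue" "emeasure lebesgue (W - V) = 0" "C \<in> sets lebesgue"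
  shows "emeasure lebesgue (scaled_copy r W x \<inter> C) = emeasure lebesgue (scaled_copy r V x \<inter> C)"
proof (rule emeasure_subset_null_diff)
  have "scaled_copy r W x \<inter> C - scaled_copy r V x \<inter> C \<subseteq> scaled_copy r (W - V) x"
    by (auto simp: scaled_copy_def)
  then have "emeasure lebesgue (scaled_copy r W x \<inter> C - scaled_copy r V x \<inter> C) \<le> emeasure lebesgue (scaled_copy r (W - V) x)"
    using assms by (intro emeasure_mono sets_scaled_copy) auto
  then show "emeasure lebesgue (scaled_copy r W x \<inter> C - scaled_copy r V x \<inter> C) = 0"
    using assms by (simp add: emeasure_scaled_copy)
  show "scaled_copy r V x \<inter> C \<subseteq> scaled_copy r W x \<inter> C"
    using scaled_copy_mono[OF assms(1)] by blast
qed (use assms in \<open>auto intro!: sets_scaled_copy sets.Int\<close>)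

text \<open>The volumes compared in the definition of the radius are the same for V and W, hence so
  are the radii, and copies with equal radius differ by a null set.\<close>

lemma emeasure_filling_null_diff:
  fixes V W :: "'a::euclidean_space set"
  assumes "V \<subseteq> W" "W \<in> sets lebesgue" "V \<in> sets lebesgue" "emeasure lebesgue (W - V) = 0"
    "C \<in> sets lebesgue" "B \<in> sets lebesgue"
  shows "emeasure lebesgue (filling W \<alpha> C x \<inter> B) = emeasure lebesgue (filling V \<alpha> C x \<inter> B)"
proof -
  have "filling_radius W \<alpha> C x = filling_radius V \<alpha> C x"
    using emeasure_scaled_copy_null_diff[OF assms(1-5)] by (simp add: filling_radius_def)
  then show ?thesis
    using emeasure_scaled_copy_null_diff[OF assms(1-4), of "C \<inter> B"] assms
    by (simp add: filling_def Int_assoc)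
qed

lemma volume_measure_null_diff:
  fixes \<phi> :: "(real ^ 'n::{finite,linorder}) set"
  assumes "V \<subseteq> W" "W \<in> sets lebesgue" "V \<in> sets lebesgue" "emeasure lebesgue (W - V) = 0" "locally_finite \<phi>"
  shows "volume_measure (cell_filling_union W \<alpha> \<phi>) = volume_measure (cell_filling_union V \<alpha> \<phi>)"
proof (rule measure_eqI)
  fix B assume "B \<in> sets (volume_measure (cell_filling_union W \<alpha> \<phi>))"
  then have B: "B \<in> sets borel" by simp
  have "cell \<phi> x \<in> sets lebesgue" "B \<in> sets lebesgue" for x using cell_borel[OF assms(5), of x] B by auto
  then show "emeasure (volume_measure (cell_filling_union W \<alpha> \<phi>)) B =
      emeasure (volume_measure (cell_filling_union V \<alpha> \<phi>)) B"
    using assms B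
    by (simp add: emeasure_volume_measure sets_cell_filling_union emeasure_cell_filling_union
        emeasure_filling_null_diff[OF assms(1-4)])
qed simp

section \<open>Stationarity\<close>

lemma filling_translate:
  fixes W C :: "'a::euclidean_space set"
  shows "filling W \<alpha> ((\<lambda>z. z - a) ` C) (x - a) = (\<lambda>z. z - a) ` filling W \<alpha> C x"
proof -
  have e: "emeasure lebesgue ((\<lambda>z. z - a) ` S) = emeasure lebesgue S" for S :: "'a set"
    using emeasure_lebesgue_affine[of 1 "- a" S] by simp
  have s: "scaled_copy r W (x - a) = (\<lambda>z. z - a) ` scaled_copy r W x" for r
    by (auto simp: scaled_copy_def image_image algebra_simps)
  have i: "(\<lambda>z. z - a) ` S \<inter> (\<lambda>z. z - a) ` T = (\<lambda>z. z - a) ` (S \<inter> T)" for S T :: "'a set" by auto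
  have "filling_radius W \<alpha> ((\<lambda>z. z - a) ` C) (x - a) = filling_radius W \<alpha> C x"
    by (simp only: filling_radius_def s i e)
  then show ?thesis by (auto simp: filling_def s)
qed

lemma cell_filling_union_translate:
  "cell_filling_union W \<alpha> ((\<lambda>z. z - a) ` \<phi>) = (\<lambda>z. z - a) ` cell_filling_union W \<alpha> \<phi>"
  by (simp add: cell_filling_union_def cell_translate filling_translate image_UN)

lemma point_process_translate:
  fixes \<Gamma> :: "'w \<Rightarrow> 'a::euclidean_space set"
  assumes "point_process M \<Gamma>"
  shows "point_process M (\<lambda>\<omega>. (\<lambda>z. z - a) ` \<Gamma> \<omega>)"
  unfolding point_process_def
proof (intro conjI ballI)
  fix B :: "'a set" assume B: "B \<in> sets borel"
  have pre: "(\<lambda>z. z - a) -` B \<in> sets borel"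
    using measurable_sets[of "\<lambda>z. z - a" borel borel B] B by simp
  have "point_count ((\<lambda>z. z - a) ` \<phi>) B = point_count \<phi> ((\<lambda>z. z - a) -` B)" for \<phi>
  proof -
    have eq: "(\<lambda>z. z - a) ` \<phi> \<inter> B = (\<lambda>z. z - a) ` (\<phi> \<inter> (\<lambda>z. z - a) -` B)" by auto
    have inj: "inj_on (\<lambda>z. z - a) S" for S by (simp add: inj_on_def)
    show ?thesis
      unfolding point_count_def eq using inj by (simp add: emeasure_count_space finite_image_iff card_image)
  qed
  then show "(\<lambda>\<omega>. point_count ((\<lambda>z. z - a) ` \<Gamma> \<omega>) B) \<in> borel_measurable M"
    using assms pre by (simp add: point_process_def)
qed (use assms locally_finite_translation in \<open>auto simp: point_process_def\<close>)

section \<open>Void probabilities and translation invariance of the Poisson process\<close>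

lemma distr_config_eqI:
  fixes \<Gamma> \<Delta> :: "'w \<Rightarrow> 'a::euclidean_space set"
  assumes M: "prob_space M" and \<Gamma>: "point_process M \<Gamma>" and \<Delta>: "point_process M \<Delta>"
    and eq: "\<And>B. B \<in> sets borel \<Longrightarrow>
      measure M {\<omega> \<in> space M. \<Gamma> \<omega> \<inter> B = {}} = measure M {\<omega> \<in> space M. \<Delta> \<omega> \<inter> B = {}}"
  shows "distr M config_algebra \<Gamma> = distr M config_algebra \<Delta>"
proof -
  interpret prob_space M by fact
  note [measurable] = point_process_measurable[OF \<Gamma>] point_process_measurable[OF \<Delta>]
  have lf: "locally_finite (\<Gamma> \<omega>)" "locally_finite (\<Delta> \<omega>)" if "\<omega> \<in> space M" for \<omega>
    using \<Gamma> \<Delta> that by (auto simp: point_process_def)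
  have void: "\<Gamma> -` void B \<inter> space M = {\<omega> \<in> space M. \<Gamma> \<omega> \<inter> B = {}}"
    "\<Delta> -` void B \<inter> space M = {\<omega> \<in> space M. \<Delta> \<omega> \<inter> B = {}}" for B
    using lf by (auto simp: void_def)
  show ?thesis
  proof (rule measure_eqI_generator_eq[OF Int_stable_void, where A = "\<lambda>_. void {}"])
    fix X :: "'a set set" assume "X \<in> void ` sets borel"
    then obtain B where "B \<in> sets borel" "X = void B" by auto
    then show "emeasure (distr M config_algebra \<Gamma>) X = emeasure (distr M config_algebra \<Delta>) X"
      using eq[of B] void_in_sets[of B]
      by (simp add: emeasure_distr void emeasure_eq_measure)
  next
    fix i :: nat
    have "emeasure (distr M config_algebra \<Gamma>) (void {}) = emeasure M (\<Gamma> -` void {} \<inter> space M)"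
      using void_in_sets[of "{}"] by (intro emeasure_distr) auto
    then show "emeasure (distr M config_algebra \<Gamma>) (void {}) \<noteq> \<infinity>" by (simp add: emeasure_eq_measure)
  qed (auto simp: sets_config void_def)
qed

text \<open>The case k = 0 of the Poisson distribution. Sets of infinite volume are included because
  void events range over all Borel sets; such a set almost surely contains infinitely many points,
  so its void probability is 0.\<close>

lemma poisson_void_probability:
  fixes \<Gamma> :: "'w \<Rightarrow> 'a::euclidean_space set"
  assumes M: "prob_space M" and P: "stationary_poisson_process M \<Gamma> \<gamma>" and \<gamma>: "\<gamma> > 0" and B: "B \<in> sets borel"
  shows "measure M {\<omega> \<in> space M. \<Gamma> \<omega> \<inter> B = {}} =
    (if emeasure lborel B < \<infinity> then exp (- \<gamma> * measure lborel B) else 0)"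
proof -
  let ?\<Lambda> = "scale_measure (ennreal \<gamma>) lborel :: 'a measure"
  interpret prob_space M by fact
  have pp: "poisson_process M \<Gamma> ?\<Lambda>" using P by (simp add: stationary_poisson_process_def)
  have ev: "{\<omega> \<in> space M. \<Gamma> \<omega> \<inter> B = {}} = {\<omega> \<in> space M. point_count (\<Gamma> \<omega>) B = of_nat 0}"
    by (auto simp: point_count_def emeasure_count_space_eq_0)
  show ?thesis
  proof (cases "emeasure lborel B < \<infinity>")
    case True
    have "emeasure ?\<Lambda> B = ennreal \<gamma> * emeasure lborel B" by simp
    then have fin: "emeasure ?\<Lambda> B < \<infinity>" using True by (simp add: ennreal_mult_less_top)
    have "measure ?\<Lambda> B = \<gamma> * measure lborel B"
      using \<gamma> by (simp add: measure_def enn2real_mult)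
    moreover have "measure M {\<omega> \<in> space M. point_count (\<Gamma> \<omega>) B = of_nat 0} =
        measure ?\<Lambda> B ^ 0 / fact 0 * exp (- measure ?\<Lambda> B)"
      using pp B fin unfolding poisson_process_def by blast
    ultimately show ?thesis using True ev by simp
  next
    case False
    then have "emeasure lborel B = \<infinity>" by (simp add: less_top[symmetric])
    then have "emeasure ?\<Lambda> B = \<infinity>" using \<gamma> by (simp add: ennreal_mult_eq_top_iff)
    then have "AE \<omega> in M. point_count (\<Gamma> \<omega>) B = \<infinity>" using pp B unfolding poisson_process_def by blast
    then have "AE \<omega> in M. \<not> point_count (\<Gamma> \<omega>) B = of_nat 0" by eventually_elim auto
    then have "measure M {\<omega> \<in> space M. point_count (\<Gamma> \<omega>) B = of_nat 0} = 0"
      by (intro prob_eq_0_AE) auto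
    then show ?thesis using False ev by simp
  qed
qed

lemma distr_poisson_translate:
  fixes \<Gamma> :: "'w \<Rightarrow> 'a::euclidean_space set"
  assumes M: "prob_space M" and P: "stationary_poisson_process M \<Gamma> \<gamma>" and \<gamma>: "\<gamma> > 0"
  shows "distr M config_algebra (\<lambda>\<omega>. (\<lambda>z. z - a) ` \<Gamma> \<omega>) = distr M config_algebra \<Gamma>"
proof (rule distr_config_eqI[OF M])
  show pp: "point_process M \<Gamma>"
    using P by (simp add: stationary_poisson_process_def poisson_process_def)
  then show "point_process M (\<lambda>\<omega>. (\<lambda>z. z - a) ` \<Gamma> \<omega>)" by (rule point_process_translate)
  fix B :: "'a set" assume B: "B \<in> sets borel"
  have pre: "(\<lambda>z. z - a) -` B \<in> sets borel"
    using measurable_sets[of "\<lambda>z. z - a" borel borel B] B by simp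
  have im: "(\<lambda>z. 1 *\<^sub>R z + a) ` B = (\<lambda>z. z - a) -` B"
  proof -
    have "z \<in> (\<lambda>z. 1 *\<^sub>R z + a) ` B" if "z - a \<in> B" for z
      using that by (intro image_eqI[of _ _ "z - a"]) auto
    then show ?thesis by auto
  qed
  have "emeasure lebesgue ((\<lambda>z. z - a) -` B) = emeasure lebesgue B"
    unfolding im[symmetric] by (subst emeasure_lebesgue_affine) simp
  then have e: "emeasure lborel ((\<lambda>z. z - a) -` B) = emeasure lborel B" using B pre by simp
  then have "measure lborel ((\<lambda>z. z - a) -` B) = measure lborel B" by (simp add: measure_def)
  moreover have "{\<omega> \<in> space M. (\<lambda>z. z - a) ` \<Gamma> \<omega> \<inter> B = {}} = {\<omega> \<in> space M. \<Gamma> \<omega> \<inter> (\<lambda>z. z - a) -` B = {}}"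
    by auto
  ultimately show "measure M {\<omega> \<in> space M. (\<lambda>z. z - a) ` \<Gamma> \<omega> \<inter> B = {}} = measure M {\<omega> \<in> space M. \<Gamma> \<omega> \<inter> B = {}}"
    using poisson_void_probability[OF M P \<gamma> B] poisson_void_probability[OF M P \<gamma> pre] e by simp
qed

lemma pred_point_in_cell_filling_union:
  fixes W :: "(real ^ 'n::{finite,linorder}) set"
  assumes W: "W \<in> lmeasurable" "W \<in> sets borel" "W \<noteq> {}" and \<alpha>: "0 < \<alpha>"
    and pp: "point_process N \<phi>"
  shows "Measurable.pred (N \<Otimes>\<^sub>M borel) (\<lambda>(p, y). y \<in> cell_filling_union W \<alpha> (\<phi> p))"
proof -
  have "point_process (N \<Otimes>\<^sub>M (borel :: (real, 'n) vec measure)) (\<lambda>q. \<phi> (fst q))"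
    by (rule point_process_compose[OF pp]) measurable
  from pred_cell_filling_union[OF W \<alpha> this, of snd] show ?thesis by (simp add: split_beta')
qed

text \<open>Shifting the measure amounts to applying the same measurable map to the shifted
  configuration, so translation invariance of the law of \<Gamma> is pushed forward.\<close>

lemma stationary_volume_measure:
  fixes \<Gamma> :: "'w \<Rightarrow> (real ^ 'n::{finite,linorder}) set"
  assumes M: "prob_space M" and P: "stationary_poisson_process M \<Gamma> \<gamma>" and \<gamma>: "\<gamma> > 0"
    and W: "W \<in> lmeasurable" "W \<in> sets borel" "W \<noteq> {}" and \<alpha>: "0 < \<alpha>"
  shows "stationary_random_measure M (\<lambda>\<omega>. volume_measure (cell_filling_union W \<alpha> (\<Gamma> \<omega>)))"
proof -
  let ?V = "\<lambda>\<phi>. volume_measure (cell_filling_union W \<alpha> \<phi>)"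
  have pp: "point_process M \<Gamma>"
    using P by (simp add: stationary_poisson_process_def poisson_process_def)
  have V[measurable]: "?V \<in> config_algebra \<rightarrow>\<^sub>M lf_measure_algebra"
    by (rule measurable_volume_measure(1)[OF pred_point_in_cell_filling_union[OF W \<alpha> point_process_config]])
  have \<Gamma>[measurable]: "(\<lambda>\<omega>. (\<lambda>z. z - a) ` \<Gamma> \<omega>) \<in> M \<rightarrow>\<^sub>M config_algebra" for a
    using point_process_measurable[OF point_process_translate[OF pp]] .
  have [measurable]: "\<Gamma> \<in> M \<rightarrow>\<^sub>M config_algebra" using point_process_measurable[OF pp] .
  have "distr M lf_measure_algebra (\<lambda>\<omega>. shift_measure a (?V (\<Gamma> \<omega>))) = distr M lf_measure_algebra (\<lambda>\<omega>. ?V (\<Gamma> \<omega>))" for a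
  proof -
    have "distr M lf_measure_algebra (\<lambda>\<omega>. shift_measure a (?V (\<Gamma> \<omega>))) =
        distr M lf_measure_algebra (?V \<circ> (\<lambda>\<omega>. (\<lambda>z. z - a) ` \<Gamma> \<omega>))"
    proof (rule distr_cong)
      fix \<omega> assume "\<omega> \<in> space M"
      then have "cell_filling_union W \<alpha> (\<Gamma> \<omega>) \<in> sets lebesgue"
        using pp W by (intro sets_cell_filling_union) (auto simp: point_process_def)
      then show "shift_measure a (?V (\<Gamma> \<omega>)) = (?V \<circ> (\<lambda>\<omega>. (\<lambda>z. z - a) ` \<Gamma> \<omega>)) \<omega>"
        by (simp add: shift_volume_measure cell_filling_union_translate)
    qed auto
    also have "\<dots> = distr (distr M config_algebra (\<lambda>\<omega>. (\<lambda>z. z - a) ` \<Gamma> \<omega>)) lf_measure_algebra ?V"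
      by (simp add: distr_distr[OF V \<Gamma>])
    also have "\<dots> = distr (distr M config_algebra \<Gamma>) lf_measure_algebra ?V"
      by (simp only: distr_poisson_translate[OF M P \<gamma>])
    also have "\<dots> = distr M lf_measure_algebra (?V \<circ> \<Gamma>)"
      by (intro distr_distr) measurable
    finally show ?thesis by (simp add: o_def)
  qed
  then show ?thesis
    unfolding stationary_random_measure_def random_measure_def by (auto intro!: measurable_compose[OF _ V])
qed

section \<open>The excess volume comes from the cells crossing the boundary\<close>

text \<open>Every cell contained in the window \<open>A\<close> contributes exactly the fraction \<open>\<alpha>\<close> of its volume,
  so only the points outside those cells enter \<open>\<Psi> A - \<alpha> \<lambda> A\<close>.\<close>

definition inner_cells :: "(real ^ 'n::{finite,linorder}) set \<Rightarrow> (real ^ 'n::{finite,linorder}) set \<Rightarrow>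
    (real ^ 'n::{finite,linorder}) set" where
  "inner_cells A \<phi> = (\<Union>x\<in>{x\<in>\<phi>. emeasure lborel (cell \<phi> x - A) = 0}. cell \<phi> x)"

text \<open>The density of Psi - \<alpha> \<lambda>, overwritten by 0 on the inner cells. Each of
  these has integral 0 anyway, but without the overwriting the field would not vanish pointwise in
  the bulk of A.\<close>

definition excess :: "(real ^ 'n::{finite,linorder}) set \<Rightarrow> real \<Rightarrow> (real ^ 'n::{finite,linorder}) set \<Rightarrow>
    (real ^ 'n::{finite,linorder}) set \<Rightarrow> real ^ 'n::{finite,linorder} \<Rightarrow> real" where
  "excess W \<alpha> A \<phi> u =
     (if u \<in> inner_cells A \<phi> then 0 else indicator (cell_filling_union W \<alpha> \<phi>) u - \<alpha>)"

lemma abs_excess_le: "0 < \<alpha> \<Longrightarrow> \<alpha> \<le> 1 \<Longrightarrow> \<bar>excess W \<alpha> A \<phi> u\<bar> \<le> 1"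
  by (auto simp: excess_def indicator_def)

lemma borel_cell_filling_union:
  fixes W :: "(real ^ 'n::{finite,linorder}) set"
  assumes W: "W \<in> lmeasurable" "W \<in> sets borel" "W \<noteq> {}" and \<alpha>: "0 < \<alpha>" and "locally_finite \<phi>"
  shows "cell_filling_union W \<alpha> \<phi> \<in> sets borel"
  using pred_section_borel[OF pred_point_in_cell_filling_union[OF W \<alpha> point_process_config], of \<phi>] assms(5) by simp

lemma borel_inner_cells:
  fixes \<phi> :: "(real ^ 'n::{finite,linorder}) set"
  assumes "locally_finite \<phi>" shows "inner_cells A \<phi> \<in> sets borel"
  unfolding inner_cells_def
  using countable_subset[OF _ countable_locally_finite[OF assms]] cell_borel[OF assms]
  by (intro sets.countable_UN') auto

text \<open>\<open>emeasure_filling\<close> summed over countably many disjoint cells. Intersecting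
  with A loses only null sets, since inner cells lie in A up to null sets.\<close>

lemma emeasure_cell_filling_union_inner_cells:
  fixes W :: "(real ^ 'n::{finite,linorder}) set"
  assumes W: "W \<in> lmeasurable" "W \<in> sets borel" "0 \<in> interior W" and \<alpha>: "0 < \<alpha>" "\<alpha> \<le> 1"
    and \<phi>: "locally_finite \<phi>" and A: "A \<in> sets borel"
  shows "emeasure lebesgue (cell_filling_union W \<alpha> \<phi> \<inter> (inner_cells A \<phi> \<inter> A)) =
    ennreal \<alpha> * emeasure lebesgue (inner_cells A \<phi> \<inter> A)"
proof -
  let ?I = "{x\<in>\<phi>. emeasure lborel (cell \<phi> x - A) = 0}"
  let ?F = "\<lambda>x. filling W \<alpha> (cell \<phi> x) x"
  have cI: "countable ?I" by (rule countable_subset[OF _ countable_locally_finite[OF \<phi>]]) auto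
  have Ws: "W \<in> sets lebesgue" using W(1) by (rule fmeasurableD)
  have Al: "A \<in> sets lebesgue" using A by simp
  have cl: "cell \<phi> x \<in> sets lebesgue" for x by (rule sets_lebesgue_cell[OF \<phi>])
  have Fl: "?F x \<in> sets lebesgue" for x by (rule sets_filling[OF Ws cl])
  have eq: "emeasure lebesgue (?F x \<inter> A) = ennreal \<alpha> * emeasure lebesgue (cell \<phi> x \<inter> A)" if x: "x \<in> ?I" for x
  proof -
    have 0: "emeasure lebesgue (cell \<phi> x - A) = 0" using x cell_borel[OF \<phi>, of x] A by simp
    have "emeasure lebesgue S = emeasure lebesgue (S \<inter> A)" if S: "S \<in> sets lebesgue" "S \<subseteq> cell \<phi> x" for S
    proof (rule emeasure_subset_null_diff)
      have "emeasure lebesgue (S - S \<inter> A) \<le> emeasure lebesgue (cell \<phi> x - A)"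
        using S cl Al by (intro emeasure_mono) auto
      then show "emeasure lebesgue (S - S \<inter> A) = 0" using 0 by simp
    qed (use S Al in auto)
    from this[OF Fl filling_subset] this[OF cl order_refl] show ?thesis
      using emeasure_filling[OF W(1,3) cl \<alpha>] by simp
  qed
  have "cell_filling_union W \<alpha> \<phi> \<inter> (inner_cells A \<phi> \<inter> A) = (\<Union>x\<in>?I. ?F x \<inter> A)"
  proof -
    have "u \<in> (\<Union>x\<in>?I. ?F x \<inter> A)" if "u \<in> ?F x" "x \<in> \<phi>" "u \<in> cell \<phi> y" "y \<in> ?I" "u \<in> A" for u x y
    proof -
      have "u \<in> cell \<phi> x" using that(1) filling_subset by blast
      then have "x = y" using cell_unique[of u \<phi> x y] that by simp
      then show ?thesis using that by blast
    qed
    moreover have "u \<in> cell_filling_union W \<alpha> \<phi>" "u \<in> inner_cells A \<phi>" if "u \<in> ?F x" "x \<in> ?I" for u x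
      using that filling_subset[of W \<alpha> "cell \<phi> x" x] unfolding cell_filling_union_def inner_cells_def by blast+
    ultimately show ?thesis
      by (intro subset_antisym subsetI) (auto simp: cell_filling_union_def inner_cells_def)
  qed
  then have "emeasure lebesgue (cell_filling_union W \<alpha> \<phi> \<inter> (inner_cells A \<phi> \<inter> A)) =
      (\<integral>\<^sup>+x. emeasure lebesgue (?F x \<inter> A) \<partial>count_space ?I)"
    using cI Fl Al disjoint_fillings[of W \<alpha> \<phi>]
    by (simp only:) (intro emeasure_UN_countable; fastforce simp: disjoint_family_on_def)
  also have "\<dots> = (\<integral>\<^sup>+x. ennreal \<alpha> * emeasure lebesgue (cell \<phi> x \<inter> A) \<partial>count_space ?I)"
    using eq by (intro nn_integral_cong) simp
  also have "\<dots> = ennreal \<alpha> * (\<integral>\<^sup>+x. emeasure lebesgue (cell \<phi> x \<inter> A) \<partial>count_space ?I)"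
    by (simp add: nn_integral_cmult)
  also have "(\<integral>\<^sup>+x. emeasure lebesgue (cell \<phi> x \<inter> A) \<partial>count_space ?I) = emeasure lebesgue (\<Union>x\<in>?I. cell \<phi> x \<inter> A)"
    using cI cl Al cell_unique[where \<phi>=\<phi>]
    by (intro emeasure_UN_countable[symmetric]) (auto simp: disjoint_family_on_def)
  also have "(\<Union>x\<in>?I. cell \<phi> x \<inter> A) = inner_cells A \<phi> \<inter> A" by (auto simp: inner_cells_def)
  finally show ?thesis .
qed

text \<open>Split A along the inner cells G: on G the volume of Z is \<alpha> times that of G
  \<inter> A, and off G the integrand is the indicator of Z minus \<alpha>.\<close>

lemma measure_volume_measure_eq:
  fixes W :: "(real ^ 'n::{finite,linorder}) set"
  assumes W: "W \<in> lmeasurable" "W \<in> sets borel" "0 \<in> interior W" and \<alpha>: "0 < \<alpha>" "\<alpha> \<le> 1"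
    and \<phi>: "locally_finite \<phi>" and A: "A \<in> sets borel" "emeasure lborel A < \<infinity>"
  shows "measure (volume_measure (cell_filling_union W \<alpha> \<phi>)) A =
    \<alpha> * measure lborel A + (\<integral>u. indicator A u * excess W \<alpha> A \<phi> u \<partial>lborel)"
proof -
  define Z where "Z = cell_filling_union W \<alpha> \<phi>"
  define G where "G = inner_cells A \<phi>"
  have "W \<noteq> {}" using W(3) interior_subset by blast
  then have Z: "Z \<in> sets borel" unfolding Z_def using borel_cell_filling_union[OF W(1,2) _ \<alpha>(1) \<phi>] by blast
  have G: "G \<in> sets borel" unfolding G_def by (rule borel_inner_cells[OF \<phi>])
  note [measurable] = Z G A(1)
  have fm: "S \<in> fmeasurable lborel" if "S \<in> sets borel" "S \<subseteq> A" for S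
    using that A emeasure_mono[of S A lborel] by (auto simp: fmeasurable_def)
  have "emeasure lborel (Z \<inter> (G \<inter> A)) = ennreal \<alpha> * emeasure lborel (G \<inter> A)"
    using emeasure_cell_filling_union_inner_cells[OF W \<alpha> \<phi> A(1)] by (simp add: Z_def[symmetric] G_def[symmetric])
  then have ZG: "measure lborel (Z \<inter> (G \<inter> A)) = \<alpha> * measure lborel (G \<inter> A)"
    using \<alpha> by (simp add: measure_def enn2real_mult)
  have split: "measure lborel S = measure lborel (S \<inter> G) + measure lborel (S - G)" if "S \<in> sets borel" "S \<subseteq> A" for S
    using measure_Un2[of "S \<inter> G" lborel S] that fm[of "S \<inter> G"] fm[of S]
    by (auto simp: Un_absorb1 Diff_Int)
  have "(\<integral>u. indicator A u * excess W \<alpha> A \<phi> u \<partial>lborel) =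
      (\<integral>u. indicator (Z \<inter> A - G) u - \<alpha> * indicator (A - G) u \<partial>lborel)"
    by (intro Bochner_Integration.integral_cong) (auto simp: excess_def Z_def G_def indicator_def)
  also have "\<dots> = measure lborel (Z \<inter> A - G) - \<alpha> * measure lborel (A - G)"
  proof -
    have "emeasure lborel (Z \<inter> A - G) < \<infinity>" "emeasure lborel (A - G) < \<infinity>"
      using fm[of "Z \<inter> A - G"] fm[of "A - G"] by (auto simp: fmeasurable_def)
    then show ?thesis by (subst Bochner_Integration.integral_diff) auto
  qed
  finally have I: "(\<integral>u. indicator A u * excess W \<alpha> A \<phi> u \<partial>lborel) =
    measure lborel (Z \<inter> A - G) - \<alpha> * measure lborel (A - G)" .
  have "measure (volume_measure Z) A = measure lborel (Z \<inter> A)"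
    using Z A by (simp add: measure_def emeasure_volume_measure)
  also have "\<dots> = measure lborel (Z \<inter> (G \<inter> A)) + measure lborel (Z \<inter> A - G)"
    using split[of "Z \<inter> A"] by (simp add: Int_ac)
  also have "\<dots> = \<alpha> * measure lborel A + (measure lborel (Z \<inter> A - G) - \<alpha> * measure lborel (A - G))"
    using split[of A] A(1) ZG by (simp add: Int_commute[of A] algebra_simps)
  finally show ?thesis using I by (simp add: Z_def)
qed

subsection \<open>Localisation\<close>

text \<open>Cutting the field to 0 where a gap occurs makes its dependence on the points near u
  exact for every locally finite configuration, so that independence can be applied without error
  terms.\<close>

definition local_excess :: "(real ^ 'n::{finite,linorder}) set \<Rightarrow> real \<Rightarrow> (real ^ 'n::{finite,linorder}) set \<Rightarrow> real \<Rightarrow>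
    (real ^ 'n::{finite,linorder}) set \<Rightarrow> (real ^ 'n::{finite,linorder}) set \<Rightarrow> real ^ 'n::{finite,linorder} \<Rightarrow> real" where
  "local_excess T d W \<alpha> A \<phi> u = (if filled T u d \<phi> then excess W \<alpha> A \<phi> u else 0)"

lemma abs_local_excess_le: "0 < \<alpha> \<Longrightarrow> \<alpha> \<le> 1 \<Longrightarrow> \<bar>local_excess T d W \<alpha> A \<phi> u\<bar> \<le> 1"
  using abs_excess_le[of \<alpha> W A \<phi> u] by (simp add: local_excess_def)

lemma covering_nonempty: "covering T \<Longrightarrow> T \<noteq> {}"
  by (auto simp: covering_def)

lemma filled_nonempty: "covering T \<Longrightarrow> filled T u d \<phi> \<Longrightarrow> \<phi> \<noteq> {}"
  using covering_nonempty[of T] by (auto simp: filled_def)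

text \<open>Both the membership of u in Z and the test whether its cell is inner depend only on the
  nucleus and shape of the cell of u. By \<open>filled_cell_local\<close> these agree for \<phi> and
  its restriction; the cut-off itself is local by \<open>filled_local\<close>.\<close>

lemma local_excess_local:
  fixes \<phi> :: "(real ^ 'n::{finite,linorder}) set"
  assumes T: "covering T" "d > 0" and \<phi>: "locally_finite \<phi>"
  shows "local_excess T d W \<alpha> A (\<phi> \<inter> ball u (5 * d)) u = local_excess T d W \<alpha> A \<phi> u"
proof (cases "filled T u d \<phi>")
  case True
  define \<psi> where "\<psi> = \<phi> \<inter> ball u (5 * d)"
  have \<psi>: "filled T u d \<psi>" using True filled_local[OF T] by (simp add: \<psi>_def)
  obtain x where x: "x \<in> \<phi>" "u \<in> cell \<phi> x" using ex_closest[OF \<phi> filled_nonempty[OF T(1) True]] by blast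
  note x' = filled_cell_local[OF T True \<psi>_def x]
  have Z: "u \<in> cell_filling_union W \<alpha> \<eta> \<longleftrightarrow> u \<in> filling W \<alpha> (cell \<phi> x) x"
    and G: "u \<in> inner_cells A \<eta> \<longleftrightarrow> emeasure lborel (cell \<phi> x - A) = 0"
    if "x \<in> \<eta>" "cell \<eta> x = cell \<phi> x" for \<eta>
  proof -
    have uniq: "y = x" if "y \<in> \<eta>" "u \<in> cell \<eta> y" for y
      using cell_unique[of u \<eta> y x] that \<open>x \<in> \<eta>\<close> \<open>cell \<eta> x = cell \<phi> x\<close> x(2) by simp
    show "u \<in> cell_filling_union W \<alpha> \<eta> \<longleftrightarrow> u \<in> filling W \<alpha> (cell \<phi> x) x"
    proof
      assume "u \<in> cell_filling_union W \<alpha> \<eta>"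
      then obtain y where y: "y \<in> \<eta>" "u \<in> filling W \<alpha> (cell \<eta> y) y" by (auto simp: cell_filling_union_def)
      then show "u \<in> filling W \<alpha> (cell \<phi> x) x"
        using uniq[of y] filling_subset[of W \<alpha> "cell \<eta> y" y] that by auto
    next
      assume "u \<in> filling W \<alpha> (cell \<phi> x) x"
      then have "u \<in> filling W \<alpha> (cell \<eta> x) x" by (simp add: that(2))
      then show "u \<in> cell_filling_union W \<alpha> \<eta>" using that(1) unfolding cell_filling_union_def by blast
    qed
    show "u \<in> inner_cells A \<eta> \<longleftrightarrow> emeasure lborel (cell \<phi> x - A) = 0"
    proof
      assume "u \<in> inner_cells A \<eta>"
      then obtain y where "y \<in> \<eta>" "u \<in> cell \<eta> y" "emeasure lborel (cell \<eta> y - A) = 0"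
        unfolding inner_cells_def by blast
      then show "emeasure lborel (cell \<phi> x - A) = 0" using uniq[of y] that by simp
    next
      assume "emeasure lborel (cell \<phi> x - A) = 0"
      then have "x \<in> {x \<in> \<eta>. emeasure lborel (cell \<eta> x - A) = 0}" "u \<in> cell \<eta> x"
        using that x(2) by simp_all
      then show "u \<in> inner_cells A \<eta>" unfolding inner_cells_def by blast
    qed
  qed
  have "excess W \<alpha> A \<psi> u = excess W \<alpha> A \<phi> u"
    using Z[OF x'] Z[OF x(1) refl] G[OF x'] G[OF x(1) refl] by (simp add: excess_def indicator_def)
  then show ?thesis using True \<psi> by (simp add: local_excess_def \<psi>_def)
next
  case False
  then show ?thesis using filled_local[OF T] by (simp add: local_excess_def)
qed

lemma local_excess_eq_0:
  fixes \<phi> :: "(real ^ 'n::{finite,linorder}) set"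
  assumes T: "covering T" "d > 0" and \<phi>: "locally_finite \<phi>" and u: "norm u < r - 3 * d"
  shows "local_excess T d W \<alpha> (cball 0 r) \<phi> u = 0"
proof (cases "filled T u d \<phi>")
  case True
  obtain x where x: "x \<in> \<phi>" "u \<in> cell \<phi> x" using ex_closest[OF \<phi> filled_nonempty[OF T(1) True]] by blast
  have "cell \<phi> x \<subseteq> ball u (3 * d)" using filled_cell_bounded[OF T True x(2)] by simp
  also have "\<dots> \<subseteq> cball 0 r"
  proof
    fix y assume "y \<in> ball u (3 * d)"
    then have "dist u y < 3 * d" by simp
    then show "y \<in> cball 0 r" using u dist_triangle[of 0 y u] by simp
  qed
  finally have "cell \<phi> x - cball 0 r = {}" by blast
  then have "emeasure lborel (cell \<phi> x - cball 0 r) = 0" by (simp only: emeasure_empty)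
  then have "u \<in> inner_cells (cball 0 r) \<phi>" unfolding inner_cells_def using x by blast
  then show ?thesis by (simp add: local_excess_def excess_def)
qed (simp add: local_excess_def)

text \<open>Being inside A is tested through the volume of the cell outside A, a measurable function
  by Fubini, which avoids a quantifier over all points of the cell.\<close>

lemma pred_inner_cells:
  fixes \<phi> :: "'p \<Rightarrow> (real ^ 'n::{finite,linorder}) set"
  assumes pp: "point_process P \<phi>" and f[measurable]: "f \<in> P \<rightarrow>\<^sub>M borel" and A[measurable]: "A \<in> sets borel"
  shows "Measurable.pred P (\<lambda>p. f p \<in> inner_cells A (\<phi> p))"
proof -
  let ?P = "P \<Otimes>\<^sub>M (borel :: (real, 'n) vec measure)"
  have pp1: "point_process ?P (\<lambda>q. \<phi> (fst q))"
    by (rule point_process_compose[OF pp]) measurable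
  have pp2: "point_process (?P \<Otimes>\<^sub>M (borel :: (real, 'n) vec measure)) (\<lambda>q. \<phi> (fst (fst q)))"
    by (rule point_process_compose[OF pp]) measurable
  have [measurable]: "Measurable.pred (?P \<Otimes>\<^sub>M (borel :: (real, 'n) vec measure)) (\<lambda>q. snd q \<in> cell (\<phi> (fst (fst q))) (snd (fst q)))"
    by (rule pred_cell[OF pp2]) measurable
  have "Measurable.pred (?P \<Otimes>\<^sub>M borel) (\<lambda>(q, y). y \<in> cell (\<phi> (fst q)) (snd q) - A)"
    unfolding split_beta' Diff_iff by measurable
  then have [measurable]: "(\<lambda>q. emeasure lborel (cell (\<phi> (fst q)) (snd q) - A)) \<in> borel_measurable ?P"
    by (rule measurable_emeasure_section)
  have [measurable]: "Measurable.pred ?P (\<lambda>q. f (fst q) \<in> cell (\<phi> (fst q)) (snd q))"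
    by (rule pred_cell[OF pp1]) measurable
  have "Measurable.pred P (\<lambda>p. \<exists>x\<in>\<phi> p. f p \<in> cell (\<phi> p) x \<and> emeasure lborel (cell (\<phi> p) x - A) = 0)"
    by (rule pred_Bex_point_process[OF pp]) (simp add: split_beta')
  moreover have "f p \<in> inner_cells A (\<phi> p) \<longleftrightarrow>
      (\<exists>x\<in>\<phi> p. f p \<in> cell (\<phi> p) x \<and> emeasure lborel (cell (\<phi> p) x - A) = 0)" for p
    by (auto simp: inner_cells_def)
  ultimately show ?thesis by simp
qed

lemma pred_filled:
  fixes \<phi> :: "'p \<Rightarrow> 'a::euclidean_space set"
  assumes pp: "point_process P \<phi>" and f[measurable]: "f \<in> P \<rightarrow>\<^sub>M borel" and T: "finite T"
  shows "Measurable.pred P (\<lambda>p. filled T (f p) d (\<phi> p))"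
proof -
  have "Measurable.pred P (\<lambda>p. \<exists>z\<in>\<phi> p. dist (f p + d *\<^sub>R t) z < d / 2)" for t
    by (rule pred_Bex_point_process[OF pp]) measurable
  then have "Measurable.pred P (\<lambda>p. \<forall>t\<in>T. \<exists>z\<in>\<phi> p. dist (f p + d *\<^sub>R t) z < d / 2)"
    by (intro pred_intros_finite T)
  moreover have "filled T u d \<eta> \<longleftrightarrow> (\<forall>t\<in>T. \<exists>z\<in>\<eta>. dist (u + d *\<^sub>R t) z < d / 2)" for u \<eta>
    unfolding filled_def by (simp add: disjoint_iff) (metis mem_ball)
  ultimately show ?thesis by simp
qed

lemma measurable_excess:
  fixes W :: "(real ^ 'n::{finite,linorder}) set"
  assumes W: "W \<in> lmeasurable" "W \<in> sets borel" "W \<noteq> {}" and \<alpha>: "0 < \<alpha>"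
    and pp: "point_process P \<phi>" and f: "f \<in> P \<rightarrow>\<^sub>M borel" and A: "A \<in> sets borel"
  shows "(\<lambda>p. excess W \<alpha> A (\<phi> p) (f p)) \<in> borel_measurable P"
proof -
  note [measurable] = pred_cell_filling_union[OF W \<alpha> pp f] pred_inner_cells[OF pp f A]
  show ?thesis unfolding excess_def indicator_def by measurable
qed

lemma measurable_local_excess:
  fixes W :: "(real ^ 'n::{finite,linorder}) set"
  assumes W: "W \<in> lmeasurable" "W \<in> sets borel" "W \<noteq> {}" and \<alpha>: "0 < \<alpha>"
    and pp: "point_process P \<phi>" and f: "f \<in> P \<rightarrow>\<^sub>M borel" and A: "A \<in> sets borel" and T: "finite T"
  shows "(\<lambda>p. local_excess T d W \<alpha> A (\<phi> p) (f p)) \<in> borel_measurable P"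
proof -
  note [measurable] = measurable_excess[OF W \<alpha> pp f A] pred_filled[OF pp f T]
  show ?thesis unfolding local_excess_def by measurable
qed

section \<open>Independence in disjoint regions\<close>

text \<open>The events that \<Gamma> avoids A \<inter> B generate the algebra of \<Gamma> \<inter>
  A. Avoiding a set in A1 and one in A2 means avoiding their disjoint union; volumes are finite and
  add up, so the exponential factorises.\<close>

lemma indep_var_poisson_disjoint:
  fixes \<Gamma> :: "'w \<Rightarrow> 'a::euclidean_space set"
  assumes M: "prob_space M" and P: "stationary_poisson_process M \<Gamma> \<gamma>" and \<gamma>: "\<gamma> > 0"
    and A: "A1 \<in> sets borel" "A2 \<in> sets borel" "A1 \<inter> A2 = {}"
      "emeasure lborel A1 < \<infinity>" "emeasure lborel A2 < \<infinity>"
  shows "prob_space.indep_var M config_algebra (\<lambda>\<omega>. \<Gamma> \<omega> \<inter> A1) config_algebra (\<lambda>\<omega>. \<Gamma> \<omega> \<inter> A2)"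
proof -
  interpret prob_space M by fact
  have pp: "point_process M \<Gamma>"
    using P by (simp add: stationary_poisson_process_def poisson_process_def)
  note meas = point_process_measurable[OF point_process_Int[OF pp]]
  have lf: "locally_finite (\<Gamma> \<omega> \<inter> A)" if "\<omega> \<in> space M" for \<omega> A
    using pp that locally_finite_subset[of "\<Gamma> \<omega>"] by (auto simp: point_process_def)
  define E where "E A = {(\<lambda>\<omega>. \<Gamma> \<omega> \<inter> A) -` S \<inter> space M |S. S \<in> void ` sets borel}" for A
  have ev: "(\<lambda>\<omega>. \<Gamma> \<omega> \<inter> A) -` void B \<inter> space M = {\<omega> \<in> space M. \<Gamma> \<omega> \<inter> (A \<inter> B) = {}}" for A B
    using lf by (auto simp: void_def)
  have sig: "sigma_sets (space M) {(\<lambda>\<omega>. \<Gamma> \<omega> \<inter> A) -` S \<inter> space M |S. S \<in> sets config_algebra} = sigma_sets (space M) (E A)" for A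
  proof -
    have "{(\<lambda>\<omega>. \<Gamma> \<omega> \<inter> A) -` S \<inter> space M |S. S \<in> sets config_algebra} = sigma_sets (space M) (E A)"
      unfolding E_def sets_config by (rule sigma_sets_vimage_commute) (use lf in auto)
    moreover have "E A \<subseteq> Pow (space M)" by (auto simp: E_def)
    ultimately show ?thesis by (simp only: sigma_sets_sigma_sets_eq)
  qed
  have stable: "Int_stable (E A)" for A
  proof (rule Int_stableI)
    fix a b assume "a \<in> E A" "b \<in> E A"
    then obtain S1 S2 where S: "S1 \<in> void ` sets borel" "S2 \<in> void ` sets borel"
      "a = (\<lambda>\<omega>. \<Gamma> \<omega> \<inter> A) -` S1 \<inter> space M" "b = (\<lambda>\<omega>. \<Gamma> \<omega> \<inter> A) -` S2 \<inter> space M"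
      unfolding E_def by auto
    then have "S1 \<inter> S2 \<in> void ` sets borel" using Int_stable_void Int_stableD by blast
    moreover have "a \<inter> b = (\<lambda>\<omega>. \<Gamma> \<omega> \<inter> A) -` (S1 \<inter> S2) \<inter> space M" using S by auto
    ultimately show "a \<inter> b \<in> E A" unfolding E_def by blast
  qed
  have "indep_set (E A1) (E A2)"
  proof (rule indep_setI)
    have "E A \<subseteq> events" if "A \<in> sets borel" for A
      using measurable_sets[OF meas[OF that]] void_in_sets by (auto simp: E_def)
    then show "E A1 \<subseteq> events" "E A2 \<subseteq> events" using A by auto
    fix a b assume "a \<in> E A1" "b \<in> E A2"
    then obtain B1 B2 where B: "B1 \<in> sets borel" "B2 \<in> sets borel"
      "a = {\<omega> \<in> space M. \<Gamma> \<omega> \<inter> (A1 \<inter> B1) = {}}" "b = {\<omega> \<in> space M. \<Gamma> \<omega> \<inter> (A2 \<inter> B2) = {}}"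
      unfolding E_def by (auto simp: ev)
    have s: "A1 \<inter> B1 \<in> sets borel" "A2 \<inter> B2 \<in> sets borel" "A1 \<inter> B1 \<union> A2 \<inter> B2 \<in> sets borel"
      using A B by auto
    have "emeasure lborel (A1 \<inter> B1) \<le> emeasure lborel A1" "emeasure lborel (A2 \<inter> B2) \<le> emeasure lborel A2"
      using A by (auto intro!: emeasure_mono)
    then have f: "emeasure lborel (A1 \<inter> B1) < \<infinity>" "emeasure lborel (A2 \<inter> B2) < \<infinity>"
      using A by (auto intro: le_less_trans)
    have u: "emeasure lborel (A1 \<inter> B1 \<union> A2 \<inter> B2) = emeasure lborel (A1 \<inter> B1) + emeasure lborel (A2 \<inter> B2)"
      using s A by (intro plus_emeasure[symmetric]) auto
    have m: "measure lborel (A1 \<inter> B1 \<union> A2 \<inter> B2) = measure lborel (A1 \<inter> B1) + measure lborel (A2 \<inter> B2)"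
      unfolding measure_def u using f by (simp add: enn2real_plus)
    have "a \<inter> b = {\<omega> \<in> space M. \<Gamma> \<omega> \<inter> (A1 \<inter> B1 \<union> A2 \<inter> B2) = {}}" using B by auto
    then show "prob (a \<inter> b) = prob a * prob b"
      using f u m s by (simp add: B(3,4) poisson_void_probability[OF M P \<gamma>] exp_add[symmetric] algebra_simps)
  qed
  then have "indep_set (sigma_sets (space M) (E A1)) (sigma_sets (space M) (E A2))"
    by (rule indep_set_sigma_sets[OF _ stable stable])
  then show ?thesis
    unfolding indep_var_eq sig using meas A by blast
qed

section \<open>Variance of integrals of locally dependent fields\<close>

text \<open>The two sides differ by the square of E X - c. It allows an integral to be centred at
  the mean of its approximation instead of its own mean.\<close>

lemma (in prob_space) variance_le_second_moment:
  fixes X :: "'a \<Rightarrow> real"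
  assumes "integrable M X" "integrable M (\<lambda>\<omega>. (X \<omega>)\<^sup>2)"
  shows "variance X \<le> expectation (\<lambda>\<omega>. (X \<omega> - c)\<^sup>2)"
proof -
  have "expectation (\<lambda>\<omega>. (X \<omega> - c)\<^sup>2) = expectation (\<lambda>\<omega>. (X \<omega>)\<^sup>2 - 2 * c * X \<omega> + c\<^sup>2)"
    by (intro Bochner_Integration.integral_cong) (auto simp: power2_diff)
  also have "\<dots> = expectation (\<lambda>\<omega>. (X \<omega>)\<^sup>2) - 2 * c * expectation X + c\<^sup>2"
    using assms by (simp add: prob_space)
  finally have "expectation (\<lambda>\<omega>. (X \<omega> - c)\<^sup>2) - variance X = (expectation X - c)\<^sup>2"
    unfolding variance_eq[OF assms] by (simp add: power2_diff power2_eq_square algebra_simps)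
  then show ?thesis using zero_le_power2[of "expectation X - c"] by linarith
qed

text \<open>By Fubini the variance is the double integral of the covariances. These vanish at
  distance at least R and are at most 2 otherwise, and the pairs closer than R have measure at most
  b times the total mass.\<close>

lemma (in prob_space) variance_local_field_le:
  fixes f :: "'a \<Rightarrow> 'b::euclidean_space \<Rightarrow> real"
  assumes \<nu>: "finite_measure \<nu>" "sets \<nu> = sets borel"
    and f: "(\<lambda>(\<omega>, u). f \<omega> u) \<in> borel_measurable (M \<Otimes>\<^sub>M \<nu>)"
    and bound: "\<And>\<omega> u. \<bar>f \<omega> u\<bar> \<le> 1"
    and uncorr: "\<And>u v. R \<le> dist u v \<Longrightarrow>
      expectation (\<lambda>\<omega>. f \<omega> u * f \<omega> v) = expectation (\<lambda>\<omega>. f \<omega> u) * expectation (\<lambda>\<omega>. f \<omega> v)"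
    and ball: "\<And>u. measure \<nu> (ball u R) \<le> b"
  shows "variance (\<lambda>\<omega>. \<integral>u. f \<omega> u \<partial>\<nu>) \<le> 2 * b * measure \<nu> UNIV"
proof -
  interpret N: finite_measure \<nu> by fact
  let ?\<nu>2 = "\<nu> \<Otimes>\<^sub>M \<nu>"
  interpret N2: finite_measure ?\<nu>2 by (rule finite_measure_pair_measure[OF \<nu>(1) \<nu>(1)])
  interpret MN: pair_sigma_finite M \<nu> ..
  interpret NN: pair_sigma_finite \<nu> \<nu> ..
  interpret MN2: pair_sigma_finite M ?\<nu>2 ..
  interpret FMN: finite_measure "M \<Otimes>\<^sub>M \<nu>"
    by (rule finite_measure_pair_measure[OF \<nu>(1) finite_measure_axioms])
  interpret FMN2: finite_measure "M \<Otimes>\<^sub>M ?\<nu>2"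
    by (rule finite_measure_pair_measure[OF N2.finite_measure_axioms finite_measure_axioms])
  note f[measurable]
  have space\<nu>: "space \<nu> = UNIV" using sets_eq_imp_space_eq[OF \<nu>(2)] by simp
  have sec[measurable]: "f \<omega> \<in> borel_measurable \<nu>" if "\<omega> \<in> space M" for \<omega>
    using measurable_compose[OF measurable_Pair1'[OF that] f] by simp
  have sec2[measurable]: "(\<lambda>\<omega>. f \<omega> u) \<in> borel_measurable M" for u
    using measurable_compose[OF measurable_Pair2'[of u \<nu> M] f] by (simp add: space\<nu>)
  let ?I = "\<lambda>\<omega>. \<integral>u. f \<omega> u \<partial>\<nu>"
  let ?m = "\<lambda>u. expectation (\<lambda>\<omega>. f \<omega> u)"
  define g where "g \<omega> z = f \<omega> (fst z) * f \<omega> (snd z)" for \<omega> z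
  have g_bound: "\<bar>g \<omega> z\<bar> \<le> 1" for \<omega> z
    using mult_mono[OF bound[of \<omega> "fst z"] bound[of \<omega> "snd z"]] by (simp add: g_def abs_mult)
  have "(\<lambda>q. f (fst q) (fst (snd q)) * f (fst q) (snd (snd q))) \<in> borel_measurable (M \<Otimes>\<^sub>M ?\<nu>2)"
  proof (intro borel_measurable_times)
    show "(\<lambda>q. f (fst q) (fst (snd q))) \<in> borel_measurable (M \<Otimes>\<^sub>M ?\<nu>2)"
      using measurable_compose[OF _ f, of "\<lambda>q. (fst q, fst (snd q))" "M \<Otimes>\<^sub>M ?\<nu>2"] by simp
    show "(\<lambda>q. f (fst q) (snd (snd q))) \<in> borel_measurable (M \<Otimes>\<^sub>M ?\<nu>2)"
      using measurable_compose[OF _ f, of "\<lambda>q. (fst q, snd (snd q))" "M \<Otimes>\<^sub>M ?\<nu>2"] by simp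
  qed
  then have g_meas: "(\<lambda>(\<omega>, z). g \<omega> z) \<in> borel_measurable (M \<Otimes>\<^sub>M ?\<nu>2)"
    by (simp add: g_def split_beta')
  have g_int: "integrable (M \<Otimes>\<^sub>M ?\<nu>2) (\<lambda>(\<omega>, z). g \<omega> z)"
    using g_bound by (intro FMN2.integrable_const_bound[where B=1] g_meas) (auto simp: split_beta')
  have f_int: "integrable (M \<Otimes>\<^sub>M \<nu>) (\<lambda>(\<omega>, u). f \<omega> u)"
    using bound by (intro FMN.integrable_const_bound[where B=1] f) (auto simp: split_beta')
  have I_bound: "\<bar>?I \<omega>\<bar> \<le> measure \<nu> UNIV" if "\<omega> \<in> space M" for \<omega>
  proof -
    have "\<bar>?I \<omega>\<bar> \<le> (\<integral>u. \<bar>f \<omega> u\<bar> \<partial>\<nu>)" by (rule integral_abs_bound)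
    also have "\<dots> \<le> (\<integral>u. 1 \<partial>\<nu>)"
      using bound that by (intro integral_mono N.integrable_const_bound[where B=1]) auto
    finally show ?thesis by (simp add: space\<nu>)
  qed
  have I_meas[measurable]: "?I \<in> borel_measurable M"
    using MN.integrable_fst[OF f_int] by (rule borel_measurable_integrable)
  have I_int: "integrable M ?I" by (rule MN.integrable_fst[OF f_int])
  have I2_int: "integrable M (\<lambda>\<omega>. (?I \<omega>)\<^sup>2)"
    using I_bound by (intro integrable_const_bound[where B="(measure \<nu> UNIV)\<^sup>2"])
      (auto intro!: AE_I2 abs_le_square_iff[THEN iffD1])
  have I2: "(?I \<omega>)\<^sup>2 = (\<integral>z. g \<omega> z \<partial>?\<nu>2)" if "\<omega> \<in> space M" for \<omega>
  proof -
    have "integrable ?\<nu>2 (g \<omega>)"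
      using g_bound measurable_compose[OF measurable_Pair1'[OF that] g_meas]
      by (intro N2.integrable_const_bound[where B=1]) auto
    from NN.integral_fst'[OF this] show ?thesis
      by (simp add: g_def[abs_def] power2_eq_square)
  qed
  have "expectation (\<lambda>\<omega>. (?I \<omega>)\<^sup>2) = expectation (\<lambda>\<omega>. \<integral>z. g \<omega> z \<partial>?\<nu>2)"
    by (intro Bochner_Integration.integral_cong I2) auto
  also have "\<dots> = (\<integral>z. expectation (\<lambda>\<omega>. g \<omega> z) \<partial>?\<nu>2)"
    by (rule MN2.Fubini_integral[OF g_int, symmetric])
  finally have E2: "expectation (\<lambda>\<omega>. (?I \<omega>)\<^sup>2) = (\<integral>z. expectation (\<lambda>\<omega>. g \<omega> z) \<partial>?\<nu>2)" .
  have m_bound: "\<bar>?m u\<bar> \<le> 1" for u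
  proof -
    have "\<bar>?m u\<bar> \<le> expectation (\<lambda>\<omega>. \<bar>f \<omega> u\<bar>)" by (rule integral_abs_bound)
    also have "\<dots> \<le> expectation (\<lambda>\<omega>. 1)"
      using bound by (intro integral_mono integrable_const_bound[where B=1]) auto
    finally show ?thesis by (simp add: prob_space)
  qed
  have m_int: "integrable \<nu> ?m" by (rule MN.integrable_snd[OF f_int])
  then have m_meas[measurable]: "?m \<in> borel_measurable \<nu>" by (rule borel_measurable_integrable)
  have mm_bound: "\<bar>?m (fst z) * ?m (snd z)\<bar> \<le> 1" for z
    using mult_mono[OF m_bound[of "fst z"] m_bound[of "snd z"]] by (simp add: abs_mult)
  have mm_int: "integrable ?\<nu>2 (\<lambda>z. ?m (fst z) * ?m (snd z))"
    using mm_bound by (intro N2.integrable_const_bound[where B=1]) auto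
  have "expectation ?I = (\<integral>u. ?m u \<partial>\<nu>)"
    by (rule MN.Fubini_integral[OF f_int, symmetric])
  then have E1: "(expectation ?I)\<^sup>2 = (\<integral>z. ?m (fst z) * ?m (snd z) \<partial>?\<nu>2)"
    using NN.integral_fst'[OF mm_int] by (simp add: power2_eq_square)
  have D: "{z \<in> space ?\<nu>2. dist (fst z) (snd z) < R} \<in> sets ?\<nu>2"
  proof -
    have [measurable_cong]: "sets \<nu> = sets borel" by (rule \<nu>(2))
    show ?thesis by measurable
  qed
  have g_exp: "integrable ?\<nu>2 (\<lambda>z. expectation (\<lambda>\<omega>. g \<omega> z))" by (rule MN2.integrable_snd[OF g_int])
  have "variance ?I = (\<integral>z. expectation (\<lambda>\<omega>. g \<omega> z) - ?m (fst z) * ?m (snd z) \<partial>?\<nu>2)"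
    unfolding variance_eq[OF I_int I2_int] E1 E2
    by (rule Bochner_Integration.integral_diff[OF g_exp mm_int, symmetric])
  also have "\<dots> \<le> (\<integral>z. 2 * indicator {z \<in> space ?\<nu>2. dist (fst z) (snd z) < R} z \<partial>?\<nu>2)"
  proof (rule integral_mono)
    fix z assume z: "z \<in> space ?\<nu>2"
    have "\<bar>expectation (\<lambda>\<omega>. g \<omega> z)\<bar> \<le> 1"
    proof -
      have "\<bar>expectation (\<lambda>\<omega>. g \<omega> z)\<bar> \<le> expectation (\<lambda>\<omega>. \<bar>g \<omega> z\<bar>)" by (rule integral_abs_bound)
      also have "\<dots> \<le> expectation (\<lambda>\<omega>. 1)"
        using g_bound[of _ z] by (intro integral_mono integrable_const_bound[where B=1]) (auto simp: g_def)
      finally show ?thesis by (simp add: prob_space)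
    qed
    then show "expectation (\<lambda>\<omega>. g \<omega> z) - ?m (fst z) * ?m (snd z)
        \<le> 2 * indicator {z \<in> space ?\<nu>2. dist (fst z) (snd z) < R} z"
      using uncorr[of "fst z" "snd z"] mm_bound[of z] z by (auto simp: g_def indicator_def)
  next
    show "integrable ?\<nu>2 (\<lambda>z. expectation (\<lambda>\<omega>. g \<omega> z) - ?m (fst z) * ?m (snd z))"
      by (intro Bochner_Integration.integrable_diff g_exp mm_int)
    show "integrable ?\<nu>2 (\<lambda>z. 2 * indicator {z \<in> space ?\<nu>2. dist (fst z) (snd z) < R} z :: real)"
      using D by (intro N2.integrable_const_bound[where B=2]) (auto simp: indicator_def)
  qed
  also have "\<dots> = 2 * measure ?\<nu>2 {z \<in> space ?\<nu>2. dist (fst z) (snd z) < R}"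
    using D by simp
  also have "measure ?\<nu>2 {z \<in> space ?\<nu>2. dist (fst z) (snd z) < R} \<le> b * measure \<nu> UNIV"
  proof -
    have b0: "0 \<le> b" using ball[of 0] measure_nonneg order_trans by blast
    have "emeasure ?\<nu>2 {z \<in> space ?\<nu>2. dist (fst z) (snd z) < R} =
        (\<integral>\<^sup>+u. emeasure \<nu> (Pair u -` {z \<in> space ?\<nu>2. dist (fst z) (snd z) < R}) \<partial>\<nu>)"
      by (rule N.emeasure_pair_measure_alt[OF D])
    also have "\<dots> \<le> (\<integral>\<^sup>+u. ennreal b \<partial>\<nu>)"
    proof (rule nn_integral_mono)
      fix u
      have "Pair u -` {z \<in> space ?\<nu>2. dist (fst z) (snd z) < R} = ball u R"
        by (auto simp: space_pair_measure space\<nu>)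
      then show "emeasure \<nu> (Pair u -` {z \<in> space ?\<nu>2. dist (fst z) (snd z) < R}) \<le> ennreal b"
        using ball[of u] by (simp add: N.emeasure_eq_measure ennreal_leI)
    qed
    also have "\<dots> = ennreal (b * measure \<nu> UNIV)"
      using b0 by (simp add: N.emeasure_eq_measure space\<nu> ennreal_mult)
    finally show ?thesis
      using b0 by (simp add: N2.emeasure_eq_measure ennreal_le_iff)
  qed
  finally show ?thesis by simp
qed

text \<open>The two integrals differ by at most J, the \<nu>-measure of the bad points. With L the
  total mass, J \<le> L gives J^2 \<le> L J, and Fubini gives E J \<le> L p, so pointwise failure
  probabilities suffice.\<close>

lemma (in prob_space) variance_approximation_le:
  fixes f h :: "'a \<Rightarrow> 'b \<Rightarrow> real" and bad :: "'a \<Rightarrow> 'b \<Rightarrow> bool"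
  assumes \<nu>: "finite_measure \<nu>"
    and f: "(\<lambda>(\<omega>, u). f \<omega> u) \<in> borel_measurable (M \<Otimes>\<^sub>M \<nu>)"
    and h: "(\<lambda>(\<omega>, u). h \<omega> u) \<in> borel_measurable (M \<Otimes>\<^sub>M \<nu>)"
    and bad: "Measurable.pred (M \<Otimes>\<^sub>M \<nu>) (\<lambda>(\<omega>, u). bad \<omega> u)"
    and bound: "\<And>\<omega> u. \<bar>f \<omega> u\<bar> \<le> 1" "\<And>\<omega> u. \<bar>h \<omega> u\<bar> \<le> 1"
    and diff: "\<And>\<omega> u. \<omega> \<in> space M \<Longrightarrow> \<bar>h \<omega> u - f \<omega> u\<bar> \<le> indicator {u. bad \<omega> u} u"
    and p: "\<And>u. u \<in> space \<nu> \<Longrightarrow> prob {\<omega> \<in> space M. bad \<omega> u} \<le> p"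
  shows "variance (\<lambda>\<omega>. \<integral>u. h \<omega> u \<partial>\<nu>) \<le>
    2 * variance (\<lambda>\<omega>. \<integral>u. f \<omega> u \<partial>\<nu>) + 2 * (measure \<nu> (space \<nu>))\<^sup>2 * p"
proof -
  interpret N: finite_measure \<nu> by fact
  interpret MN: pair_sigma_finite M \<nu> ..
  interpret FMN: finite_measure "M \<Otimes>\<^sub>M \<nu>"
    by (rule finite_measure_pair_measure[OF \<nu> finite_measure_axioms])
  let ?L = "measure \<nu> (space \<nu>)"
  have int: "integrable M (\<lambda>\<omega>. \<integral>u. k \<omega> u \<partial>\<nu>)" "integrable M (\<lambda>\<omega>. (\<integral>u. k \<omega> u \<partial>\<nu>)\<^sup>2)"
    "\<And>\<omega>. \<omega> \<in> space M \<Longrightarrow> \<bar>\<integral>u. k \<omega> u \<partial>\<nu>\<bar> \<le> ?L"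
    "\<And>\<omega>. \<omega> \<in> space M \<Longrightarrow> integrable \<nu> (k \<omega>)"
    if k: "(\<lambda>(\<omega>, u). k \<omega> u) \<in> borel_measurable (M \<Otimes>\<^sub>M \<nu>)" "\<And>\<omega> u. \<bar>k \<omega> u\<bar> \<le> 1" for k :: "'a \<Rightarrow> 'b \<Rightarrow> real"
  proof -
    have sec[measurable]: "k \<omega> \<in> borel_measurable \<nu>" if "\<omega> \<in> space M" for \<omega>
      using measurable_compose[OF measurable_Pair1'[OF that] k(1)] by simp
    have ki: "integrable (M \<Otimes>\<^sub>M \<nu>) (\<lambda>(\<omega>, u). k \<omega> u)"
      using k(2) by (intro FMN.integrable_const_bound[where B=1] k(1)) (auto simp: split_beta')
    show "integrable M (\<lambda>\<omega>. \<integral>u. k \<omega> u \<partial>\<nu>)" by (rule MN.integrable_fst[OF ki])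
    then have [measurable]: "(\<lambda>\<omega>. \<integral>u. k \<omega> u \<partial>\<nu>) \<in> borel_measurable M" by (rule borel_measurable_integrable)
    show i: "integrable \<nu> (k \<omega>)" if "\<omega> \<in> space M" for \<omega>
      using k(2) that by (intro N.integrable_const_bound[where B=1]) auto
    show b: "\<bar>\<integral>u. k \<omega> u \<partial>\<nu>\<bar> \<le> ?L" if "\<omega> \<in> space M" for \<omega>
    proof -
      have "\<bar>\<integral>u. k \<omega> u \<partial>\<nu>\<bar> \<le> (\<integral>u. \<bar>k \<omega> u\<bar> \<partial>\<nu>)" by (rule integral_abs_bound)
      also have "\<dots> \<le> (\<integral>u. 1 \<partial>\<nu>)"
        using k(2) i[OF that] by (intro integral_mono) auto
      finally show ?thesis by simp
    qed
    show "integrable M (\<lambda>\<omega>. (\<integral>u. k \<omega> u \<partial>\<nu>)\<^sup>2)"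
      using b by (intro integrable_const_bound[where B="?L\<^sup>2"])
        (auto intro!: AE_I2 abs_le_square_iff[THEN iffD1])
  qed
  define F where "F \<omega> = (\<integral>u. f \<omega> u \<partial>\<nu>)" for \<omega>
  define H where "H \<omega> = (\<integral>u. h \<omega> u \<partial>\<nu>)" for \<omega>
  define J where "J \<omega> = (\<integral>u. indicator {u. bad \<omega> u} u \<partial>\<nu> :: real)" for \<omega> :: 'a
  note Fi = int[OF f bound(1), folded F_def] and Hi = int[OF h bound(2), folded H_def]
  have bad': "(\<lambda>(\<omega>, u). indicator {u. bad \<omega> u} u :: real) \<in> borel_measurable (M \<Otimes>\<^sub>M \<nu>)"
    using bad by (simp add: indicator_def split_beta')
  have "\<bar>indicator {u. bad \<omega> u} u :: real\<bar> \<le> 1" for \<omega> u by (simp add: indicator_def)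
  note Ji = int[OF bad' this, folded J_def]
  have J0: "0 \<le> J \<omega>" for \<omega> unfolding J_def by (intro integral_nonneg_AE) auto
  have dif: "\<bar>H \<omega> - F \<omega>\<bar> \<le> J \<omega>" if \<omega>: "\<omega> \<in> space M" for \<omega>
  proof -
    have "H \<omega> - F \<omega> = (\<integral>u. h \<omega> u - f \<omega> u \<partial>\<nu>)"
      unfolding H_def F_def using Fi(4)[OF \<omega>] Hi(4)[OF \<omega>] by simp
    also have "\<bar>\<dots>\<bar> \<le> (\<integral>u. \<bar>h \<omega> u - f \<omega> u\<bar> \<partial>\<nu>)" by (rule integral_abs_bound)
    also have "\<dots> \<le> J \<omega>"
      unfolding J_def using Fi(4)[OF \<omega>] Hi(4)[OF \<omega>] Ji(4)[OF \<omega>] diff[OF \<omega>] by (intro integral_mono) auto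
    finally show ?thesis .
  qed
  have "expectation J \<le> ?L * p"
  proof -
    have ji: "integrable (M \<Otimes>\<^sub>M \<nu>) (\<lambda>(\<omega>, u). indicator {u. bad \<omega> u} u :: real)"
      by (intro FMN.integrable_const_bound[where B=1] bad') (auto simp: split_beta' indicator_def)
    have "expectation J = (\<integral>u. expectation (\<lambda>\<omega>. indicator {u. bad \<omega> u} u) \<partial>\<nu>)"
      unfolding J_def by (rule MN.Fubini_integral[OF ji, symmetric])
    also have "\<dots> \<le> (\<integral>u. p \<partial>\<nu>)"
    proof (rule integral_mono[OF MN.integrable_snd[OF ji]])
      fix u assume u: "u \<in> space \<nu>"
      have "{\<omega> \<in> space M. bad \<omega> u} \<in> sets M"
        using measurable_compose[OF measurable_Pair2'[OF u] bad] by (simp add: pred_def)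
      moreover have "expectation (\<lambda>\<omega>. indicator {u. bad \<omega> u} u :: real) = expectation (indicator {\<omega> \<in> space M. bad \<omega> u})"
        by (intro Bochner_Integration.integral_cong) (auto simp: indicator_def)
      ultimately show "expectation (\<lambda>\<omega>. indicator {u. bad \<omega> u} u) \<le> p"
        using p[OF u] by simp
    qed simp
    finally show ?thesis by simp
  qed
  note [measurable] = borel_measurable_integrable[OF Fi(1)] borel_measurable_integrable[OF Hi(1)]
    borel_measurable_integrable[OF Ji(1)]
  let ?c = "expectation F"
  have "integrable M (\<lambda>\<omega>. (F \<omega> - ?c)\<^sup>2)"
    using Fi(1,2) by (simp add: power2_diff)
  moreover have "integrable M (\<lambda>\<omega>. ?L * J \<omega>)" using Ji(1) by simp
  moreover have "integrable M (\<lambda>\<omega>. (H \<omega> - ?c)\<^sup>2)"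
    using Hi(1,2) by (simp add: power2_diff)
  moreover have "(H \<omega> - ?c)\<^sup>2 \<le> 2 * (F \<omega> - ?c)\<^sup>2 + 2 * (?L * J \<omega>)" if \<omega>: "\<omega> \<in> space M" for \<omega>
  proof -
    have "(H \<omega> - F \<omega>)\<^sup>2 \<le> (J \<omega>)\<^sup>2" using dif[OF \<omega>] J0[of \<omega>] by (simp add: abs_le_square_iff[symmetric])
    also have "\<dots> \<le> ?L * J \<omega>"
      using J0[of \<omega>] Ji(3)[OF \<omega>] by (simp add: power2_eq_square mult_right_mono)
    finally have 1: "(H \<omega> - F \<omega>)\<^sup>2 \<le> ?L * J \<omega>" .
    \<comment> \<open>The inequality (a + b)^2 \<le> 2 a^2 + 2 b^2, obtained from (a - b)^2 \<ge>
      0.\<close>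
    have "(H \<omega> - ?c)\<^sup>2 \<le> 2 * (F \<omega> - ?c)\<^sup>2 + 2 * (H \<omega> - F \<omega>)\<^sup>2"
      using zero_le_power2[of "(F \<omega> - ?c) - (H \<omega> - F \<omega>)"] by (simp add: power2_eq_square algebra_simps)
    then show ?thesis using 1 by linarith
  qed
  ultimately have "expectation (\<lambda>\<omega>. (H \<omega> - ?c)\<^sup>2) \<le> expectation (\<lambda>\<omega>. 2 * (F \<omega> - ?c)\<^sup>2 + 2 * (?L * J \<omega>))"
    by (intro integral_mono) auto
  also have "\<dots> = 2 * variance F + 2 * (?L * expectation J)"
    using \<open>integrable M (\<lambda>\<omega>. (F \<omega> - ?c)\<^sup>2)\<close> Ji(1) by simp
  also have "\<dots> \<le> 2 * variance F + 2 * (?L * (?L * p))"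
    using \<open>expectation J \<le> ?L * p\<close> by (intro add_mono mult_left_mono) auto
  finally show ?thesis
    using variance_le_second_moment[OF Hi(1,2), of ?c]
    by (simp add: F_def[symmetric] H_def[symmetric] power2_eq_square mult.assoc)
qed

section \<open>The variance estimate\<close>

lemma (in prob_space) variance_cong:
  fixes X Y :: "'a \<Rightarrow> real"
  assumes "\<And>\<omega>. \<omega> \<in> space M \<Longrightarrow> X \<omega> = Y \<omega>"
  shows "variance X = variance Y"
proof -
  have "expectation X = expectation Y" using assms by (intro Bochner_Integration.integral_cong) auto
  then show ?thesis using assms by (intro Bochner_Integration.integral_cong) auto
qed

lemma (in prob_space) variance_add_const:
  fixes X :: "'a \<Rightarrow> real"
  assumes "integrable M X" shows "variance (\<lambda>\<omega>. c + X \<omega>) = variance X"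
  using assms by (simp add: prob_space)

text \<open>Union bound over the balls of radius d/2 indexed by T, each empty with the Poisson void
  probability.\<close>

lemma prob_not_filled_le:
  fixes \<Gamma> :: "'w \<Rightarrow> 'a::euclidean_space set"
  assumes M: "prob_space M" and P: "stationary_poisson_process M \<Gamma> \<gamma>" and \<gamma>: "\<gamma> > 0"
    and T: "covering T" and d: "d > 0"
  shows "measure M {\<omega> \<in> space M. \<not> filled T u d (\<Gamma> \<omega>)} \<le>
    real (card T) * exp (- \<gamma> * (unit_ball_vol (real DIM('a)) * (d / 2) ^ DIM('a)))"
proof -
  interpret prob_space M by fact
  have pp: "point_process M \<Gamma>"
    using P by (simp add: stationary_poisson_process_def poisson_process_def)
  have T': "finite T" using T by (simp add: covering_def)
  let ?E = "\<lambda>t. {\<omega> \<in> space M. \<Gamma> \<omega> \<inter> ball (u + d *\<^sub>R t) (d/2) = {}}"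
  have E: "?E t \<in> events" for t
  proof -
    have "?E t = {\<omega> \<in> space M. point_count (\<Gamma> \<omega>) (ball (u + d *\<^sub>R t) (d/2)) = 0}"
      by (auto simp: point_count_def emeasure_count_space_eq_0)
    also have "\<dots> \<in> events"
    proof -
      have [measurable]: "(\<lambda>\<omega>. point_count (\<Gamma> \<omega>) (ball (u + d *\<^sub>R t) (d/2))) \<in> borel_measurable M"
        using pp by (simp add: point_process_def)
      show ?thesis by measurable
    qed
    finally show ?thesis .
  qed
  have "{\<omega> \<in> space M. \<not> filled T u d (\<Gamma> \<omega>)} = (\<Union>t\<in>T. ?E t)" by (auto simp: filled_def)
  then have "prob {\<omega> \<in> space M. \<not> filled T u d (\<Gamma> \<omega>)} \<le> (\<Sum>t\<in>T. prob (?E t))"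
    using finite_measure_subadditive_finite[OF T', of ?E] E by auto
  also have "\<dots> = (\<Sum>t\<in>T. exp (- \<gamma> * (unit_ball_vol (real DIM('a)) * (d / 2) ^ DIM('a))))"
  proof (rule sum.cong[OF refl])
    fix t
    show "prob (?E t) = exp (- \<gamma> * (unit_ball_vol (real DIM('a)) * (d / 2) ^ DIM('a)))"
      using d emeasure_bounded_finite[OF bounded_ball, of "u + d *\<^sub>R t" "d/2"]
      by (subst poisson_void_probability[OF M P \<gamma>]) (auto simp: content_ball)
  qed
  finally show ?thesis by simp
qed

text \<open>Bernoulli's inequality (1 - \<delta>/r)^D \<ge> 1 - D \<delta>/r, with D the
  dimension.\<close>

lemma measure_shell_le:
  assumes "0 < r" "0 \<le> \<delta>" "\<delta> \<le> r"
  shows "measure lborel (cball 0 r - ball (0::'a::euclidean_space) (r - \<delta>)) \<le>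
    unit_ball_vol (real DIM('a)) * r ^ DIM('a) * (real DIM('a) * \<delta> / r)"
proof -
  let ?V = "unit_ball_vol (real DIM('a))"
  have "measure lborel (cball 0 r - ball (0::'a) (r - \<delta>)) = measure lborel (cball (0::'a) r) - measure lborel (ball (0::'a) (r - \<delta>))"
    using assms emeasure_bounded_finite[OF bounded_cball, of "0::'a" r] by (intro measure_Diff) auto
  also have "\<dots> = ?V * r ^ DIM('a) - ?V * (r - \<delta>) ^ DIM('a)"
    using assms by (simp add: content_ball content_cball)
  also have "(r - \<delta>) ^ DIM('a) = r ^ DIM('a) * (1 + - \<delta> / r) ^ DIM('a)"
    using assms by (simp add: power_mult_distrib[symmetric] field_simps)
  also have "?V * r ^ DIM('a) - ?V * (r ^ DIM('a) * (1 + - \<delta> / r) ^ DIM('a)) =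
      ?V * r ^ DIM('a) * (1 - (1 + - \<delta> / r) ^ DIM('a))"
    by (simp add: algebra_simps)
  also have "\<dots> \<le> ?V * r ^ DIM('a) * (real DIM('a) * \<delta> / r)"
    using Bernoulli_inequality[of "- \<delta> / r" "DIM('a)"] assms by (intro mult_left_mono) auto
  finally show ?thesis .
qed

text \<open>At distance at least 10 d the balls of radius 5 d are disjoint, and the two values are
  functions of the independent restrictions of \<Gamma> to them.\<close>

lemma uncorrelated_local_excess:
  fixes \<Gamma> :: "'w \<Rightarrow> (real ^ 'n::{finite,linorder}) set"
  assumes M: "prob_space M" and P: "stationary_poisson_process M \<Gamma> \<gamma>" and \<gamma>: "\<gamma> > 0"
    and W: "W \<in> lmeasurable" "W \<in> sets borel" "W \<noteq> {}" and \<alpha>: "0 < \<alpha>" "\<alpha> \<le> 1"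
    and T: "covering T" "d > 0" and A: "A \<in> sets borel" and uv: "10 * d \<le> dist u v"
  shows "(\<integral>\<omega>. local_excess T d W \<alpha> A (\<Gamma> \<omega>) u * local_excess T d W \<alpha> A (\<Gamma> \<omega>) v \<partial>M) =
    (\<integral>\<omega>. local_excess T d W \<alpha> A (\<Gamma> \<omega>) u \<partial>M) * (\<integral>\<omega>. local_excess T d W \<alpha> A (\<Gamma> \<omega>) v \<partial>M)"
proof -
  interpret prob_space M by fact
  have pp: "point_process M \<Gamma>"
    using P by (simp add: stationary_poisson_process_def poisson_process_def)
  let ?f = "\<lambda>u \<phi>. local_excess T d W \<alpha> A \<phi> u"
  let ?X = "\<lambda>u \<omega>. ?f u (\<Gamma> \<omega> \<inter> ball u (5 * d))"
  have loc: "?X u \<omega> = ?f u (\<Gamma> \<omega>)" if "\<omega> \<in> space M" for \<omega> u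
    using local_excess_local[OF T, of "\<Gamma> \<omega>"] pp that by (auto simp: point_process_def)
  have fm: "?f u \<in> borel_measurable config_algebra" for u
    using T(1) by (intro measurable_local_excess[OF W \<alpha>(1) point_process_config _ A]) (auto simp: covering_def)
  have "ball u (5 * d) \<inter> ball v (5 * d) = {}"
  proof -
    have False if "dist u y < 5 * d" "dist v y < 5 * d" for y
      using that uv dist_triangle2[of u v y] by linarith
    then show ?thesis by (auto simp: disjoint_iff)
  qed
  then have "indep_var config_algebra (\<lambda>\<omega>. \<Gamma> \<omega> \<inter> ball u (5 * d)) config_algebra (\<lambda>\<omega>. \<Gamma> \<omega> \<inter> ball v (5 * d))"
    using emeasure_bounded_finite[OF bounded_ball]
    by (intro indep_var_poisson_disjoint[OF M P \<gamma>]) auto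
  from indep_var_compose[OF this fm fm] have ind: "indep_var borel (?X u) borel (?X v)"
    by (simp add: o_def)
  have int: "integrable M (?X u)" for u
  proof (rule integrable_const_bound[where B=1])
    show "?X u \<in> borel_measurable M"
      using measurable_compose[OF point_process_measurable[OF point_process_Int[OF pp]] fm] by simp
  qed (simp add: abs_local_excess_le[OF \<alpha>])
  have "(\<integral>\<omega>. ?X u \<omega> * ?X v \<omega> \<partial>M) = (\<integral>\<omega>. ?X u \<omega> \<partial>M) * (\<integral>\<omega>. ?X v \<omega> \<partial>M)"
    by (rule indep_var_lebesgue_integral[OF ind int int])
  moreover have "(\<integral>\<omega>. ?X u \<omega> * ?X v \<omega> \<partial>M) = (\<integral>\<omega>. ?f u (\<Gamma> \<omega>) * ?f v (\<Gamma> \<omega>) \<partial>M)"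
    by (intro Bochner_Integration.integral_cong) (auto simp: loc)
  moreover have "(\<integral>\<omega>. ?X u \<omega> \<partial>M) = (\<integral>\<omega>. ?f u (\<Gamma> \<omega>) \<partial>M)" for u
    by (intro Bochner_Integration.integral_cong) (auto simp: loc)
  ultimately show ?thesis by simp
qed

text \<open>Lebesgue measure on a window is encoded as a density, so that its space stays the whole
  of R^d for every window.\<close>

lemma finite_measure_density_indicator:
  fixes A :: "'a::euclidean_space set"
  assumes "A \<in> sets borel" "bounded A"
  shows "finite_measure (density lborel (indicator A))"
    and "B \<in> sets borel \<Longrightarrow> measure (density lborel (indicator A)) B = measure lborel (A \<inter> B)"
proof -
  have e: "emeasure (density lborel (indicator A)) B = emeasure lborel (A \<inter> B)" if "B \<in> sets borel" for B
    using assms that by (simp add: emeasure_density indicator_inter_arith[symmetric])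
  show "finite_measure (density lborel (indicator A))"
    using e[of UNIV] emeasure_bounded_finite[OF assms(2)] by (intro finite_measureI) auto
  show "B \<in> sets borel \<Longrightarrow> measure (density lborel (indicator A)) B = measure lborel (A \<inter> B)"
    using e by (simp add: measure_def)
qed

lemma integral_density_indicator:
  fixes f :: "'a::euclidean_space \<Rightarrow> real"
  assumes "A \<in> sets borel" "f \<in> borel_measurable borel"
  shows "(\<integral>u. f u \<partial>density lborel (indicator A)) = (\<integral>u. indicator A u * f u \<partial>lborel)"
proof -
  have "density lborel (indicator A) = density lborel (\<lambda>x. ennreal (indicator A x))"
    by (simp add: ennreal_indicator)
  then show ?thesis using assms by (simp add: integral_density)
qed

lemma variance_volume_le:
  fixes \<Gamma> :: "'w \<Rightarrow> (real ^ 'n::{finite,linorder}) set" and T :: "(real ^ 'n::{finite,linorder}) set"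
  defines "D \<equiv> DIM((real, 'n) vec)" and "V \<equiv> unit_ball_vol (real DIM((real, 'n) vec))"
  assumes M: "prob_space M" and P: "stationary_poisson_process M \<Gamma> \<gamma>" and \<gamma>: "\<gamma> > 0"
    and W: "W \<in> lmeasurable" "W \<in> sets borel" "0 \<in> interior W" and \<alpha>: "0 < \<alpha>" "\<alpha> \<le> 1"
    and T: "covering T" "d > 0" and r: "3 * d \<le> r"
  shows "prob_space.variance M (\<lambda>\<omega>. measure (volume_measure (cell_filling_union W \<alpha> (\<Gamma> \<omega>))) (cball 0 r)) \<le>
    4 * (V * (10 * d) ^ D) * (V * r ^ D * (real D * (3 * d) / r)) +
    2 * (V * r ^ D)\<^sup>2 * (real (card T) * exp (- \<gamma> * (V * (d / 2) ^ D)))"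
proof -
  interpret prob_space M by fact
  have pp: "point_process M \<Gamma>"
    using P by (simp add: stationary_poisson_process_def poisson_process_def)
  have lf: "locally_finite (\<Gamma> \<omega>)" if "\<omega> \<in> space M" for \<omega>
    using pp that by (simp add: point_process_def)
  have Wne: "W \<noteq> {}" using W(3) interior_subset by blast
  have r0: "0 < r" using T(2) r by simp
  define A where "A = cball (0 :: (real, 'n) vec) r"
  define S where "S = A - ball 0 (r - 3 * d)"
  define \<nu> where "\<nu> B = density lborel (indicator B)" for B :: "(real, 'n) vec set"
  have A: "A \<in> sets borel" "bounded A" by (auto simp: A_def)
  have S: "S \<in> sets borel" "bounded S" unfolding S_def A_def by (auto intro: bounded_diff)
  have sets\<nu>: "sets (\<nu> B) = sets borel" for B by (simp add: \<nu>_def)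
  have space\<nu>: "space (\<nu> B) = UNIV" for B by (simp add: \<nu>_def)
  note fA = finite_measure_density_indicator[OF A, folded \<nu>_def]
    and fS = finite_measure_density_indicator[OF S, folded \<nu>_def]
  have mA: "measure lborel A = V * r ^ D" using r0 by (simp add: A_def V_def D_def content_cball)
  define h where "h \<omega> u = excess W \<alpha> A (\<Gamma> \<omega>) u" for \<omega> u
  define f where "f \<omega> u = local_excess T d W \<alpha> A (\<Gamma> \<omega>) u" for \<omega> u
  have cong\<nu>: "sets (M \<Otimes>\<^sub>M \<nu> B) = sets (M \<Otimes>\<^sub>M borel)" for B
    by (rule sets_pair_measure_cong[OF refl sets\<nu>])
  have pp2: "point_process (M \<Otimes>\<^sub>M (borel :: (real, 'n) vec measure)) (\<lambda>q. \<Gamma> (fst q))"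
    by (rule point_process_compose[OF pp]) measurable
  have hm: "(\<lambda>(\<omega>, u). h \<omega> u) \<in> borel_measurable (M \<Otimes>\<^sub>M \<nu> B)" for B
    unfolding measurable_cong_sets[OF cong\<nu> refl] h_def split_beta'
    by (rule measurable_excess[OF W(1,2) Wne \<alpha>(1) pp2 _ A(1)]) measurable
  have Tf: "finite T" using T(1) by (simp add: covering_def)
  have fm: "(\<lambda>(\<omega>, u). f \<omega> u) \<in> borel_measurable (M \<Otimes>\<^sub>M \<nu> B)" for B
    unfolding measurable_cong_sets[OF cong\<nu> refl] f_def split_beta'
    by (rule measurable_local_excess[OF W(1,2) Wne \<alpha>(1) pp2 _ A(1) Tf]) measurable
  have "Measurable.pred (M \<Otimes>\<^sub>M borel) (\<lambda>q. filled T (snd q) d (\<Gamma> (fst q)))"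
    by (rule pred_filled[OF pp2 _ Tf]) measurable
  then have "Measurable.pred (M \<Otimes>\<^sub>M borel) (\<lambda>q. \<not> filled T (snd q) d (\<Gamma> (fst q)))"
    by (rule pred_intros_logic)
  then have bm: "Measurable.pred (M \<Otimes>\<^sub>M \<nu> B) (\<lambda>(\<omega>, u). \<not> filled T u d (\<Gamma> \<omega>))" for B
    unfolding measurable_cong_sets[OF cong\<nu> refl] split_beta' .
  have h1: "\<bar>h \<omega> u\<bar> \<le> 1" and f1: "\<bar>f \<omega> u\<bar> \<le> 1" for \<omega> u
    by (simp_all add: h_def f_def abs_excess_le[OF \<alpha>] abs_local_excess_le[OF \<alpha>])
  define I where "I \<omega> = (\<integral>u. h \<omega> u \<partial>\<nu> A)" for \<omega>
  have I_int: "integrable M I"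
  proof -
    interpret N: finite_measure "\<nu> A" by (rule fA(1))
    interpret MN: pair_sigma_finite M "\<nu> A" ..
    interpret FMN: finite_measure "M \<Otimes>\<^sub>M \<nu> A"
      by (rule finite_measure_pair_measure[OF fA(1) finite_measure_axioms])
    have "integrable (M \<Otimes>\<^sub>M \<nu> A) (\<lambda>(\<omega>, u). h \<omega> u)"
      using h1 by (intro FMN.integrable_const_bound[where B=1] hm) (auto simp: split_beta')
    then show ?thesis unfolding I_def by (rule MN.integrable_fst)
  qed
  have "measure (volume_measure (cell_filling_union W \<alpha> (\<Gamma> \<omega>))) A = \<alpha> * measure lborel A + I \<omega>"
    if \<omega>: "\<omega> \<in> space M" for \<omega>
  proof -
    have "(\<lambda>u. h \<omega> u) \<in> borel_measurable borel"
      using measurable_excess[OF W(1,2) Wne \<alpha>(1), of borel "\<lambda>_. \<Gamma> \<omega>" "\<lambda>u. u" A] A(1) lf[OF \<omega>]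
      by (simp add: h_def point_process_def)
    then have "I \<omega> = (\<integral>u. indicator A u * h \<omega> u \<partial>lborel)"
      unfolding I_def \<nu>_def by (rule integral_density_indicator[OF A(1)])
    then show ?thesis
      using measure_volume_measure_eq[OF W \<alpha> lf[OF \<omega>] A(1) emeasure_bounded_finite[OF A(2)]]
      by (simp add: h_def)
  qed
  then have "variance (\<lambda>\<omega>. measure (volume_measure (cell_filling_union W \<alpha> (\<Gamma> \<omega>))) A) =
      variance (\<lambda>\<omega>. \<alpha> * measure lborel A + I \<omega>)"
    by (rule variance_cong)
  also have "\<dots> = variance I" by (rule variance_add_const[OF I_int])
  \<comment> \<open>The comparison runs over all of A: h may be nonzero deep inside A when there is
    a gap, and the exponential term pays for this.\<close>
  also have "\<dots> \<le> 2 * variance (\<lambda>\<omega>. \<integral>u. f \<omega> u \<partial>\<nu> A) +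
      2 * (measure (\<nu> A) (space (\<nu> A)))\<^sup>2 * (real (card T) * exp (- \<gamma> * (V * (d / 2) ^ D)))"
    unfolding I_def
  proof (rule variance_approximation_le[OF fA(1) fm hm bm f1 h1])
    show "\<bar>h \<omega> u - f \<omega> u\<bar> \<le> indicator {u. \<not> filled T u d (\<Gamma> \<omega>)} u" for \<omega> u
      using h1[of \<omega> u] by (simp add: h_def f_def local_excess_def)
    show "prob {\<omega> \<in> space M. \<not> filled T u d (\<Gamma> \<omega>)} \<le> real (card T) * exp (- \<gamma> * (V * (d / 2) ^ D))" for u
      using prob_not_filled_le[OF M P \<gamma> T] by (simp add: V_def D_def)
  qed
  also have "measure (\<nu> A) (space (\<nu> A)) = V * r ^ D" using fA(2)[of UNIV] mA by (simp add: space\<nu>)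
  \<comment> \<open>The cut-off field lives on the shell of width 3 d. Restricting to it before
    using local dependence replaces the mass r^D by one of order r^(D-1) d.\<close>
  also have "variance (\<lambda>\<omega>. \<integral>u. f \<omega> u \<partial>\<nu> A) = variance (\<lambda>\<omega>. \<integral>u. f \<omega> u \<partial>\<nu> S)"
  proof (rule variance_cong)
    fix \<omega> assume \<omega>: "\<omega> \<in> space M"
    have [measurable]: "(\<lambda>u. f \<omega> u) \<in> borel_measurable borel"
      using measurable_local_excess[OF W(1,2) Wne \<alpha>(1), of borel "\<lambda>_. \<Gamma> \<omega>" "\<lambda>u. u" A T] A(1) lf[OF \<omega>] Tf
      by (simp add: f_def point_process_def)
    have ind: "(\<integral>u. f \<omega> u \<partial>\<nu> B) = (\<integral>u. indicator B u * f \<omega> u \<partial>lborel)" if "B \<in> sets borel" for B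
      unfolding \<nu>_def by (rule integral_density_indicator[OF that]) measurable
    have "f \<omega> u = 0" if "u \<in> A" "u \<notin> S" for u
      using that local_excess_eq_0[OF T lf[OF \<omega>], of u r] by (auto simp: S_def f_def A_def)
    then show "(\<integral>u. f \<omega> u \<partial>\<nu> A) = (\<integral>u. f \<omega> u \<partial>\<nu> S)"
      unfolding ind[OF A(1)] ind[OF S(1)]
      by (intro Bochner_Integration.integral_cong) (auto simp: S_def indicator_def)
  qed
  also have "variance (\<lambda>\<omega>. \<integral>u. f \<omega> u \<partial>\<nu> S) \<le> 2 * (V * (10 * d) ^ D) * measure (\<nu> S) UNIV"
  proof (rule variance_local_field_le[OF fS(1) sets\<nu> fm f1])
    show "expectation (\<lambda>\<omega>. f \<omega> u * f \<omega> v) = expectation (\<lambda>\<omega>. f \<omega> u) * expectation (\<lambda>\<omega>. f \<omega> v)"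
      if "10 * d \<le> dist u v" for u v
      unfolding f_def by (rule uncorrelated_local_excess[OF M P \<gamma> W(1,2) Wne \<alpha> T A(1) that])
    show "measure (\<nu> S) (ball u (10 * d)) \<le> V * (10 * d) ^ D" for u
    proof -
      have "measure lborel (S \<inter> ball u (10 * d)) \<le> measure lborel (ball u (10 * d))"
        using S(1) emeasure_bounded_finite[OF bounded_ball, of u "10 * d"]
        by (intro measure_mono_fmeasurable) (auto simp: fmeasurable_def)
      then show ?thesis using fS(2)[of "ball u (10 * d)"] T(2) by (simp add: V_def D_def content_ball)
    qed
  qed
  also have "measure (\<nu> S) UNIV \<le> V * r ^ D * (real D * (3 * d) / r)"
    using fS(2)[of UNIV] measure_shell_le[of r "3 * d", where 'a = "(real, 'n) vec"] r r0 T(2)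
    by (simp add: S_def A_def V_def D_def)
  finally show ?thesis
    using T(2) unfolding A_def by (simp add: V_def mult.assoc)
qed

section \<open>The limit with a growing scale\<close>

lemma tendsto_power_mult_exp_neg:
  fixes c :: real
  assumes "c > 0" shows "((\<lambda>s. s ^ k * exp (- (c * s))) \<longlongrightarrow> 0) at_top"
proof -
  have "filterlim (\<lambda>s. c * s) at_top at_top"
    using assms by (intro filterlim_tendsto_pos_mult_at_top[OF tendsto_const _ filterlim_ident])
  from filterlim_compose[OF tendsto_power_div_exp_0 this]
  have "((\<lambda>s. (1 / c ^ k) * ((c * s) ^ k / exp (c * s))) \<longlongrightarrow> (1 / c ^ k) * 0) at_top"
    by (intro tendsto_intros)
  then show ?thesis using assms by (simp add: power_mult_distrib exp_minus field_simps)
qed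

lemma variance_volume_tendsto:
  fixes \<Gamma> :: "'w \<Rightarrow> (real ^ 'n::{finite,linorder}) set"
  assumes M: "prob_space M" and P: "stationary_poisson_process M \<Gamma> \<gamma>" and \<gamma>: "\<gamma> > 0"
    and W: "W \<in> lmeasurable" "W \<in> sets borel" "0 \<in> interior W" and \<alpha>: "0 < \<alpha>" "\<alpha> \<le> 1"
  shows "((\<lambda>r. prob_space.variance M (\<lambda>\<omega>. measure (volume_measure (cell_filling_union W \<alpha> (\<Gamma> \<omega>))) (cball 0 r)) /
           measure lborel (cball (0 :: (real, 'n) vec) r)) \<longlongrightarrow> 0) at_top"
proof -
  interpret prob_space M by fact
  define D where "D = DIM((real, 'n) vec)"
  define V where "V = unit_ball_vol (real D)"
  have D: "D \<ge> 1" and V: "V > 0" by (simp_all add: D_def V_def DIM_positive Suc_leI)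
  obtain T :: "(real, 'n) vec set" where T: "covering T" using ex_covering by blast
  let ?v = "\<lambda>r. variance (\<lambda>\<omega>. measure (volume_measure (cell_filling_union W \<alpha> (\<Gamma> \<omega>))) (cball 0 r))"
  let ?c = "\<gamma> * V / 2 ^ D"
  \<comment> \<open>The bound of \<open>variance_volume_le\<close> divided by V r^D, with d = s and
    r = s^(2(D+1)). In the shell term s^(D+1)/r = 1/s^(D+1), and 12 is 4 times 3; the gap term keeps
    r^D = s^(2(D+1)D) against an exponential.\<close>
  define H where "H s = 12 * real D * V * 10 ^ D * (1 / s ^ Suc D) +
      2 * V * real (card T) * (s ^ (2 * Suc D * D) * exp (- (?c * s)))" for s :: real
  have "((\<lambda>s::real. 1 / s ^ Suc D) \<longlongrightarrow> 0) at_top"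
    by (intro tendsto_divide_0[OF tendsto_const] filterlim_at_top_imp_at_infinity filterlim_pow_at_top filterlim_ident) simp
  moreover have "((\<lambda>s. s ^ (2 * Suc D * D) * exp (- (?c * s))) \<longlongrightarrow> 0) at_top"
    using \<gamma> V by (intro tendsto_power_mult_exp_neg) simp
  ultimately have "(H \<longlongrightarrow> 12 * real D * V * 10 ^ D * 0 + 2 * V * real (card T) * 0) at_top"
    unfolding H_def by (intro tendsto_intros)
  then have H0: "(H \<longlongrightarrow> 0) at_top" by simp
  let ?s = "\<lambda>r::real. root (2 * Suc D) r"
  have s_top: "filterlim ?s at_top at_top"
    unfolding filterlim_at_top
  proof (intro allI)
    fix Z :: real
    have "eventually (\<lambda>r::real. r \<ge> \<bar>Z\<bar> ^ (2 * Suc D)) at_top" by (rule eventually_ge_at_top)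
    then show "eventually (\<lambda>r. Z \<le> ?s r) at_top"
    proof eventually_elim
      case (elim r)
      have "\<bar>Z\<bar> = root (2 * Suc D) (\<bar>Z\<bar> ^ (2 * Suc D))" by (rule real_root_power_cancel[symmetric]) auto
      also have "\<dots> \<le> ?s r" using elim by (intro real_root_le_mono) auto
      finally show ?case by simp
    qed
  qed
  have lim: "((\<lambda>r. H (?s r)) \<longlongrightarrow> 0) at_top" by (rule filterlim_compose[OF H0 s_top])
  \<comment> \<open>For s \<ge> 3 one has 3 s \<le> s^2 \<le> r, as required for the width 3 d of
    the shell.\<close>
  have "eventually (\<lambda>r. ?s r \<ge> 3) at_top" using s_top by (simp add: filterlim_at_top)
  then have upper: "eventually (\<lambda>r. ?v r / measure lborel (cball (0 :: (real, 'n) vec) r) \<le> H (?s r)) at_top"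
    using eventually_gt_at_top[of 0]
  proof eventually_elim
    case (elim r)
    define s where "s = ?s r"
    have s: "s \<ge> 3" using elim by (simp add: s_def)
    have rs: "r = s ^ (2 * Suc D)"
      unfolding s_def using elim by (intro real_root_pow_pos2[symmetric]) auto
    have "3 * s \<le> s * s" using s by (intro mult_right_mono) auto
    also have "s * s = s ^ 2" by (simp add: power2_eq_square)
    also have "s ^ 2 \<le> s ^ (2 * Suc D)" using s by (intro power_increasing) auto
    finally have "3 * s \<le> r" by (simp only: rs)
    moreover have "s > 0" using s by simp
    ultimately have v: "?v r \<le> 4 * (V * (10 * s) ^ D) * (V * r ^ D * (real D * (3 * s) / r)) +
        2 * (V * r ^ D)\<^sup>2 * (real (card T) * exp (- \<gamma> * (V * (s / 2) ^ D)))"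
      using variance_volume_le[OF M P \<gamma> W \<alpha> T, of s r] by (simp add: V_def D_def)
    have Vr: "measure lborel (cball (0 :: (real, 'n) vec) r) = V * r ^ D"
      using elim by (simp add: V_def D_def content_cball)
    have pos: "V * r ^ D > 0" using V elim by simp
    \<comment> \<open>Weakens the exponent from s^D to s, for which the limit of a power times an
      exponential is at hand.\<close>
    have "s ^ 1 \<le> s ^ D" using s D by (intro power_increasing) auto
    then have "?c * s \<le> ?c * s ^ D" using \<gamma> V by (intro mult_left_mono) auto
    then have e: "exp (- \<gamma> * (V * (s / 2) ^ D)) \<le> exp (- (?c * s))" by (simp add: power_divide)
    have "?v r / (V * r ^ D) \<le> (4 * (V * (10 * s) ^ D) * (V * r ^ D * (real D * (3 * s) / r)) +
        2 * (V * r ^ D)\<^sup>2 * (real (card T) * exp (- \<gamma> * (V * (s / 2) ^ D)))) / (V * r ^ D)"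
      using v pos by (intro divide_right_mono) auto
    also have "\<dots> = 4 * (V * (10 * s) ^ D) * (real D * (3 * s) / r) +
        2 * (V * r ^ D) * (real (card T) * exp (- \<gamma> * (V * (s / 2) ^ D)))"
    proof -
      have "(4 * a * (x * b) + 2 * x\<^sup>2 * y) / x = 4 * a * b + 2 * x * y" if "x > 0" for a b x y :: real
        using that by (simp add: field_simps power2_eq_square)
      from this[OF pos] show ?thesis .
    qed
    also have "\<dots> \<le> 4 * (V * (10 * s) ^ D) * (real D * (3 * s) / r) +
        2 * (V * r ^ D) * (real (card T) * exp (- (?c * s)))"
      using e pos by (intro add_left_mono mult_left_mono) auto
    also have "4 * (V * (10 * s) ^ D) * (real D * (3 * s) / r) = 12 * real D * V * 10 ^ D * (1 / s ^ Suc D)"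
    proof -
      have "r = s ^ Suc D * s ^ Suc D" by (simp only: rs mult_2 power_add)
      moreover have "4 * (V * (10 * s) ^ D) * (real D * (3 * s)) = 12 * real D * V * 10 ^ D * s ^ Suc D"
        by (simp add: power_mult_distrib)
      ultimately show ?thesis using s by (simp add: divide_simps)
    qed
    also have "2 * (V * r ^ D) * (real (card T) * exp (- (?c * s))) =
        2 * V * real (card T) * (s ^ (2 * Suc D * D) * exp (- (?c * s)))"
    proof -
      have "r ^ D = s ^ (2 * Suc D * D)" by (simp only: rs power_mult[symmetric])
      then show ?thesis by simp
    qed
    finally show ?case by (simp add: H_def s_def Vr)
  qed
  show ?thesis
  proof (rule tendsto_sandwich[OF _ upper tendsto_const lim])
    show "eventually (\<lambda>r. 0 \<le> ?v r / measure lborel (cball (0 :: (real, 'n) vec) r)) at_top"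
      by (intro always_eventually allI divide_nonneg_nonneg integral_nonneg_AE) auto
  qed
qed

lemma hyperuniform_volume_measure:
  fixes \<Gamma> :: "'w \<Rightarrow> (real ^ 'n::{finite,linorder}) set"
  assumes M: "prob_space M" and P: "stationary_poisson_process M \<Gamma> \<gamma>" and \<gamma>: "\<gamma> > 0"
    and W: "W \<in> lmeasurable" "W \<in> sets borel" "0 \<in> interior W" and \<alpha>: "0 < \<alpha>" "\<alpha> \<le> 1"
  shows "hyperuniform M (\<lambda>\<omega>. volume_measure (cell_filling_union W \<alpha> (\<Gamma> \<omega>)))"
  unfolding hyperuniform_def
proof (intro conjI ballI impI)
  interpret prob_space M by fact
  have "W \<noteq> {}" using W(3) interior_subset by blast
  then show "stationary_random_measure M (\<lambda>\<omega>. volume_measure (cell_filling_union W \<alpha> (\<Gamma> \<omega>)))"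
    using stationary_volume_measure[OF M P \<gamma> W(1,2) _ \<alpha>(1)] by blast
  fix B :: "(real, 'n) vec set" assume B: "B \<in> sets borel" "bounded B"
  have "(\<integral>\<^sup>+\<omega>. (emeasure (volume_measure (cell_filling_union W \<alpha> (\<Gamma> \<omega>))) B)\<^sup>2 \<partial>M) \<le> (\<integral>\<^sup>+\<omega>. (emeasure lborel B)\<^sup>2 \<partial>M)"
  proof (rule nn_integral_mono)
    fix \<omega> assume "\<omega> \<in> space M"
    then have "cell_filling_union W \<alpha> (\<Gamma> \<omega>) \<in> sets lebesgue"
      using P W(1) by (intro sets_cell_filling_union)
        (auto simp: stationary_poisson_process_def poisson_process_def point_process_def)
    then have "emeasure (volume_measure (cell_filling_union W \<alpha> (\<Gamma> \<omega>))) B \<le> emeasure lebesgue B"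
      using B emeasure_mono[of "cell_filling_union W \<alpha> (\<Gamma> \<omega>) \<inter> B" B lebesgue] by (simp add: emeasure_volume_measure)
    then show "(emeasure (volume_measure (cell_filling_union W \<alpha> (\<Gamma> \<omega>))) B)\<^sup>2 \<le> (emeasure lborel B)\<^sup>2"
      using B by (simp add: power_mono)
  qed
  also have "\<dots> < \<infinity>" using emeasure_bounded_finite[OF B(2)] by (simp add: emeasure_space_1 power2_eq_square ennreal_mult_less_top)
  finally show "(\<integral>\<^sup>+\<omega>. (emeasure (volume_measure (cell_filling_union W \<alpha> (\<Gamma> \<omega>))) B)\<^sup>2 \<partial>M) < \<infinity>" .
qed (rule variance_volume_tendsto[OF assms])

text \<open>Agreement on \<open>space M\<close> is all that is available, because configurations are
  locally finite only there.\<close>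

lemma hyperuniform_cong:
  assumes eq: "\<And>\<omega>. \<omega> \<in> space M \<Longrightarrow> \<Psi> \<omega> = \<Phi> \<omega>" and M: "prob_space M" and \<Phi>: "hyperuniform M \<Phi>"
  shows "hyperuniform M \<Psi>"
proof -
  interpret prob_space M by fact
  have "random_measure M \<Psi> = random_measure M \<Phi>"
    unfolding random_measure_def using eq by (rule measurable_cong)
  moreover have "distr M lf_measure_algebra (\<lambda>\<omega>. shift_measure y (\<Psi> \<omega>)) =
      distr M lf_measure_algebra (\<lambda>\<omega>. shift_measure y (\<Phi> \<omega>))" for y
    using eq by (intro distr_cong) auto
  moreover have "distr M lf_measure_algebra \<Psi> = distr M lf_measure_algebra \<Phi>"
    using eq by (intro distr_cong) auto
  moreover have "(\<integral>\<^sup>+\<omega>. (emeasure (\<Psi> \<omega>) B)\<^sup>2 \<partial>M) = (\<integral>\<^sup>+\<omega>. (emeasure (\<Phi> \<omega>) B)\<^sup>2 \<partial>M)" for B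
    using eq by (intro nn_integral_cong) auto
  moreover have "variance (\<lambda>\<omega>. measure (\<Psi> \<omega>) B) = variance (\<lambda>\<omega>. measure (\<Phi> \<omega>) B)" for B
    using eq by (intro variance_cong) auto
  ultimately show ?thesis
    using \<Phi> unfolding hyperuniform_def stationary_random_measure_def by simp
qed

theorem theorem9p1:
  fixes M :: "'w measure"
    and \<Gamma> :: "'w \<Rightarrow> (real ^ 'n::{finite,linorder}) set"
    and W :: "(real ^ 'n::{finite,linorder}) set"
    and \<gamma> \<alpha> :: real
  assumes "prob_space M"
    and "\<gamma> > 0"
    and "stationary_poisson_process M \<Gamma> \<gamma>"
    and "W \<in> sets lebesgue"
    and "emeasure lebesgue W < \<infinity>"
    and "0 \<in> interior W"
    and "0 < \<alpha>" and "\<alpha> \<le> 1"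
  defines "Z \<equiv> \<lambda>\<omega>. restricted_union W \<alpha> (\<Gamma> \<omega>)"
  defines "\<Psi> \<equiv> \<lambda>\<omega>. volume_measure (Z \<omega>)"
  shows "(\<forall>\<omega>\<in>space M. \<forall>B\<in>sets borel.
            emeasure (\<Psi> \<omega>) B = emeasure lebesgue (Z \<omega> \<inter> B) \<and>
            emeasure lebesgue (Z \<omega> \<inter> B) =
              (\<integral>\<^sup>+x. emeasure lebesgue (restricted_cell W \<alpha> (\<Gamma> \<omega>) x \<inter> B) \<partial>count_space (\<Gamma> \<omega>))) \<and>
         hyperuniform M \<Psi>"
proof -
  have lf: "locally_finite (\<Gamma> \<omega>)" if "\<omega> \<in> space M" for \<omega>
    using assms(3) that by (simp add: stationary_poisson_process_def poisson_process_def point_process_def)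
  have Z: "Z \<omega> = cell_filling_union W \<alpha> (\<Gamma> \<omega>)" if "\<omega> \<in> space M" for \<omega>
    unfolding Z_def by (rule restricted_union_eq[OF lf[OF that]])
  have "emeasure (\<Psi> \<omega>) B = emeasure lebesgue (Z \<omega> \<inter> B)"
    and "emeasure lebesgue (Z \<omega> \<inter> B) =
      (\<integral>\<^sup>+x. emeasure lebesgue (restricted_cell W \<alpha> (\<Gamma> \<omega>) x \<inter> B) \<partial>count_space (\<Gamma> \<omega>))"
    if "\<omega> \<in> space M" "B \<in> sets borel" for \<omega> B
  proof -
    show "emeasure (\<Psi> \<omega>) B = emeasure lebesgue (Z \<omega> \<inter> B)"
      unfolding \<Psi>_def Z[OF that(1)]
      by (rule emeasure_volume_measure[OF sets_cell_filling_union[OF lf[OF that(1)] assms(4)] that(2)])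
    show "emeasure lebesgue (Z \<omega> \<inter> B) =
        (\<integral>\<^sup>+x. emeasure lebesgue (restricted_cell W \<alpha> (\<Gamma> \<omega>) x \<inter> B) \<partial>count_space (\<Gamma> \<omega>))"
      unfolding Z[OF that(1)] emeasure_cell_filling_union[OF lf[OF that(1)] assms(4) that(2)]
      by (intro nn_integral_cong) (simp add: restricted_cell_eq_filling voronoi_cell_eq_cell[OF lf[OF that(1)]])
  qed
  moreover have "hyperuniform M \<Psi>"
  proof -
    \<comment> \<open>The Borel subset V gives the same measure for each locally finite
      configuration, so hyperuniformity carries over from V to W.\<close>
    obtain V where V: "V \<in> sets borel" "V \<subseteq> W" "interior W \<subseteq> interior V" "emeasure lebesgue (W - V) = 0"
      using ex_borel_subset[OF assms(4)] .
    have Vl: "V \<in> sets lebesgue" using V(1) by simp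
    have "emeasure lebesgue V \<le> emeasure lebesgue W" by (rule emeasure_mono[OF V(2) assms(4)])
    then have "V \<in> lmeasurable" using Vl assms(5) by (auto simp: fmeasurable_def)
    then have "hyperuniform M (\<lambda>\<omega>. volume_measure (cell_filling_union V \<alpha> (\<Gamma> \<omega>)))"
      using V assms by (intro hyperuniform_volume_measure[OF assms(1,3,2)]) auto
    moreover have "\<Psi> \<omega> = volume_measure (cell_filling_union V \<alpha> (\<Gamma> \<omega>))" if "\<omega> \<in> space M" for \<omega>
      unfolding \<Psi>_def Z[OF that]
      by (rule volume_measure_null_diff[OF V(2) assms(4) Vl V(4) lf[OF that]])
    ultimately show ?thesis using assms(1) by (intro hyperuniform_cong[of M \<Psi>]) auto
  qed
  ultimately show ?thesis by blast
qed

end
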